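(* Assume that $b<1$ and $\alpha_c'<\alpha<\alpha_c$. Let $a=a(\alpha,F)\in[b,1]$ be the unique solution to $\alpha\left\langle\frac{p(1-p)}{(a-p)^2}\right\rangle=1$, let $c=c(\alpha,F)=a+\alpha(1-a)\left\langle\frac{p}{a-p}\right\rangle$ (which is the almost sure limit of $H/m$ as $m\to\infty$), and let $$\tau^2=\operatorname{Var}\left(\frac{(1-a)p}{a-p}\right).$$ Then, as $m\to\infty$, $$\frac{H-cm}{\tau\sqrt{\alpha}\cdot m^{1/2}}\longrightarrow N(0,1)\quad\text{in distribution.}$$
   Context: $F$ is a probability distribution function on $[0,1]$, $p$ denotes a generic random variable with distribution function $F(s)=P(p\le s)$, $\langle\,\cdot\,\rangle$ denotes integration (expectation) with respect to $dF$, and $\operatorname{Var}$ is the variance with respect to $dF$. Put $b=b(F)=\min\{s: F(s)=1\}$, the right edge of the support of $dF$. Fix $0<\alpha<\infty$ and let $n=\lfloor\alpha m\rfloor$. The environment $p_1,p_2,\dots$ is i.i.d. with distribution $F$. Given the environment, $A=A(F)$ is a random $m\times n$ matrix with independent Bernoulli entries $\varepsilon_{i,j}$ such that $P(\varepsilon_{i,j}=1)=p_j$ (rows $i$ are labeled starting at the bottom, columns $j$ from the left). An increasing path in $A$ is a sequence of 1's in $A$ whose positions have column index nondecreasing and row index strictly increasing. $H=H(m,n,F)$ is the length of the longest increasing path in $A$. The critical values are $$\alpha_c=\left\langle\frac{p}{1-p}\right\rangle^{-1},\qquad \alpha_c'=\left\langle\frac{p(1-p)}{(b-p)^2}\right\rangle^{-1},$$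 where the inverse of an infinite expectation is $0$. $N(0,1)$ is the standard normal distribution. *)

theory Defs
  imports "HOL-Probability.Probability"
begin

section \<open>The distribution of the environment\<close>

definition unit_interval_cdf :: "(real \<Rightarrow> real) \<Rightarrow> bool" where
  "unit_interval_cdf F \<longleftrightarrow>
     mono F \<and> (\<forall>s. continuous (at_right s) F) \<and> (\<forall>s<0. F s = 0) \<and> F 1 = 1"

text \<open>For a point mass the standard deviation \<open>growth_tau\<close> below vanishes and the normalization
  by it is meaningless.\<close>

definition nondegenerate_cdf :: "(real \<Rightarrow> real) \<Rightarrow> bool" where
  "nondegenerate_cdf F \<longleftrightarrow> (\<exists>s. 0 < F s \<and> F s < 1)"

abbreviation dF :: "(real \<Rightarrow> real) \<Rightarrow> real measure" where
  "dF F \<equiv> interval_measure F"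

definition right_edge :: "(real \<Rightarrow> real) \<Rightarrow> real" where
  "right_edge F = (LEAST s. F s = 1)"

text \<open>These expectations may be infinite, hence the values in \<^typ>\<open>ennreal\<close>. There
  \<open>x / 0 = \<infinity>\<close> for \<open>x > 0\<close>, so an atom at \<open>a\<close> with \<open>0 < a < 1\<close> makes \<open>quad_mean F a\<close> infinite;
  also \<open>inverse \<infinity> = 0\<close> and \<open>inverse 0 = \<infinity>\<close>.\<close>

definition quad_mean :: "(real \<Rightarrow> real) \<Rightarrow> real \<Rightarrow> ennreal" where
  "quad_mean F a = (\<integral>\<^sup>+ p. ennreal (p * (1 - p)) / ennreal ((a - p)\<^sup>2) \<partial>dF F)"

definition alpha_crit :: "(real \<Rightarrow> real) \<Rightarrow> ennreal" where
  "alpha_crit F = inverse (\<integral>\<^sup>+ p. ennreal p / ennreal (1 - p) \<partial>dF F)"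

definition alpha_crit' :: "(real \<Rightarrow> real) \<Rightarrow> ennreal" where
  "alpha_crit' F = inverse (quad_mean F (right_edge F))"

definition is_growth_a :: "real \<Rightarrow> (real \<Rightarrow> real) \<Rightarrow> real \<Rightarrow> bool" where
  "is_growth_a \<alpha> F a \<longleftrightarrow> a \<in> {right_edge F..1} \<and> ennreal \<alpha> * quad_mean F a = 1"

definition growth_a :: "real \<Rightarrow> (real \<Rightarrow> real) \<Rightarrow> real" where
  "growth_a \<alpha> F = (THE a. is_growth_a \<alpha> F a)"

definition growth_c :: "real \<Rightarrow> (real \<Rightarrow> real) \<Rightarrow> real" where
  "growth_c \<alpha> F = (let a = growth_a \<alpha> F in a + \<alpha> * (1 - a) * (\<integral>p. p / (a - p) \<partial>dF F))"

definition growth_tau :: "real \<Rightarrow> (real \<Rightarrow> real) \<Rightarrow> real" where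
  "growth_tau \<alpha> F =
     (let a = growth_a \<alpha> F in sqrt (prob_space.variance (dF F) (\<lambda>p. (1 - a) * p / (a - p))))"

section \<open>The random matrix\<close>

definition env_algebra :: "'a measure \<Rightarrow> (nat \<Rightarrow> 'a \<Rightarrow> real) \<Rightarrow> 'a measure" where
  "env_algebra M p =
     vimage_algebra (space M) (\<lambda>\<omega> j. p j \<omega>) (\<Pi>\<^sub>M j\<in>UNIV. (borel :: real measure))"

text \<open>The array is infinite, with rows \<open>i\<close> and columns \<open>j\<close> numbered from \<open>0\<close>; the \<open>m \<times> n\<close> matrix
  is its corner \<open>i < m\<close>, \<open>j < n\<close>. The last conjunct gives the finite-dimensional distributions
  of the entries conditionally on the \<open>\<sigma>\<close>-algebra generated by the environment: independent and
  Bernoulli with parameter \<open>p j\<close> in column \<open>j\<close>.\<close>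

definition disordered_array ::
  "'a measure \<Rightarrow> (real \<Rightarrow> real) \<Rightarrow> (nat \<Rightarrow> 'a \<Rightarrow> real) \<Rightarrow> (nat \<Rightarrow> nat \<Rightarrow> 'a \<Rightarrow> bool) \<Rightarrow> bool" where
  "disordered_array M F p \<epsilon> \<longleftrightarrow>
     prob_space M \<and>
     prob_space.indep_vars M (\<lambda>_. borel) p UNIV \<and>
     (\<forall>j. cdf (distr M borel (p j)) = F) \<and>
     (\<forall>i j. \<epsilon> i j \<in> measurable M (count_space UNIV)) \<and>
     (\<forall>K e. finite K \<longrightarrow>
        (AE \<omega> in M.
           real_cond_exp M (env_algebra M p)
             (indicat_real {\<omega> \<in> space M. \<forall>(i, j)\<in>K. \<epsilon> i j \<omega> = e i j}) \<omega> =
           (\<Prod>(i, j)\<in>K. if e i j then p j \<omega> else 1 - p j \<omega>)))"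

section \<open>Longest increasing paths\<close>

definition increasing_path :: "nat \<Rightarrow> nat \<Rightarrow> (nat \<Rightarrow> nat \<Rightarrow> bool) \<Rightarrow> (nat \<times> nat) list \<Rightarrow> bool" where
  "increasing_path m n A xs \<longleftrightarrow>
     (\<forall>(i, j)\<in>set xs. i < m \<and> j < n \<and> A i j) \<and>
     sorted_wrt (\<lambda>(i, j) (i', j'). i < i' \<and> j \<le> j') xs"

definition longest_path :: "nat \<Rightarrow> nat \<Rightarrow> (nat \<Rightarrow> nat \<Rightarrow> bool) \<Rightarrow> nat" where
  "longest_path m n A = Max (length ` {xs. increasing_path m n A xs})"

definition H :: "real \<Rightarrow> (nat \<Rightarrow> nat \<Rightarrow> 'a \<Rightarrow> bool) \<Rightarrow> nat \<Rightarrow> 'a \<Rightarrow> nat" where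
  "H \<alpha> \<epsilon> m \<omega> = longest_path m (nat \<lfloor>\<alpha> * real m\<rfloor>) (\<lambda>i j. \<epsilon> i j \<omega>)"

end

theory Submission
  imports Defs "HOL-Real_Asymp.Real_Asymp"
begin

text \<open>
  Fix the environment. Reading the last-passage recursion column by column turns the matrix into a
  series of discrete-time queues. With independent Bernoulli(\<open>z\<close>) entries on a left boundary and
  suitable geometric weights on a bottom boundary the model is stationary (Burke's theorem), with
  mean passage time \<open>\<Phi> z = m z + (1 - z) \<Sum>\<^sub>j p\<^sub>j / (z - p\<^sub>j)\<close>. Tilting the left boundary gives, for
  different boundary parameters \<open>w\<close> and \<open>z\<close>, the exact value of one exponential moment of the
  passage time. The function \<open>\<Phi>\<close> is convex and, since \<open>\<alpha> \<langle>p (1 - p) / (a - p)\<^sup>2\<rangle> = 1\<close>, its minimum is near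
  \<open>a\<close>; Chernoff bounds for parameters within \<open>O(h)\<close> of \<open>a\<close>, and a comparison of the increments in the
  last column with those of a stationary model, show that \<open>H = \<Phi> a + O(m h\<^sup>2)\<close> up to probability
  \<open>O(m exp (- m h\<^sup>3 / 2))\<close>. With \<open>h = m\<^bsup>-3/10\<^esup>\<close> the error is \<open>O(m\<^bsup>2/5\<^esup>)\<close>, so \<open>H\<close> inherits the central limit
  theorem for the sum of the independent variables \<open>(1 - a) p\<^sub>j / (a - p\<^sub>j)\<close>.
\<close>

section \<open>The matrix as a series of queues\<close>

text \<open>The two critical values place \<open>a\<close> strictly between \<open>b\<close> and 1,
  which leaves room for boundary parameters on both sides of \<open>a\<close>. Upper bounds are the
  easy half: deleting boundary weights only lowers passage times, so Chernoff bounds pass directly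
  to \<open>H\<close>. For lower bounds this comparison goes the wrong way, since a path may collect
  its weight on a boundary; hence it must be known along which boundary the geodesics leave. This
  can be decided at distance of order h from \<open>a\<close>, where \<open>\<Phi>\<close> is
  strictly monotone and one boundary dominates. There the gaps in \<open>\<Phi>\<close> are of order
  m h^2 and the tilts of order h, which gives exponents of order m h^3. For h = m^(-3/10) this is
  m^(1/10), enough for summable probabilities, while the error m h^2 = m^(2/5) is below the scale
  m^(1/2) of the limit theorem. The randomness of the environment moves the slope of
  \<open>\<Phi>\<close> at \<open>a\<close> by less than about m^(3/5), which is below m h =
  m^(7/10), so \<open>\<Phi>\<close> still has its minimum within distance h of
  \<open>a\<close>.\<close>

fun queue :: "nat \<Rightarrow> (nat \<Rightarrow> bool) \<Rightarrow> (nat \<Rightarrow> bool) \<Rightarrow> nat \<Rightarrow> nat" where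
  "queue u v c 0 = u"
| "queue u v c (Suc i) = queue u v c i + of_bool (c i) - of_bool (v i)"

definition departures :: "nat \<Rightarrow> (nat \<Rightarrow> bool) \<Rightarrow> (nat \<Rightarrow> bool) \<Rightarrow> nat \<Rightarrow> bool" where
  "departures u v c i \<longleftrightarrow> c i \<or> v i \<and> queue u v c i = 0"

primrec services :: "(nat \<Rightarrow> bool) \<Rightarrow> (nat \<Rightarrow> nat \<times> (nat \<Rightarrow> bool)) \<Rightarrow> nat \<Rightarrow> nat \<Rightarrow> bool" where
  "services V X 0 = V"
| "services V X (Suc j) = departures (fst (X j)) (services V X j) (snd (X j))"

definition final_queue ::
  "(nat \<Rightarrow> bool) \<Rightarrow> (nat \<Rightarrow> nat \<times> (nat \<Rightarrow> bool)) \<Rightarrow> nat \<Rightarrow> nat \<Rightarrow> nat" where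
  "final_queue V X i j = queue (fst (X j)) (services V X j) (snd (X j)) i"

definition passage ::
  "(nat \<Rightarrow> bool) \<Rightarrow> (nat \<Rightarrow> nat \<times> (nat \<Rightarrow> bool)) \<Rightarrow> nat \<Rightarrow> nat \<Rightarrow> nat" where
  "passage V X i j = (\<Sum>k<j. fst (X k)) + (\<Sum>k<i. of_bool (services V X j k))"

text \<open>Two ways around a strip of one column: along the bottom and up the right side, or up the
  left side and along the top.\<close>

lemma queue_balance:
  "u + (\<Sum>k<i. of_bool (departures u v c k)) = queue u v c i + (\<Sum>k<i. of_bool (v k))"
  by (induction i) (auto simp: departures_def)

lemma passage_Suc_column:
  "passage V X i (Suc j) = passage V X i j + final_queue V X i j"
  using queue_balance[of "fst (X j)" "services V X j" "snd (X j)" i]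
  by (simp add: passage_def final_queue_def)

lemma passage_eq_final_queues:
  "passage V X i j = (\<Sum>k<i. of_bool (V k)) + (\<Sum>k<j. final_queue V X i k)"
  by (induction j) (simp_all add: passage_Suc_column, simp add: passage_def)

lemma passage_Suc_row:
  "passage V X (Suc i) j = passage V X i j + of_bool (services V X j i)"
  by (simp add: passage_def)

text \<open>Here the queues meet increasing paths. With horizontal increment u and vertical
  increment v at a corner and entry c, the maximum of u + c and v, reduced by v or by u, is the rule
  of \<open>queue\<close> or of \<open>departures\<close>.\<close>

lemma passage_recursion:
  "passage V X (Suc i) (Suc j) =
     max (passage V X i (Suc j) + of_bool (snd (X j) i)) (passage V X (Suc i) j)"
proof -
  have "passage V X (Suc i) (Suc j) = passage V X i (Suc j) + of_bool (services V X (Suc j) i)"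
    by (rule passage_Suc_row)
  moreover have "passage V X i (Suc j) = passage V X i j + final_queue V X i j"
    by (rule passage_Suc_column)
  moreover have "passage V X (Suc i) j = passage V X i j + of_bool (services V X j i)"
    by (rule passage_Suc_row)
  ultimately show ?thesis
    by (auto simp: departures_def final_queue_def)
qed

lemma passage_row_0: "passage V X 0 j = (\<Sum>k<j. fst (X k))"
  by (simp add: passage_def)

lemma passage_column_0: "passage V X i 0 = (\<Sum>k<i. of_bool (V k))"
  by (simp add: passage_def)

definition no_bottom :: "(nat \<Rightarrow> nat \<times> (nat \<Rightarrow> bool)) \<Rightarrow> nat \<Rightarrow> nat \<times> (nat \<Rightarrow> bool)" where
  "no_bottom X j = (0, snd (X j))"

lemma no_bottom_simps [simp]: "fst (no_bottom X j) = 0" "snd (no_bottom X j) = snd (X j)"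
  by (simp_all add: no_bottom_def)

text \<open>A geodesic starts along only one of the two boundaries. The recursion consists of maxima
  and added constants, so it commutes with the maximum of two solutions, and at each boundary point
  one of the two models vanishes.\<close>

lemma passage_max_plus:
  "passage V X i j = max (passage V (no_bottom X) i j) (passage (\<lambda>_. False) X i j)"
proof (induction i arbitrary: j)
  case 0
  show ?case by (simp add: passage_row_0)
next
  case (Suc i)
  show ?case
  proof (induction j)
    case 0
    show ?case by (simp add: passage_column_0)
  next
    case (Suc j)
    show ?case
      unfolding passage_recursion[of V] passage_recursion[of "\<lambda>_. False"]
      using Suc.IH \<open>\<And>j. passage V X i j = _\<close>[of "Suc j"] by simp
  qed
qed

lemma queue_mono:
  assumes "u' \<le> u" "\<And>i. v i \<Longrightarrow> v' i"
  shows "queue u' v' c i \<le> queue u v c i"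
proof (induction i)
  case (Suc i)
  then show ?case using assms(2)[of i] by auto
qed (use assms in simp)

lemma services_mono:
  assumes "\<And>i. V i \<Longrightarrow> V' i" "\<And>j. fst (X' j) \<le> fst (X j)" "\<And>j. snd (X' j) = snd (X j)"
  shows "services V X j i \<Longrightarrow> services V' X' j i"
proof (induction j arbitrary: i)
  case (Suc j)
  have "queue (fst (X' j)) (services V' X' j) (snd (X j)) i
      \<le> queue (fst (X j)) (services V X j) (snd (X j)) i"
    by (rule queue_mono) (use assms Suc.IH in auto)
  with Suc show ?case by (auto simp: departures_def assms)
qed (use assms in auto)

lemma passage_increment:
  assumes "i \<le> i'"
  shows "passage V X i' j = passage V X i j + (\<Sum>k\<in>{i..<i'}. of_bool (services V X j k))"
proof -
  have "sum f {..<i'} = sum f {..<i} + sum f {i..<i'}" for f :: "nat \<Rightarrow> nat"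
    using sum.atLeastLessThan_concat[of 0 i i' f] assms by (simp only: lessThan_atLeast0)
  then show ?thesis by (simp only: passage_def add.assoc)
qed

lemma passage_increment_mono:
  assumes "\<And>i. V i \<Longrightarrow> V' i" "\<And>j. fst (X' j) \<le> fst (X j)" "\<And>j. snd (X' j) = snd (X j)"
    and "i \<le> i'"
  shows "passage V X i' j + passage V' X' i j \<le> passage V' X' i' j + passage V X i j"
proof -
  have "(\<Sum>k\<in>{i..<i'}. of_bool (services V X j k)) \<le>
      (\<Sum>k\<in>{i..<i'}. of_bool (services V' X' j k) :: nat)"
    using services_mono[of V V' X' X, OF assms(1,2,3)] by (intro sum_mono) auto
  then show ?thesis
    using passage_increment[OF assms(4), of V X j] passage_increment[OF assms(4), of V' X' j]
    by simp
qed

text \<open>If the geodesic to \<open>(m, n)\<close> starts along the bottom boundary, then so do the geodesics to all lower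
  points of the same column, and the increments along that column do not see the left boundary.\<close>

lemma increments_dominate_if_bottom_exit:
  assumes exit: "passage V (no_bottom X) m n \<le> passage (\<lambda>_. False) X m n"
    and V': "\<And>i. V' i \<Longrightarrow> V i" and i: "i < m" and s: "services V' X n i"
  shows "services (\<lambda>_. False) (no_bottom X) n i"
proof -
  \<comment> \<open>The lead of the bottom model over the left one can only shrink on the way up, so
    a lead in row \<open>m\<close> implies one in every lower row.\<close>
  have ge: "passage V (no_bottom X) k n \<le> passage (\<lambda>_. False) X k n" if "k \<le> m" for k
    using passage_increment_mono[of "\<lambda>_. False" V "no_bottom X" X k m n] that exit by simp
  have eq: "passage V X k n = passage (\<lambda>_. False) X k n" if "k \<le> m" for k
    using passage_max_plus[of V X k n] ge[OF that] by simp
  have "services V X n i" using s by (rule services_mono[rotated 3]) (use V' in auto)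
  then have "passage (\<lambda>_. False) X (Suc i) n = passage (\<lambda>_. False) X i n + 1"
    using passage_Suc_row[of V X i n] eq[of i] eq[of "Suc i"] i by simp
  then have "services (\<lambda>_. False) X n i"
    using passage_Suc_row[of "\<lambda>_. False" X i n] by (cases "services (\<lambda>_. False) X n i") auto
  then show ?thesis by (rule services_mono[rotated 3]) auto
qed

section \<open>Longest increasing paths as passage times without boundaries\<close>

definition columns_passage :: "(nat \<Rightarrow> nat \<Rightarrow> bool) \<Rightarrow> nat \<Rightarrow> nat \<Rightarrow> nat" where
  "columns_passage C = passage (\<lambda>_. False) (\<lambda>j. (0, C j))"

lemma columns_passage_simps:
  "columns_passage C 0 j = 0" "columns_passage C i 0 = 0"
  "columns_passage C (Suc i) (Suc j) =
     max (columns_passage C i (Suc j) + of_bool (C j i)) (columns_passage C (Suc i) j)"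
  by (simp_all add: columns_passage_def passage_row_0 passage_column_0 passage_recursion)

text \<open>A geodesic enters the last column at some height k and afterwards collects entries of
  that column only.\<close>

lemma columns_passage_last_column:
  "\<exists>k\<le>i. columns_passage C i (Suc j) =
     columns_passage C k j + (\<Sum>l\<in>{k..<i}. of_bool (C j l))"
proof (induction i)
  case 0
  show ?case by (auto simp: columns_passage_simps)
next
  case (Suc i)
  then obtain k where k: "k \<le> i"
    "columns_passage C i (Suc j) = columns_passage C k j + (\<Sum>l\<in>{k..<i}. of_bool (C j l))" by blast
  show ?case
  proof (cases "columns_passage C (Suc i) (Suc j) = columns_passage C (Suc i) j")
    case True
    then show ?thesis by (intro exI[of _ "Suc i"]) simp
  next
    case False
    then have "columns_passage C (Suc i) (Suc j) = columns_passage C i (Suc j) + of_bool (C j i)"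
      by (auto simp: columns_passage_simps max_def split: if_splits)
    then show ?thesis using k by (intro exI[of _ k]) (simp add: le_Suc_eq)
  qed
qed

text \<open>Nested induction on rows and columns: the last entry of the path lies left of the last
  column, below the last row or in the corner, and each case corresponds to one term of the
  recursion.\<close>

lemma increasing_path_length_le:
  "increasing_path i j (\<lambda>i j. C j i) xs \<Longrightarrow> length xs \<le> columns_passage C i j"
proof (induction i arbitrary: j xs)
  case 0
  then show ?case by (cases xs) (auto simp: increasing_path_def)
next
  case (Suc i)
  note row = Suc.IH
  show ?case using Suc.prems
  proof (induction j arbitrary: xs)
    case 0
    then show ?case by (cases xs) (auto simp: increasing_path_def)
  next
    case (Suc j)
    show ?case
    proof (cases xs rule: rev_cases)
      case Nil
      then show ?thesis by simp
    next
      case (snoc ys x)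
      obtain a b where x: "x = (a, b)" by (cases x)
      from Suc.prems have P: "increasing_path (Suc i) (Suc j) (\<lambda>i j. C j i) (ys @ [(a, b)])"
        unfolding snoc x .
      then have ys: "a' < a \<and> b' \<le> b" if "(a', b') \<in> set ys" for a' b'
        using that by (auto simp: increasing_path_def sorted_wrt_append)
      from P have ab: "a < Suc i" "b < Suc j" "C b a"
        and ys': "\<forall>(i', j')\<in>set ys. C j' i'"
          "sorted_wrt (\<lambda>(i, j) (i', j'). i < i' \<and> j \<le> j') ys"
        and xs': "sorted_wrt (\<lambda>(i, j) (i', j'). i < i' \<and> j \<le> j') (ys @ [(a, b)])"
        by (auto simp: increasing_path_def sorted_wrt_append)
      consider "b < j" | "b = j" "a = i" | "b = j" "a < i" using ab by linarith
      then show ?thesis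
      proof cases
        case 1
        have "increasing_path (Suc i) j (\<lambda>i j. C j i) xs"
          unfolding increasing_path_def snoc x using ab ys ys' 1 xs' by fastforce
        from Suc.IH[OF this] show ?thesis by (simp add: columns_passage_simps)
      next
        case 2
        have "increasing_path i (Suc j) (\<lambda>i j. C j i) ys"
          unfolding increasing_path_def using ab ys ys' 2 by fastforce
        from row[OF this] show ?thesis using 2 ab snoc by (simp add: columns_passage_simps)
      next
        case 3
        have "increasing_path i (Suc j) (\<lambda>i j. C j i) xs"
          unfolding increasing_path_def snoc x using ab ys ys' 3 xs' by fastforce
        from row[OF this] show ?thesis by (simp add: columns_passage_simps)
      qed
    qed
  qed
qed

lemma increasing_path_mono:
  assumes "increasing_path i j A xs" "i \<le> i'" "j \<le> j'"
  shows "increasing_path i' j' A xs"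
  using assms unfolding increasing_path_def by fastforce

lemma increasing_path_length_attained:
  "\<exists>xs. increasing_path i j (\<lambda>i j. C j i) xs \<and> length xs = columns_passage C i j"
proof (induction i arbitrary: j)
  case 0
  show ?case by (intro exI[of _ "[]"]) (auto simp: increasing_path_def columns_passage_simps)
next
  case (Suc i)
  note row = Suc.IH
  show ?case
  proof (induction j)
    case 0
    show ?case by (intro exI[of _ "[]"]) (auto simp: increasing_path_def columns_passage_simps)
  next
    case (Suc j)
    obtain xs where xs: "increasing_path (Suc i) j (\<lambda>i j. C j i) xs"
      "length xs = columns_passage C (Suc i) j" using Suc.IH by blast
    obtain ys where ys: "increasing_path i (Suc j) (\<lambda>i j. C j i) ys"
      "length ys = columns_passage C i (Suc j)" using row by blast
    have A: "increasing_path (Suc i) (Suc j) (\<lambda>i j. C j i) xs"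
      by (rule increasing_path_mono[OF xs(1)]) auto
    have B: "increasing_path (Suc i) (Suc j) (\<lambda>i j. C j i) ys"
      by (rule increasing_path_mono[OF ys(1)]) auto
    have D: "increasing_path (Suc i) (Suc j) (\<lambda>i j. C j i) (ys @ [(i, j)])" if "C j i"
      using ys(1) that unfolding increasing_path_def sorted_wrt_append by fastforce
    show ?case
    proof (cases "columns_passage C (Suc i) (Suc j) = columns_passage C (Suc i) j")
      case True
      then show ?thesis using A xs(2) by auto
    next
      case False
      then have "columns_passage C (Suc i) (Suc j) = columns_passage C i (Suc j) + of_bool (C j i)"
        by (auto simp: columns_passage_simps max_def split: if_splits)
      then show ?thesis using B D ys(2) by (cases "C j i") auto
    qed
  qed
qed

lemma longest_path_eq_passage: "longest_path m n A = columns_passage (\<lambda>j i. A i j) m n"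
proof -
  let ?S = "length ` {xs. increasing_path m n A xs}"
  have le: "l \<le> columns_passage (\<lambda>j i. A i j) m n" if "l \<in> ?S" for l
    using increasing_path_length_le[of m n "\<lambda>j i. A i j"] that by auto
  then have "finite ?S" by (meson finite_nat_set_iff_bounded_le)
  moreover have "columns_passage (\<lambda>j i. A i j) m n \<in> ?S"
    using increasing_path_length_attained[of m n "\<lambda>j i. A i j"] by force
  ultimately show ?thesis unfolding longest_path_def using le by (intro Max_eqI) auto
qed

lemma columns_passage_cong:
  assumes "\<And>i j. i < m \<Longrightarrow> j < n \<Longrightarrow> C j i = C' j i"
  shows "columns_passage C m n = columns_passage C' m n"
proof -
  have "increasing_path m n (\<lambda>i j. C j i) = increasing_path m n (\<lambda>i j. C' j i)"
    using assms by (intro ext) (auto simp: increasing_path_def)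
  then show ?thesis
    using longest_path_eq_passage[of m n "\<lambda>i j. C j i"] longest_path_eq_passage[of m n "\<lambda>i j. C' j i"]
    by (simp add: longest_path_def)
qed

text \<open>Rotation by 180 degrees reverses increasing paths. One inequality suffices, because
  rotating twice restores the matrix inside the corner.\<close>

lemma columns_passage_rotate:
  "columns_passage (\<lambda>j i. C (n - 1 - j) (m - 1 - i)) m n = columns_passage C m n"
proof -
  have le: "columns_passage C m n \<le> columns_passage (\<lambda>j i. C (n - 1 - j) (m - 1 - i)) m n" for C
  proof -
    obtain xs where xs: "increasing_path m n (\<lambda>i j. C j i) xs" "length xs = columns_passage C m n"
      using increasing_path_length_attained by blast
    let ?r = "\<lambda>(i, j). (m - 1 - i, n - 1 - j)"
    have *: "i < m" "j < n" "C j i" if "(i, j) \<in> set xs" for i j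
      using xs(1) that by (auto simp: increasing_path_def)
    have "sorted_wrt (\<lambda>(i, j) (i', j'). i < i' \<and> j \<le> j') (rev (map ?r xs))"
      unfolding sorted_wrt_rev sorted_wrt_map
    proof (rule sorted_wrt_mono_rel[of xs "\<lambda>(i, j) (i', j'). i < i' \<and> j \<le> j'"])
      show "sorted_wrt (\<lambda>(i, j) (i', j'). i < i' \<and> j \<le> j') xs"
        using xs(1) by (simp add: increasing_path_def)
    qed (use * in fastforce)
    then have "increasing_path m n (\<lambda>i j. C (n - 1 - j) (m - 1 - i)) (rev (map ?r xs))"
      using * by (fastforce simp: increasing_path_def)
    from increasing_path_length_le[of m n "\<lambda>j i. C (n - 1 - j) (m - 1 - i)", OF this]
    show ?thesis using xs(2) by simp
  qed
  have "columns_passage (\<lambda>j i. C (n - 1 - j) (m - 1 - i)) m n \<le>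
      columns_passage (\<lambda>j i. C (n - 1 - (n - 1 - j)) (m - 1 - (m - 1 - i))) m n"
    using le[of "\<lambda>j i. C (n - 1 - j) (m - 1 - i)"] .
  also have "\<dots> = columns_passage C m n"
    by (rule columns_passage_cong) auto
  finally show ?thesis using le[of C] by simp
qed

section \<open>The stationary model\<close>

abbreviation bernoullis :: "nat \<Rightarrow> real \<Rightarrow> (nat \<Rightarrow> bool) pmf" where
  "bernoullis m p \<equiv> Pi_pmf {..<m} False (\<lambda>_. bernoulli_pmf p)"

text \<open>The stationary law of a queue with arrival probability \<open>p\<close> and service
  probability \<open>z\<close>. Its ratio \<open>p * (1 - z) / ((1 - p) * z)\<close> is the
  probability of an up step over that of a down step.\<close>

definition queue_pmf :: "real \<Rightarrow> real \<Rightarrow> nat pmf" where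
  "queue_pmf z p = geometric_pmf ((z - p) / ((1 - p) * z))"

definition bulk_pmf ::
  "nat \<Rightarrow> nat \<Rightarrow> real \<Rightarrow> (nat \<Rightarrow> real) \<Rightarrow> (nat \<Rightarrow> nat \<times> (nat \<Rightarrow> bool)) pmf" where
  "bulk_pmf m n z p = Pi_pmf {..<n} (0, \<lambda>_. False)
     (\<lambda>j. pair_pmf (queue_pmf z (p j)) (bernoullis m (p j)))"

section \<open>Burke's theorem: one time slot, one column, all columns\<close>

lemma pmf_queue_pmf:
  assumes "0 \<le> p" "p < z" "z < 1"
  shows "pmf (queue_pmf z p) k =
    (p * (1 - z) / ((1 - p) * z)) ^ k * ((z - p) / ((1 - p) * z))"
proof -
  have "0 < (1 - p) * z" using assms by simp
  moreover have "z - p \<le> (1 - p) * z" using assms mult_left_mono[of z 1 p] by (simp add: algebra_simps)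
  ultimately have "0 < (z - p) / ((1 - p) * z)" "(z - p) / ((1 - p) * z) \<le> 1"
    using assms by simp_all
  then have "pmf (queue_pmf z p) k =
      (1 - (z - p) / ((1 - p) * z)) ^ k * ((z - p) / ((1 - p) * z))"
    unfolding queue_pmf_def by (rule pmf_geometric)
  moreover have "1 - (z - p) / ((1 - p) * z) = p * (1 - z) / ((1 - p) * z)"
    using assms by (simp add: field_simps)
  ultimately show ?thesis by simp
qed

text \<open>Detailed balance: an up step is an arrival without service, a down step a service
  without arrival.\<close>

lemma pmf_queue_pmf_balance:
  assumes "0 \<le> p" "p < z" "z < 1"
  shows "(1 - p) * z * pmf (queue_pmf z p) (Suc k) = p * (1 - z) * pmf (queue_pmf z p) k"
proof -
  have "(1 - p) * z * (p * (1 - z) / ((1 - p) * z)) = p * (1 - z)" using assms by simp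
  then show ?thesis
    unfolding pmf_queue_pmf[OF assms] power_Suc by (metis mult.assoc)
qed

lemma burke_one_step_pair:
  assumes p: "0 \<le> p" "p < z" "z < 1"
  shows "do {u \<leftarrow> queue_pmf z p; y \<leftarrow> bernoulli_pmf z; e \<leftarrow> bernoulli_pmf p;
      return_pmf (e \<or> y \<and> u = 0, u + of_bool e - of_bool y)} =
    do {y \<leftarrow> bernoulli_pmf z; u \<leftarrow> queue_pmf z p; return_pmf (y, u)}" (is "?L = ?R")
proof (rule pmf_eqI)
  fix bk :: "bool \<times> nat"
  obtain b k where bk: "bk = (b, k)" by (cases bk)
  let ?G = "queue_pmf z p"
  have z01: "0 \<le> z" "z \<le> 1" "0 \<le> p" "p \<le> 1" using p by auto
  have L: "?L = do {y \<leftarrow> bernoulli_pmf z; e \<leftarrow> bernoulli_pmf p;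
      map_pmf (\<lambda>u. (e \<or> y \<and> u = 0, u + of_bool e - of_bool y)) ?G}"
    by (subst bind_commute_pmf, intro bind_pmf_cong refl, subst bind_commute_pmf)
       (simp add: map_pmf_def)
  have R: "?R = do {y \<leftarrow> bernoulli_pmf z; map_pmf (Pair y) ?G}"
    by (simp add: map_pmf_def)
  have pt: "pmf (map_pmf f ?G) c = (\<Sum>u\<in>A. pmf ?G u)"
    if "finite A" "f -` {c} = A" for f :: "nat \<Rightarrow> bool \<times> nat" and c A
    using that by (simp add: pmf_map measure_measure_pmf_finite)
  have "pmf ?L (b, k) = z * (p * pmf (map_pmf (\<lambda>u. (True, u)) ?G) (b, k)
        + (1 - p) * pmf (map_pmf (\<lambda>u. (u = 0, u - 1)) ?G) (b, k))
      + (1 - z) * (p * pmf (map_pmf (\<lambda>u. (True, Suc u)) ?G) (b, k)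
        + (1 - p) * pmf (map_pmf (\<lambda>u. (False, u)) ?G) (b, k))"
    unfolding L by (simp add: pmf_bind z01 algebra_simps)
  also have "\<dots> = (if b then z else 1 - z) * pmf ?G k"
  proof (cases b)
    case True
    have 1: "pmf (map_pmf (\<lambda>u. (True, u)) ?G) (True, k) = pmf ?G k"
      by (rule trans[OF pt[of "{k}"]]) auto
    have 2: "pmf (map_pmf (\<lambda>u. (False, u)) ?G) (True, k) = 0"
      by (rule trans[OF pt[of "{}"]]) auto
    show ?thesis
    proof (cases k)
      case 0
      have 3: "pmf (map_pmf (\<lambda>u. (True, Suc u)) ?G) (True, 0) = 0"
        by (rule trans[OF pt[of "{}"]]) auto
      have "(\<lambda>u::nat. (u = 0, u - 1)) -` {(True, 0)} = {0}"
      proof (rule set_eqI)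
        show "u \<in> (\<lambda>u::nat. (u = 0, u - 1)) -` {(True, 0)} \<longleftrightarrow> u \<in> {0}" for u
          by (cases u) simp_all
      qed
      from trans[OF pt[OF _ this]]
      have 4: "pmf (map_pmf (\<lambda>u. (u = 0, u - 1)) ?G) (True, 0) = pmf ?G 0" by simp
      have "z * (p * pmf ?G 0 + (1 - p) * pmf ?G 0) + (1 - z) * (p * 0 + (1 - p) * 0) = z * pmf ?G 0"
        by (simp add: algebra_simps)
      then show ?thesis by (simp only: True 0 1[unfolded 0] 2[unfolded 0] 3 4 if_True)
    next
      case (Suc l)
      have 3: "pmf (map_pmf (\<lambda>u. (True, Suc u)) ?G) (True, Suc l) = pmf ?G l"
        by (rule trans[OF pt[of "{l}"]]) auto
      have 4: "pmf (map_pmf (\<lambda>u. (u = 0, u - 1)) ?G) (True, Suc l) = 0"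
        by (rule trans[OF pt[of "{}"]]) auto
      show ?thesis using True 1 2 3 4 Suc pmf_queue_pmf_balance[OF p, of l]
        by (simp add: algebra_simps)
    qed
  next
    case False
    have 1: "pmf (map_pmf (\<lambda>u. (True, u)) ?G) (False, k) = 0"
      by (rule trans[OF pt[of "{}"]]) auto
    have 2: "pmf (map_pmf (\<lambda>u. (False, u)) ?G) (False, k) = pmf ?G k"
      by (rule trans[OF pt[of "{k}"]]) auto
    have 3: "pmf (map_pmf (\<lambda>u. (True, Suc u)) ?G) (False, k) = 0"
      by (rule trans[OF pt[of "{}"]]) auto
    have 4: "pmf (map_pmf (\<lambda>u. (u = 0, u - 1)) ?G) (False, k) = pmf ?G (Suc k)"
      by (rule trans[OF pt[of "{Suc k}"]]) auto
    show ?thesis using False 1 2 3 4 pmf_queue_pmf_balance[OF p, of k]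
      by (simp add: algebra_simps)
  qed
  also have "\<dots> = pmf ?R (b, k)"
  proof -
    have 1: "pmf (map_pmf (Pair y) ?G) (y, k) = pmf ?G k" for y :: bool
      by (rule trans[OF pt[of "{k}"]]) auto
    have 2: "pmf (map_pmf (Pair y) ?G) (\<not> y, k) = 0" for y
      by (rule trans[OF pt[of "{}"]]) auto
    show ?thesis unfolding R using 1[of True] 1[of False] 2[of True] 2[of False]
      by (cases b) (simp_all add: pmf_bind z01)
  qed
  finally show "pmf ?L bk = pmf ?R bk" unfolding bk .
qed

text \<open>Here \<open>K\<close> stands for everything computed afterwards; this continuation form
  allows rewriting inside longer monadic blocks.\<close>

lemma burke_one_step:
  assumes p: "0 \<le> p" "p < z" "z < 1"
  shows "do {u \<leftarrow> queue_pmf z p; y \<leftarrow> bernoulli_pmf z; e \<leftarrow> bernoulli_pmf p;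
      K (e \<or> y \<and> u = 0) (u + of_bool e - of_bool y)} =
    do {y \<leftarrow> bernoulli_pmf z; u \<leftarrow> queue_pmf z p; K y u}"
  using arg_cong[OF burke_one_step_pair[OF p], of "\<lambda>D. bind_pmf D (\<lambda>(b, k). K b k)"]
  by (simp add: bind_assoc_pmf bind_return_pmf)

lemma bernoullis_Suc:
  "bernoullis (Suc m) p =
    do {y \<leftarrow> bernoulli_pmf p; f \<leftarrow> bernoullis m p; return_pmf (f(m := y))}"
  by (simp add: lessThan_Suc Pi_pmf_insert')

lemma bind_bernoullis_Suc:
  "bind_pmf (bernoullis (Suc m) p) K =
    do {f \<leftarrow> bernoullis m p; y \<leftarrow> bernoulli_pmf p; K (f(m := y))}"
  unfolding bernoullis_Suc
  by (simp add: bind_assoc_pmf bind_return_pmf) (rule bind_commute_pmf)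

lemma bernoullis_outside:
  "f \<in> set_pmf (bernoullis m p) \<Longrightarrow> m \<le> i \<Longrightarrow> \<not> f i"
  using set_Pi_pmf_subset[of "{..<m}" False "\<lambda>_. bernoulli_pmf p"] by auto

lemma queue_cong:
  assumes "\<And>k. k < i \<Longrightarrow> v k = v' k" "\<And>k. k < i \<Longrightarrow> c k = c' k"
  shows "queue u v c i = queue u v' c' i"
  using assms by (induction i) auto

text \<open>Induction on the rows: the queue after m rows is independent of the outputs so far and
  has its stationary law, so the next slot starts afresh.\<close>

lemma burke_column:
  assumes p: "0 \<le> p" "p < z" "z < 1"
  shows "do {v \<leftarrow> bernoullis m z; u \<leftarrow> queue_pmf z p; c \<leftarrow> bernoullis m p;
      K (departures u v c) (queue u v c m)} =
    do {v \<leftarrow> bernoullis m z; u \<leftarrow> queue_pmf z p; K v u}"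
proof (induction m arbitrary: K)
  case 0
  show ?case by (simp add: departures_def bind_return_pmf fun_eq_iff[symmetric])
next
  case (Suc m)
  let ?B = "\<lambda>z. bernoullis m z" and ?G = "queue_pmf z p"
  have "do {v \<leftarrow> bernoullis (Suc m) z; u \<leftarrow> ?G; c \<leftarrow> bernoullis (Suc m) p;
      K (departures u v c) (queue u v c (Suc m))} =
    do {v \<leftarrow> ?B z; y \<leftarrow> bernoulli_pmf z; u \<leftarrow> ?G; c \<leftarrow> ?B p; e \<leftarrow> bernoulli_pmf p;
      K (departures u (v(m := y)) (c(m := e))) (queue u (v(m := y)) (c(m := e)) (Suc m))}"
    unfolding bind_bernoullis_Suc ..
  also have "\<dots> = do {v \<leftarrow> ?B z; y \<leftarrow> bernoulli_pmf z; u \<leftarrow> ?G; c \<leftarrow> ?B p; e \<leftarrow> bernoulli_pmf p;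
      K ((departures u v c)(m := e \<or> y \<and> queue u v c m = 0))
        (queue u v c m + of_bool e - of_bool y)}"
  proof (intro bind_pmf_cong refl)
    fix v y u c e
    assume v: "v \<in> set_pmf (?B z)" and c: "c \<in> set_pmf (?B p)"
    have q: "queue u (v(m := y)) (c(m := e)) i = queue u v c i" if "i \<le> m" for i
      using that by (intro queue_cong) auto
    have "departures u (v(m := y)) (c(m := e)) = (departures u v c)(m := e \<or> y \<and> queue u v c m = 0)"
    proof
      fix i
      show "departures u (v(m := y)) (c(m := e)) i
          = ((departures u v c)(m := e \<or> y \<and> queue u v c m = 0)) i"
        using q[of i] bernoullis_outside[OF v, of i] bernoullis_outside[OF c, of i]
        by (cases i m rule: linorder_cases) (auto simp: departures_def)
    qed
    then show "K (departures u (v(m := y)) (c(m := e))) (queue u (v(m := y)) (c(m := e)) (Suc m)) =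
        K ((departures u v c)(m := e \<or> y \<and> queue u v c m = 0)) (queue u v c m + of_bool e - of_bool y)"
      using q[of m] by simp
  qed
  also have "\<dots> = do {v \<leftarrow> ?B z; u \<leftarrow> ?G; c \<leftarrow> ?B p; y \<leftarrow> bernoulli_pmf z; e \<leftarrow> bernoulli_pmf p;
      K ((departures u v c)(m := e \<or> y \<and> queue u v c m = 0))
        (queue u v c m + of_bool e - of_bool y)}"
    by (intro bind_pmf_cong refl, subst bind_commute_pmf, intro bind_pmf_cong refl,
        subst bind_commute_pmf, rule refl)
  also have "\<dots> = do {v \<leftarrow> ?B z; u \<leftarrow> ?G; y \<leftarrow> bernoulli_pmf z; e \<leftarrow> bernoulli_pmf p;
      K (v(m := e \<or> y \<and> u = 0)) (u + of_bool e - of_bool y)}"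
    by (rule Suc.IH)
  also have "\<dots> = do {v \<leftarrow> ?B z; y \<leftarrow> bernoulli_pmf z; u \<leftarrow> ?G; K (v(m := y)) u}"
    by (rule bind_pmf_cong[OF refl], rule burke_one_step[OF p])
  also have "\<dots> = do {v \<leftarrow> bernoullis (Suc m) z; u \<leftarrow> ?G; K v u}"
    unfolding bind_bernoullis_Suc ..
  finally show ?case .
qed

lemma bind_Pi_pmf_lessThan_Suc:
  "bind_pmf (Pi_pmf {..<Suc n} d q) K = do {x \<leftarrow> q n; f \<leftarrow> Pi_pmf {..<n} d q; K (f(n := x))}"
  by (simp add: lessThan_Suc Pi_pmf_insert' bind_assoc_pmf bind_return_pmf)

lemma bulk_pmf_outside:
  "X \<in> set_pmf (bulk_pmf m n z p) \<Longrightarrow> n \<le> j \<Longrightarrow> X j = (0, \<lambda>_. False)"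
  unfolding bulk_pmf_def
  using set_Pi_pmf_subset[of "{..<n}" "(0, \<lambda>_. False)"
      "\<lambda>j. pair_pmf (queue_pmf z (p j)) (bernoullis m (p j))"] by fastforce

lemma services_cong:
  assumes "\<And>k. k < j \<Longrightarrow> X k = X' k"
  shows "services V X j = services V X' j"
  using assms by (induction j) auto

lemma queue_0_empty: "queue 0 v (\<lambda>_. False) i = 0"
  by (induction i) auto

text \<open>Induction on the columns: the outputs of a station are again independent Bernoulli
  variables, are independent of its final queue, and serve the next station. As \<open>K\<close>
  receives both arguments, the increments on the right and on the top of the rectangle are jointly
  independent.\<close>

theorem burke:
  assumes p: "\<And>j. j < n \<Longrightarrow> 0 \<le> p j \<and> p j < z" and z: "z < 1"
  shows "do {v \<leftarrow> bernoullis m z; X \<leftarrow> bulk_pmf m n z p;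
      K (services v X n) (final_queue v X m)} =
    do {v \<leftarrow> bernoullis m z; u \<leftarrow> Pi_pmf {..<n} 0 (\<lambda>j. queue_pmf z (p j)); K v u}"
  using p
proof (induction n arbitrary: K)
  case 0
  have "final_queue v (\<lambda>_. (0, \<lambda>_. False)) m = (\<lambda>_. 0)" for v
    by (auto simp: final_queue_def queue_0_empty)
  then show ?case by (simp add: bulk_pmf_def bind_return_pmf)
next
  case (Suc n)
  let ?B = "bernoullis m" and ?G = "\<lambda>j. queue_pmf z (p j)"
    and ?U = "Pi_pmf {..<n} 0 (\<lambda>j. queue_pmf z (p j))"
  have "do {v \<leftarrow> ?B z; X \<leftarrow> bulk_pmf m (Suc n) z p; K (services v X (Suc n)) (final_queue v X m)} =
    do {v \<leftarrow> ?B z; x \<leftarrow> pair_pmf (?G n) (?B (p n)); X \<leftarrow> bulk_pmf m n z p;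
      K (services v (X(n := x)) (Suc n)) (final_queue v (X(n := x)) m)}"
    unfolding bulk_pmf_def bind_Pi_pmf_lessThan_Suc ..
  also have "\<dots> = do {v \<leftarrow> ?B z; x \<leftarrow> pair_pmf (?G n) (?B (p n)); X \<leftarrow> bulk_pmf m n z p;
      K (departures (fst x) (services v X n) (snd x))
        ((final_queue v X m)(n := queue (fst x) (services v X n) (snd x) m))}"
  proof (intro bind_pmf_cong refl)
    fix v x X assume X: "X \<in> set_pmf (bulk_pmf m n z p)"
    have s: "services v (X(n := x)) j = services v X j" if "j \<le> n" for j
      using that by (intro services_cong) auto
    have "final_queue v (X(n := x)) m = (final_queue v X m)(n := queue (fst x) (services v X n) (snd x) m)"
    proof
      fix j
      show "final_queue v (X(n := x)) m j
          = ((final_queue v X m)(n := queue (fst x) (services v X n) (snd x) m)) j"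
        using s[of j] bulk_pmf_outside[OF X, of j]
        by (cases j n rule: linorder_cases) (auto simp: final_queue_def queue_0_empty)
    qed
    then show "K (services v (X(n := x)) (Suc n)) (final_queue v (X(n := x)) m) =
        K (departures (fst x) (services v X n) (snd x))
          ((final_queue v X m)(n := queue (fst x) (services v X n) (snd x) m))"
      using s[of n] by simp
  qed
  also have "\<dots> = do {v \<leftarrow> ?B z; X \<leftarrow> bulk_pmf m n z p; u \<leftarrow> ?G n; c \<leftarrow> ?B (p n);
      K (departures u (services v X n) c) ((final_queue v X m)(n := queue u (services v X n) c m))}"
    by (intro bind_pmf_cong refl, subst bind_commute_pmf)
       (simp add: pair_pmf_def bind_assoc_pmf bind_return_pmf)
  also have "\<dots> = do {v \<leftarrow> ?B z; f \<leftarrow> ?U; u \<leftarrow> ?G n; c \<leftarrow> ?B (p n);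
      K (departures u v c) (f(n := queue u v c m))}"
    by (rule Suc.IH) (use Suc.prems in auto)
  also have "\<dots> = do {f \<leftarrow> ?U; v \<leftarrow> ?B z; u \<leftarrow> ?G n; c \<leftarrow> ?B (p n);
      K (departures u v c) (f(n := queue u v c m))}"
    by (rule bind_commute_pmf)
  also have "\<dots> = do {f \<leftarrow> ?U; v \<leftarrow> ?B z; u \<leftarrow> ?G n; K v (f(n := u))}"
    by (rule bind_pmf_cong[OF refl], rule burke_column) (use Suc.prems[of n] z in auto)
  also have "\<dots> = do {v \<leftarrow> ?B z; f \<leftarrow> ?U; u \<leftarrow> ?G n; K v (f(n := u))}"
    by (rule bind_commute_pmf)
  also have "\<dots> = do {v \<leftarrow> ?B z; u \<leftarrow> ?G n; f \<leftarrow> ?U; K v (f(n := u))}"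
    by (rule bind_pmf_cong[OF refl], rule bind_commute_pmf)
  also have "\<dots> = do {v \<leftarrow> ?B z; u \<leftarrow> Pi_pmf {..<Suc n} 0 ?G; K v u}"
    unfolding bind_Pi_pmf_lessThan_Suc ..
  finally show ?case .
qed

text \<open>Up to constants and signs, the logarithms of the normalizing factors of the boundary
  laws in the natural parameter \<open>logit x\<close>. The signs differ because a tilt by \<theta>
  = \<open>logit z - logit w\<close> moves a Bernoulli parameter from w to z, but a geometric
  boundary law from z to w.\<close>

definition log_partition :: "nat \<Rightarrow> nat \<Rightarrow> (nat \<Rightarrow> real) \<Rightarrow> real \<Rightarrow> real" where
  "log_partition m n p x = (\<Sum>j<n. ln (x - p j) - ln x) - real m * ln (1 - x)"

definition logit :: "real \<Rightarrow> real" where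
  "logit x = ln x - ln (1 - x)"

section \<open>Exponential moments of the passage time\<close>

lemma nn_integral_bernoullis_tilt:
  assumes w: "0 < w" "w < 1" and z: "0 < z" "z < 1" and "\<theta> = logit z - logit w"
  shows "(\<integral>\<^sup>+v. ennreal (exp (\<theta> * real (\<Sum>i<m. of_bool (v i)))) * f v \<partial>bernoullis m w) =
    ennreal (((1 - w) / (1 - z)) ^ m) * (\<integral>\<^sup>+v. f v \<partial>bernoullis m z)"
proof -
  have e: "exp \<theta> = z * (1 - w) / (w * (1 - z))"
    using assms by (simp add: logit_def exp_diff divide_simps)
  have one: "pmf (bernoulli_pmf w) b * exp (\<theta> * of_bool b) = (1 - w) / (1 - z) * pmf (bernoulli_pmf z) b" for b
    using w z by (cases b) (simp_all add: e divide_simps)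
  have "ennreal (pmf (bernoullis m w) v) * ennreal (exp (\<theta> * real (\<Sum>i<m. of_bool (v i)))) =
      ennreal (((1 - w) / (1 - z)) ^ m) * ennreal (pmf (bernoullis m z) v)" for v
  proof (cases "\<forall>i. i \<notin> {..<m} \<longrightarrow> v i = False")
    case True
    have "pmf (bernoullis m w) v * exp (\<theta> * real (\<Sum>i<m. of_bool (v i))) =
        (\<Prod>i<m. pmf (bernoulli_pmf w) (v i) * exp (\<theta> * of_bool (v i)))"
    proof -
      have "exp (\<theta> * real (\<Sum>i<m. of_bool (v i))) = (\<Prod>i<m. exp (\<theta> * of_bool (v i)))"
        by (simp only: of_nat_sum of_nat_of_bool sum_distrib_left exp_sum[OF finite_lessThan])
      then show ?thesis using True by (simp add: pmf_Pi prod.distrib)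
    qed
    also have "\<dots> = ((1 - w) / (1 - z)) ^ m * pmf (bernoullis m z) v"
      using True unfolding one
      by (simp only: pmf_Pi[OF finite_lessThan] prod.distrib prod_constant card_lessThan) simp
    finally show ?thesis using w z by (simp flip: ennreal_mult)
  next
    case False
    then show ?thesis by (subst (1 2) pmf_Pi) auto
  qed
  then have "ennreal (pmf (bernoullis m w) v) * (ennreal (exp (\<theta> * real (\<Sum>i<m. of_bool (v i)))) * f v) =
      ennreal (((1 - w) / (1 - z)) ^ m) * (ennreal (pmf (bernoullis m z) v) * f v)" for v
    by (metis mult.assoc)
  then show ?thesis
    by (simp only: nn_integral_measure_pmf) (rule nn_integral_cmult, simp)
qed

text \<open>The tilt turns the ratio of the geometric law at z into the ratio at w, and
  \<open>p < w\<close> makes the new geometric series converge.\<close>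

lemma nn_integral_queue_pmf_exp:
  assumes p: "0 \<le> p" "p < z" "p < w" and z: "z < 1" "w < 1" and \<theta>: "\<theta> = logit z - logit w"
  shows "(\<integral>\<^sup>+u. ennreal (exp (\<theta> * real u)) \<partial>queue_pmf z p) =
    ennreal (exp ((ln (z - p) - ln z) - (ln (w - p) - ln w)))"
proof -
  have e: "exp \<theta> = z * (1 - w) / (w * (1 - z))"
    using p z unfolding \<theta> by (simp add: logit_def exp_diff divide_simps)
  let ?r = "p * (1 - w) / ((1 - p) * w)"
  have r: "p * (1 - z) / ((1 - p) * z) * exp \<theta> = ?r"
    unfolding e using p z by (simp add: divide_simps)
  have r01: "0 \<le> ?r" "?r < 1"
    using p z by (auto simp: divide_simps algebra_simps mult_left_le)
  have "(\<integral>\<^sup>+u. ennreal (exp (\<theta> * real u)) \<partial>queue_pmf z p) =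
      (\<Sum>u. ennreal (((z - p) / ((1 - p) * z)) * ?r ^ u))"
    unfolding nn_integral_measure_pmf nn_integral_count_space_nat
  proof (rule arg_cong[of _ _ suminf], rule ext)
    fix u
    have gen: "ennreal (r ^ u * q) * ennreal (E ^ u) = ennreal (q * (r * E) ^ u)" if "0 \<le> E" for q r E :: real
      using that by (subst ennreal_mult''[symmetric]) (simp_all add: power_mult_distrib mult_ac)
    have "exp (\<theta> * real u) = exp \<theta> ^ u" by (simp add: exp_of_nat2_mult)
    then show "ennreal (pmf (queue_pmf z p) u) * ennreal (exp (\<theta> * real u)) =
        ennreal (((z - p) / ((1 - p) * z)) * ?r ^ u)"
      unfolding r[symmetric] pmf_queue_pmf[OF p(1,2) z(1)] by (simp only:) (rule gen, simp)
  qed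
  also have "\<dots> = ennreal (\<Sum>u. ((z - p) / ((1 - p) * z)) * ?r ^ u)"
    using r01 p z by (intro suminf_ennreal2 summable_mult summable_geometric mult_nonneg_nonneg) auto
  also have "(\<Sum>u. ((z - p) / ((1 - p) * z)) * ?r ^ u) = ((z - p) / ((1 - p) * z)) / (1 - ?r)"
  proof -
    have s: "norm ?r < 1" using r01 by (simp only: real_norm_def abs_of_nonneg)
    show ?thesis
      by (simp only: suminf_mult[OF summable_geometric[OF s]] suminf_geometric[OF s]) simp
  qed
  also have "\<dots> = exp ((ln (z - p) - ln z) - (ln (w - p) - ln w))"
  proof -
    have "1 - ?r = (w - p) / ((1 - p) * w)" using p z by (simp add: divide_simps algebra_simps)
    then show ?thesis using p z by (simp add: exp_diff divide_simps)
  qed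
  finally show ?thesis .
qed

text \<open>Tilting the left boundary from \<open>w\<close> to \<open>z\<close> absorbs its contribution to the passage time;
  what remains are the final queues of a stationary model, which are independent by Burke's theorem.\<close>

theorem passage_mgf:
  assumes p: "\<And>j. j < n \<Longrightarrow> 0 \<le> p j \<and> p j < z \<and> p j < w" and z: "0 < z" "z < 1" and w: "0 < w" "w < 1"
    and \<theta>: "\<theta> = logit z - logit w"
  shows "(\<integral>\<^sup>+(v, X). ennreal (exp (\<theta> * real (passage v X m n)))
      \<partial>pair_pmf (bernoullis m w) (bulk_pmf m n z p)) =
    ennreal (exp (log_partition m n p z - log_partition m n p w))"
proof -
  let ?U = "Pi_pmf {..<n} 0 (\<lambda>j. queue_pmf z (p j))"
  let ?g = "\<lambda>u. ennreal (exp (\<theta> * real (\<Sum>k<n. u k)))"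
  have "(\<integral>\<^sup>+(v, X). ennreal (exp (\<theta> * real (passage v X m n)))
      \<partial>pair_pmf (bernoullis m w) (bulk_pmf m n z p)) =
    (\<integral>\<^sup>+v. ennreal (exp (\<theta> * real (\<Sum>i<m. of_bool (v i)))) *
      (\<integral>\<^sup>+X. ?g (final_queue v X m) \<partial>bulk_pmf m n z p) \<partial>bernoullis m w)"
    by (simp add: nn_integral_pair_pmf' passage_eq_final_queues distrib_left exp_add ennreal_mult
        nn_integral_cmult del: sum_of_bool_eq)
  \<comment> \<open>The passage time is read up the left side and then along the top. The tilt
    removes the Bernoulli sum, and after it both boundaries have the parameter z.\<close>
  also have "\<dots> = ennreal (((1 - w) / (1 - z)) ^ m) *
      (\<integral>\<^sup>+v. (\<integral>\<^sup>+X. ?g (final_queue v X m) \<partial>bulk_pmf m n z p) \<partial>bernoullis m z)"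
    by (rule nn_integral_bernoullis_tilt[OF w z \<theta>])
  also have "(\<integral>\<^sup>+v. (\<integral>\<^sup>+X. ?g (final_queue v X m) \<partial>bulk_pmf m n z p) \<partial>bernoullis m z) =
      (\<integral>\<^sup>+u. ?g u \<partial>bind_pmf (bernoullis m z) (\<lambda>v. bind_pmf (bulk_pmf m n z p)
        (\<lambda>X. return_pmf (final_queue v X m))))"
    by (simp add: nn_integral_bind_pmf)
  also have "bind_pmf (bernoullis m z) (\<lambda>v. bind_pmf (bulk_pmf m n z p)
        (\<lambda>X. return_pmf (final_queue v X m))) = ?U"
    by (subst burke[where K = "\<lambda>_ u. return_pmf u"]) (use p z in \<open>auto simp: bind_return_pmf'\<close>)
  also have "(\<integral>\<^sup>+u. ?g u \<partial>?U) = (\<integral>\<^sup>+u. (\<Prod>k<n. ennreal (exp (\<theta> * real (u k)))) \<partial>?U)"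
    by (simp add: sum_distrib_left exp_sum prod_ennreal)
  also have "\<dots> = (\<Prod>k<n. \<integral>\<^sup>+u. ennreal (exp (\<theta> * real u)) \<partial>queue_pmf z (p k))"
    by (rule nn_integral_prod_Pi_pmf) simp
  also have "\<dots> = (\<Prod>k<n. ennreal (exp ((ln (z - p k) - ln z) - (ln (w - p k) - ln w))))"
    by (intro prod.cong refl nn_integral_queue_pmf_exp) (use p z w \<theta> in auto)
  also have "ennreal (((1 - w) / (1 - z)) ^ m) * \<dots> =
      ennreal (exp (log_partition m n p z - log_partition m n p w))"
  proof -
    have "((1 - w) / (1 - z)) ^ m = exp (real m * (ln (1 - w) - ln (1 - z)))"
      using z w by (simp add: exp_of_nat_mult exp_diff)
    then show ?thesis
      by (simp add: log_partition_def prod_ennreal exp_sum[symmetric] exp_add[symmetric]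
          sum_subtractf sum.distrib algebra_simps flip: ennreal_mult'')
  qed
  finally show ?thesis .
qed

section \<open>The stationary mean near its minimum\<close>

definition stationary_mean :: "nat \<Rightarrow> nat \<Rightarrow> (nat \<Rightarrow> real) \<Rightarrow> real \<Rightarrow> real" where
  "stationary_mean m n p x = real m * x + (1 - x) * (\<Sum>j<n. p j / (x - p j))"

definition stationary_slope :: "nat \<Rightarrow> nat \<Rightarrow> (nat \<Rightarrow> real) \<Rightarrow> real \<Rightarrow> real" where
  "stationary_slope m n p x = real m - (\<Sum>j<n. p j * (1 - p j) / (x - p j)\<^sup>2)"

text \<open>Reversed environments arise from rotating the matrix, which is how an appended last
  column becomes a left boundary.\<close>

lemma sum_rev_env: "(\<Sum>j<n. f (p (n - Suc j))) = (\<Sum>j<n. f (p j :: real) :: real)"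
  by (rule sum.nat_diff_reindex)

lemma stationary_mean_rev: "stationary_mean m n (\<lambda>j. p (n - Suc j)) x = stationary_mean m n p x"
  unfolding stationary_mean_def by (subst sum_rev_env[of "\<lambda>q. q / (x - q)"]) simp

lemma stationary_slope_rev: "stationary_slope m n (\<lambda>j. p (n - Suc j)) x = stationary_slope m n p x"
  unfolding stationary_slope_def by (subst sum_rev_env[of "\<lambda>q. q * (1 - q) / (x - q)\<^sup>2"]) simp

lemma logit_mvt:
  assumes "0 < w" "w < z" "z < 1"
  shows "\<exists>\<xi>\<in>{w<..<z}. logit z - logit w = (z - w) * (1 / \<xi> + 1 / (1 - \<xi>))"
proof -
  have "\<exists>\<xi>. w < \<xi> \<and> \<xi> < z \<and> logit z - logit w = (z - w) * (1 / \<xi> + 1 / (1 - \<xi>))"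
    by (rule MVT2) (use assms in \<open>auto simp: logit_def[abs_def] intro!: derivative_eq_intros\<close>)
  then show ?thesis by auto
qed

text \<open>The derivative \<open>1 / \<xi> + 1 / (1 - \<xi>)\<close> is at least 1. This crude
  bound replaces a tilt by the distance of the two parameters, the form used in the
  exponents.\<close>

lemma logit_diff_ge:
  assumes "0 < w" "w < z" "z < 1"
  shows "z - w \<le> logit z - logit w"
proof -
  obtain \<xi> where \<xi>: "\<xi> \<in> {w<..<z}" "logit z - logit w = (z - w) * (1 / \<xi> + 1 / (1 - \<xi>))"
    using logit_mvt[OF assms] by blast
  have "1 \<le> 1 / \<xi>" "0 \<le> 1 / (1 - \<xi>)" using \<xi>(1) assms by auto
  then have "(z - w) * 1 \<le> (z - w) * (1 / \<xi> + 1 / (1 - \<xi>))"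
    using assms by (intro mult_left_mono) linarith+
  then show ?thesis using \<xi>(2) by simp
qed

lemma logit_diff_le:
  assumes "0 < l" "l \<le> w" "w < z" "z \<le> u" "u < 1"
  shows "logit z - logit w \<le> (z - w) * (1 / l + 1 / (1 - u))"
proof -
  obtain \<xi> where \<xi>: "\<xi> \<in> {w<..<z}" "logit z - logit w = (z - w) * (1 / \<xi> + 1 / (1 - \<xi>))"
    using logit_mvt[of w z] assms by force
  show ?thesis
    unfolding \<xi>(2) using \<xi>(1) assms by (intro mult_left_mono add_mono) (auto intro!: divide_left_mono)
qed

section \<open>Derivatives and quantitative convexity of the stationary mean\<close>

locale bounded_environment =
  fixes n :: nat and p :: "nat \<Rightarrow> real" and b :: real
  assumes p: "\<And>j. j < n \<Longrightarrow> 0 \<le> p j \<and> p j \<le> b" and b: "0 \<le> b" "b < 1"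
begin

lemma stationary_mean_deriv:
  assumes "b < x" "x < 1"
  shows "(stationary_mean m n p has_real_derivative stationary_slope m n p x) (at x)"
proof -
  have "((\<lambda>x. real m * x + (1 - x) * (\<Sum>j<n. p j / (x - p j))) has_real_derivative
      real m + ((1 - x) * (\<Sum>j<n. - (p j / (x - p j)\<^sup>2)) + (- 1) * (\<Sum>j<n. p j / (x - p j)))) (at x)"
    using p assms by (auto intro!: derivative_eq_intros sum.cong simp: power2_eq_square) fastforce
  moreover have "(1 - x) * (\<Sum>j<n. - (p j / (x - p j)\<^sup>2)) + (- 1) * (\<Sum>j<n. p j / (x - p j))
      = - (\<Sum>j<n. p j * (1 - p j) / (x - p j)\<^sup>2)"
  proof -
    have "(1 - x) * (- (p j / (x - p j)\<^sup>2)) + (- 1) * (p j / (x - p j)) = - (p j * (1 - p j) / (x - p j)\<^sup>2)"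
      if "j < n" for j
      using p[OF that] assms by (simp add: divide_simps power2_eq_square) (simp add: algebra_simps)
    then show ?thesis by (simp add: sum_distrib_left flip: sum_negf sum.distrib)
  qed
  ultimately show ?thesis
    by (simp add: stationary_mean_def[abs_def] stationary_slope_def)
qed

lemma stationary_mean_mvt:
  assumes "b < x" "x < y" "y < 1"
  shows "\<exists>\<xi>. x < \<xi> \<and> \<xi> < y \<and>
    stationary_mean m n p y - stationary_mean m n p x = (y - x) * stationary_slope m n p \<xi>"
  by (rule MVT2) (use assms stationary_mean_deriv in auto)

text \<open>Cauchy's mean value theorem, since the derivatives satisfy
  \<open>log_partition' = logit' * stationary_mean\<close>.\<close>

lemma log_partition_mvt:
  assumes "b < w" "w < z" "z < 1"
  shows "\<exists>\<xi>\<in>{w<..<z}. log_partition m n p z - log_partition m n p w =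
    (logit z - logit w) * stationary_mean m n p \<xi>"
proof -
  have pos: "0 < x - p j" if "b < x" "j < n" for x j using p[OF that(2)] that(1) by simp
  have L: "(log_partition m n p has_real_derivative
      (\<Sum>j<n. 1 / (x - p j) - 1 / x) + real m / (1 - x)) (at x)" if "b < x" "x < 1" for x
    unfolding log_partition_def[abs_def] using pos[OF that(1)] that b
    by (auto intro!: derivative_eq_intros sum.cong simp: divide_simps)
  have g: "(logit has_real_derivative 1 / x + 1 / (1 - x)) (at x)" if "b < x" "x < 1" for x
    unfolding logit_def[abs_def] using that b by (auto intro!: derivative_eq_intros)
  have "\<exists>\<xi>. w < \<xi> \<and> \<xi> < z \<and>
      (log_partition m n p z - log_partition m n p w) * (1 / \<xi> + 1 / (1 - \<xi>)) =
      (logit z - logit w) * ((\<Sum>j<n. 1 / (\<xi> - p j) - 1 / \<xi>) + real m / (1 - \<xi>))"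
  proof (rule GMVT'[OF assms(2)])
    fix x assume "w \<le> x" "x \<le> z"
    then have "b < x" "x < 1" using assms by auto
    then show "isCont (log_partition m n p) x" "isCont logit x"
      using L g DERIV_isCont by blast+
  qed (use L g assms in auto)
  then obtain \<xi> where \<xi>: "w < \<xi>" "\<xi> < z"
    and eq: "(log_partition m n p z - log_partition m n p w) * (1 / \<xi> + 1 / (1 - \<xi>)) =
      (logit z - logit w) * ((\<Sum>j<n. 1 / (\<xi> - p j) - 1 / \<xi>) + real m / (1 - \<xi>))" by blast
  have x: "0 < \<xi>" "\<xi> < 1" "b < \<xi>" using \<xi> assms b by auto
  have "1 / (\<xi> - p j) - 1 / \<xi> = (1 / \<xi>) * (p j / (\<xi> - p j))" if "j < n" for j
    using pos[OF x(3) that] x by (simp add: divide_simps)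
  then have "(\<Sum>j<n. 1 / (\<xi> - p j) - 1 / \<xi>) = (1 / \<xi>) * (\<Sum>j<n. p j / (\<xi> - p j))"
    by (simp add: sum_distrib_left)
  moreover have "(1 / x) * T + M / (1 - x) = (1 / x + 1 / (1 - x)) * (M * x + (1 - x) * T)"
    if "0 < x" "x < 1" for x T M :: real
    using that by (simp add: divide_simps)
  ultimately have "(\<Sum>j<n. 1 / (\<xi> - p j) - 1 / \<xi>) + real m / (1 - \<xi>) =
      (1 / \<xi> + 1 / (1 - \<xi>)) * stationary_mean m n p \<xi>"
    using x(1,2) by (simp only: stationary_mean_def)
  with eq have "(1 / \<xi> + 1 / (1 - \<xi>)) * (log_partition m n p z - log_partition m n p w) =
      (1 / \<xi> + 1 / (1 - \<xi>)) * ((logit z - logit w) * stationary_mean m n p \<xi>)"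
    by (simp add: mult_ac)
  moreover have "1 / \<xi> + 1 / (1 - \<xi>) \<noteq> 0" using x by (simp add: divide_simps)
  ultimately show ?thesis using \<xi> by auto
qed

text \<open>Prepares Chernoff exponents: if the stationary mean stays below the level x by g between
  the two parameters, the exponent at level x is at most -(z - w) g.\<close>

lemma log_partition_diff_le:
  assumes "b < w" "w < z" "z < 1" and "\<And>\<xi>. w < \<xi> \<Longrightarrow> \<xi> < z \<Longrightarrow> stationary_mean m n p \<xi> \<le> x - g" "0 \<le> g"
  shows "log_partition m n p z - log_partition m n p w \<le> (logit z - logit w) * x - (z - w) * g"
proof -
  obtain \<xi> where \<xi>: "w < \<xi>" "\<xi> < z" "log_partition m n p z - log_partition m n p w =
    (logit z - logit w) * stationary_mean m n p \<xi>"
    using log_partition_mvt[OF assms(1-3), of m] by auto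
  have l: "z - w \<le> logit z - logit w" using assms b by (intro logit_diff_ge) auto
  then have "(logit z - logit w) * stationary_mean m n p \<xi> \<le> (logit z - logit w) * (x - g)"
    using assms \<xi> by (intro mult_left_mono) auto
  moreover have "(z - w) * g \<le> (logit z - logit w) * g"
    using l assms by (intro mult_right_mono) auto
  ultimately show ?thesis using \<xi>(3) by (simp add: algebra_simps)
qed

lemma log_partition_diff_ge:
  assumes "b < w" "w < z" "z < 1" and "\<And>\<xi>. w < \<xi> \<Longrightarrow> \<xi> < z \<Longrightarrow> x + g \<le> stationary_mean m n p \<xi>" "0 \<le> g"
  shows "(logit z - logit w) * x + (z - w) * g \<le> log_partition m n p z - log_partition m n p w"
proof -
  obtain \<xi> where \<xi>: "w < \<xi>" "\<xi> < z" "log_partition m n p z - log_partition m n p w =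
    (logit z - logit w) * stationary_mean m n p \<xi>"
    using log_partition_mvt[OF assms(1-3), of m] by auto
  have l: "z - w \<le> logit z - logit w" using assms b by (intro logit_diff_ge) auto
  then have "(logit z - logit w) * (x + g) \<le> (logit z - logit w) * stationary_mean m n p \<xi>"
    using assms \<xi> by (intro mult_left_mono) auto
  moreover have "(z - w) * g \<le> (logit z - logit w) * g"
    using l assms by (intro mult_right_mono) auto
  ultimately show ?thesis using \<xi>(3) by (simp add: algebra_simps)
qed

text \<open>Each summand at x is at most 1 - (x - a) times its value at \<open>a\<close>, because x
  - p j \<le> 1. So the slope grows at rate at least m, up to an error of the size of the slope at
  \<open>a\<close>.\<close>

lemma slope_right_ge:
  assumes "b < a" "a \<le> x" "x < 1"
  shows "(x - a) * real m - \<bar>stationary_slope m n p a\<bar> \<le> stationary_slope m n p x"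
proof -
  have "p j * (1 - p j) / (x - p j)\<^sup>2 \<le> (1 - (x - a)) * (p j * (1 - p j) / (a - p j)\<^sup>2)" if j: "j < n" for j
  proof -
    have pj: "0 \<le> p j" "p j < a" "p j < 1" using p[OF j] assms b by auto
    have "(a - p j) / (x - p j) \<le> 1" using pj assms by simp
    then have "((a - p j) / (x - p j))\<^sup>2 \<le> (a - p j) / (x - p j)"
      unfolding power2_eq_square using pj assms by (intro mult_left_le) auto
    also have "\<dots> = 1 - (x - a) / (x - p j)" using pj assms by (simp add: field_simps)
    also have "\<dots> \<le> 1 - (x - a)"
    proof -
      have "(x - a) * (x - p j) \<le> (x - a) * 1" using pj assms by (intro mult_left_mono) auto
      then show ?thesis using pj assms by (simp add: field_simps)
    qed
    finally have "((a - p j) / (x - p j))\<^sup>2 * (p j * (1 - p j) / (a - p j)\<^sup>2) \<le>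
        (1 - (x - a)) * (p j * (1 - p j) / (a - p j)\<^sup>2)"
      using pj by (intro mult_right_mono) auto
    then show ?thesis using pj assms by (simp add: power_divide)
  qed
  then have "(\<Sum>j<n. p j * (1 - p j) / (x - p j)\<^sup>2) \<le> (1 - (x - a)) * (\<Sum>j<n. p j * (1 - p j) / (a - p j)\<^sup>2)"
    unfolding sum_distrib_left by (intro sum_mono) auto
  moreover have "\<dots> = (1 - (x - a)) * (real m - stationary_slope m n p a)"
    by (simp add: stationary_slope_def)
  moreover have "\<bar>(1 - (x - a)) * stationary_slope m n p a\<bar> \<le> \<bar>stationary_slope m n p a\<bar>"
    unfolding abs_mult using assms b by (intro mult_left_le_one_le) auto
  ultimately show ?thesis
    unfolding stationary_slope_def[of m n p x] by (simp add: algebra_simps)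
qed

lemma slope_left_le:
  assumes "b < x" "x \<le> a" "a < 1"
  shows "stationary_slope m n p x \<le> 2 * \<bar>stationary_slope m n p a\<bar> - (a - x) * real m"
proof -
  have "(1 + (a - x)) * (p j * (1 - p j) / (a - p j)\<^sup>2) \<le> p j * (1 - p j) / (x - p j)\<^sup>2" if j: "j < n" for j
  proof -
    have pj: "0 \<le> p j" "p j < x" "p j < 1" using p[OF j] assms b by auto
    have "1 + (a - x) \<le> 1 + (a - x) / (x - p j)"
    proof -
      have "(a - x) * (x - p j) \<le> (a - x) * 1" using pj assms by (intro mult_left_mono) auto
      then show ?thesis using pj assms by (simp add: field_simps)
    qed
    also have "\<dots> = (a - p j) / (x - p j)" using pj assms by (simp add: field_simps)
    also have "\<dots> \<le> ((a - p j) / (x - p j))\<^sup>2"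
      using pj assms by (intro self_le_power) auto
    finally have "(1 + (a - x)) * (p j * (1 - p j) / (a - p j)\<^sup>2) \<le>
        ((a - p j) / (x - p j))\<^sup>2 * (p j * (1 - p j) / (a - p j)\<^sup>2)"
      using pj by (intro mult_right_mono) auto
    then show ?thesis using pj assms by (simp add: power_divide)
  qed
  then have "(1 + (a - x)) * (\<Sum>j<n. p j * (1 - p j) / (a - p j)\<^sup>2) \<le> (\<Sum>j<n. p j * (1 - p j) / (x - p j)\<^sup>2)"
    unfolding sum_distrib_left by (intro sum_mono) auto
  moreover have "(1 + (a - x)) * (\<Sum>j<n. p j * (1 - p j) / (a - p j)\<^sup>2) =
      (1 + (a - x)) * (real m - stationary_slope m n p a)"
    by (simp add: stationary_slope_def)
  \<comment> \<open>The factor 1 + (a - x) is at most 2, whence the 2 in the conclusion.\<close>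
  moreover have "\<bar>(1 + (a - x)) * stationary_slope m n p a\<bar> \<le> 2 * \<bar>stationary_slope m n p a\<bar>"
    unfolding abs_mult using assms b by (intro mult_right_mono) auto
  ultimately show ?thesis
    unfolding stationary_slope_def[of m n p x] by (simp add: algebra_simps)
qed

text \<open>The opposite bound limits the rise of \<open>\<Phi>\<close> near \<open>a\<close> to O(m
  h^2). It comes from (1 - t)^2 \<ge> 1 - 2 t for t = (x - a) / (x - p j) \<le> (x - a) / (a - b),
  so its constant depends on the distance of \<open>a\<close> from \<open>b\<close>.\<close>

lemma slope_right_le:
  assumes "b < a" "a \<le> x" "x < 1"
  shows "stationary_slope m n p x \<le> \<bar>stationary_slope m n p a\<bar>
    + 2 * (x - a) / (a - b) * (real m + \<bar>stationary_slope m n p a\<bar>)"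
proof -
  let ?t = "2 * (x - a) / (a - b)"
  have "(1 - ?t) * (p j * (1 - p j) / (a - p j)\<^sup>2) \<le> p j * (1 - p j) / (x - p j)\<^sup>2" if j: "j < n" for j
  proof -
    have pj: "0 \<le> p j" "p j \<le> b" "p j < 1" using p[OF j] assms b by auto
    have "1 - ?t \<le> 1 - 2 * ((x - a) / (x - p j))"
      using pj assms by (simp add: divide_left_mono)
    also have "\<dots> \<le> (1 - (x - a) / (x - p j))\<^sup>2"
      using zero_le_power2[of "(x - a) / (x - p j)"] by (simp add: power2_diff)
    also have "1 - (x - a) / (x - p j) = (a - p j) / (x - p j)" using pj assms by (simp add: field_simps)
    finally have "(1 - ?t) * (p j * (1 - p j) / (a - p j)\<^sup>2) \<le>
        ((a - p j) / (x - p j))\<^sup>2 * (p j * (1 - p j) / (a - p j)\<^sup>2)"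
      using pj by (intro mult_right_mono) auto
    then show ?thesis using pj assms by (simp add: power_divide)
  qed
  then have "(1 - ?t) * (\<Sum>j<n. p j * (1 - p j) / (a - p j)\<^sup>2) \<le> (\<Sum>j<n. p j * (1 - p j) / (x - p j)\<^sup>2)"
    unfolding sum_distrib_left by (intro sum_mono) auto
  moreover have "(\<Sum>j<n. p j * (1 - p j) / (a - p j)\<^sup>2) = real m - stationary_slope m n p a"
    by (simp add: stationary_slope_def)
  ultimately have "stationary_slope m n p x \<le> real m - (1 - ?t) * (real m - stationary_slope m n p a)"
    unfolding stationary_slope_def[of m n p x] by simp
  also have "\<dots> = stationary_slope m n p a + ?t * (real m - stationary_slope m n p a)"
    by (simp add: algebra_simps)
  also have "\<dots> \<le> \<bar>stationary_slope m n p a\<bar> + ?t * (real m + \<bar>stationary_slope m n p a\<bar>)"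
    using assms by (intro add_mono mult_left_mono) auto
  finally show ?thesis .
qed

end

text \<open>The numbers 14 and 10 keep all parameters between \<open>a - 5 * h\<close> and
  \<open>a + 7 * h\<close> in the inner halves of the intervals from \<open>a\<close> to
  \<open>b\<close> and from \<open>a\<close> to 1. The slope condition puts the minimum of the
  stationary mean within distance h of \<open>a\<close>.\<close>

locale near_critical = bounded_environment +
  fixes m :: nat and a h :: real
  assumes a: "b < a" "a < 1" and h: "0 < h" "14 * h \<le> 1 - a" "10 * h \<le> a - b"
    and slope: "\<bar>stationary_slope m n p a\<bar> \<le> real m * h / 4"
begin

abbreviation "\<Phi> \<equiv> stationary_mean m n p"

lemma h_le: "h \<le> 1" using h a b by linarith

lemma slope_right: "a + h \<le> x \<Longrightarrow> x < 1 \<Longrightarrow> real m * h / 2 \<le> stationary_slope m n p x"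
proof -
  assume x: "a + h \<le> x" "x < 1"
  have "real m * h \<le> real m * (x - a)" using x by (intro mult_left_mono) auto
  then show ?thesis using slope_right_ge[of a x m] x h slope a by (simp add: mult.commute)
qed

lemma slope_right_near: "a \<le> x \<Longrightarrow> x < 1 \<Longrightarrow> - (real m * h / 4) \<le> stationary_slope m n p x"
proof -
  assume x: "a \<le> x" "x < 1"
  have "0 \<le> (x - a) * real m" using x by simp
  then show ?thesis using slope_right_ge[OF a(1) x, of m] slope by linarith
qed

lemma slope_left: "b < x \<Longrightarrow> x \<le> a - h \<Longrightarrow> stationary_slope m n p x \<le> - (real m * h / 2)"
proof -
  assume x: "b < x" "x \<le> a - h"
  have "real m * h \<le> real m * (a - x)" using x by (intro mult_left_mono) auto
  then show ?thesis using slope_left_le[of x a m] x h slope a by (simp add: mult.commute)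
qed

lemma slope_right_growth:
  assumes "a \<le> x" "x \<le> a + 7 * h"
  shows "stationary_slope m n p x \<le> 18 / (a - b) * (real m * h)"
proof -
  have x1: "x < 1" using assms h by linarith
  have "\<bar>stationary_slope m n p a\<bar> \<le> real m * 1 / 4"
    using slope h_le mult_left_mono[of h 1 "real m"] by simp
  moreover have "2 * (x - a) / (a - b) \<le> 14 * h / (a - b)"
    using assms a by (intro divide_right_mono) auto
  ultimately have "2 * (x - a) / (a - b) * (real m + \<bar>stationary_slope m n p a\<bar>)
      \<le> 14 * h / (a - b) * (real m + real m * 1 / 4)"
    using a h by (intro mult_mono) auto
  then have "stationary_slope m n p x \<le> real m * h / 4 + 14 * h / (a - b) * (real m + real m * 1 / 4)"
    using slope_right_le[of a x m] a assms x1 slope by linarith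
  also have "\<dots> \<le> (1 / (4 * (a - b))) * (real m * h) + 14 * h / (a - b) * (real m + real m * 1 / 4)"
  proof -
    have "1 / 4 \<le> 1 / (4 * (a - b))" using a b by (intro divide_left_mono) auto
    then show ?thesis using h mult_right_mono[of "1 / 4" "1 / (4 * (a - b))" "real m * h"] by simp
  qed
  \<comment> \<open>The constant is 1/4 + 14 * 5/4 = 71/4, rounded up to 18 below.\<close>
  also have "\<dots> = (71 / 4) / (a - b) * (real m * h)"
  proof -
    have "(1 / (4 * d)) * (r * h) + 14 * h / d * (r + r * 1 / 4) = (71 / 4) / d * (r * h)"
      if "0 < d" for d r :: real
      using that by (simp add: field_simps)
    then show ?thesis by this (use a in simp)
  qed
  also have "\<dots> \<le> 18 / (a - b) * (real m * h)"
    using a h by (intro mult_right_mono divide_right_mono) auto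
  finally show ?thesis .
qed

lemma mean_right_increase:
  assumes "a + h \<le> x" "x + h \<le> y" "y < 1"
  shows "\<Phi> x + real m * h\<^sup>2 / 2 \<le> \<Phi> y"
proof -
  obtain \<xi> where \<xi>: "x < \<xi>" "\<xi> < y" "\<Phi> y - \<Phi> x = (y - x) * stationary_slope m n p \<xi>"
    using stationary_mean_mvt[of x y m] assms a h by auto
  have "h * (real m * h / 2) \<le> (y - x) * stationary_slope m n p \<xi>"
    using assms \<xi> h slope_right[of \<xi>] by (intro mult_mono) auto
  moreover have "h * (real m * h / 2) = real m * h\<^sup>2 / 2" by (simp add: power2_eq_square)
  ultimately show ?thesis using \<xi>(3) by linarith
qed

lemma mean_right_mono:
  assumes "a + h \<le> x" "x \<le> y" "y < 1"
  shows "\<Phi> x \<le> \<Phi> y"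
proof (cases "x = y")
  case False
  obtain \<xi> where \<xi>: "x < \<xi>" "\<xi> < y" "\<Phi> y - \<Phi> x = (y - x) * stationary_slope m n p \<xi>"
    using stationary_mean_mvt[of x y m] assms a h False by auto
  have "0 \<le> real m * h / 2" using h by simp
  also have "\<dots> \<le> stationary_slope m n p \<xi>" using slope_right[of \<xi>] \<xi> assms by simp
  finally show ?thesis using \<xi> by (smt (verit) mult_nonneg_nonneg)
qed simp

lemma mean_left_decrease:
  assumes "b < x" "x + h \<le> y" "y \<le> a - h"
  shows "\<Phi> y + real m * h\<^sup>2 / 2 \<le> \<Phi> x"
proof -
  obtain \<xi> where \<xi>: "x < \<xi>" "\<xi> < y" "\<Phi> y - \<Phi> x = (y - x) * stationary_slope m n p \<xi>"
    using stationary_mean_mvt[of x y m] assms a h by auto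
  have "h * (real m * h / 2) \<le> (y - x) * - stationary_slope m n p \<xi>"
    using assms \<xi> h slope_left[of \<xi>] by (intro mult_mono) auto
  moreover have "h * (real m * h / 2) = real m * h\<^sup>2 / 2" by (simp add: power2_eq_square)
  ultimately show ?thesis using \<xi>(3) by linarith
qed

lemma mean_left_mono:
  assumes "b < x" "x \<le> y" "y \<le> a - h"
  shows "\<Phi> y \<le> \<Phi> x"
proof (cases "x = y")
  case False
  obtain \<xi> where \<xi>: "x < \<xi>" "\<xi> < y" "\<Phi> y - \<Phi> x = (y - x) * stationary_slope m n p \<xi>"
    using stationary_mean_mvt[of x y m] assms a h False by auto
  have "stationary_slope m n p \<xi> \<le> - (real m * h / 2)" using slope_left[of \<xi>] \<xi> assms by simp
  also have "\<dots> \<le> 0" using h by simp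
  finally show ?thesis using \<xi> by (smt (verit) mult_nonneg_nonpos)
qed simp

text \<open>Between \<open>a\<close> and \<open>a + h\<close> the mean may fall, but by at most m
  h^2 / 4; the next stretch of length h wins back m h^2 / 2.\<close>

lemma mean_critical_le: "a + 2 * h \<le> y \<Longrightarrow> y < 1 \<Longrightarrow> \<Phi> a \<le> \<Phi> y"
proof -
  assume y: "a + 2 * h \<le> y" "y < 1"
  obtain \<xi> where \<xi>: "a < \<xi>" "\<xi> < a + h" "\<Phi> (a + h) - \<Phi> a = ((a + h) - a) * stationary_slope m n p \<xi>"
    using stationary_mean_mvt[of a "a + h" m] a h by auto
  have "h * - (real m * h / 4) \<le> h * stationary_slope m n p \<xi>"
    using \<xi> y h slope_right_near[of \<xi>] by (intro mult_left_mono) auto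
  moreover have "\<Phi> (a + h) + real m * h\<^sup>2 / 2 \<le> \<Phi> y"
    using y h by (intro mean_right_increase) auto
  moreover have "0 \<le> real m * h\<^sup>2" by simp
  moreover have "h * - (real m * h / 4) = - (real m * h\<^sup>2 / 4)" by (simp add: power2_eq_square)
  moreover have "\<Phi> (a + h) - \<Phi> a = h * stationary_slope m n p \<xi>" using \<xi>(3) by simp
  ultimately show ?thesis by linarith
qed

text \<open>An interval of length at most 7 h and the slope bound 18 / (a - b) * (m h) give the
  constant 126 = 7 * 18.\<close>

lemma mean_near_le:
  assumes "a < x" "x \<le> a + 7 * h"
  shows "\<Phi> x \<le> \<Phi> a + 126 / (a - b) * (real m * h\<^sup>2)"
proof -
  have x1: "x < 1" using assms h by linarith
  obtain \<xi> where \<xi>: "a < \<xi>" "\<xi> < x" "\<Phi> x - \<Phi> a = (x - a) * stationary_slope m n p \<xi>"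
    using stationary_mean_mvt[of a x m] assms x1 a by auto
  have "(x - a) * stationary_slope m n p \<xi> \<le> (x - a) * (18 / (a - b) * (real m * h))"
    using \<xi> assms slope_right_growth[of \<xi>] by (intro mult_left_mono) auto
  also have "\<dots> \<le> (7 * h) * (18 / (a - b) * (real m * h))"
    using assms a h by (intro mult_right_mono) auto
  also have "\<dots> = 126 / (a - b) * (real m * h\<^sup>2)" by (simp add: power2_eq_square)
  finally show ?thesis using \<xi>(3) by simp
qed

end

section \<open>Tail bounds with boundaries\<close>

definition columns_pmf :: "nat \<Rightarrow> nat \<Rightarrow> (nat \<Rightarrow> real) \<Rightarrow> (nat \<Rightarrow> nat \<Rightarrow> bool) pmf" where
  "columns_pmf m n p = Pi_pmf {..<n} (\<lambda>_. False) (\<lambda>j. bernoullis m (p j))"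

lemma prob_le_exp_moment:
  assumes "(\<integral>\<^sup>+x. ennreal (exp (f x)) \<partial>measure_pmf P) \<le> ennreal (exp c)"
  shows "measure_pmf.prob P {x. t \<le> f x} \<le> exp (c - t)"
proof -
  have "emeasure (measure_pmf P) {x. t \<le> f x} = (\<integral>\<^sup>+x. indicator {x. t \<le> f x} x \<partial>measure_pmf P)"
    by simp
  also have "\<dots> \<le> (\<integral>\<^sup>+x. ennreal (exp (- t)) * ennreal (exp (f x)) \<partial>measure_pmf P)"
    by (intro nn_integral_mono) (auto simp: indicator_def simp flip: ennreal_mult exp_add)
  also have "\<dots> = ennreal (exp (- t)) * (\<integral>\<^sup>+x. ennreal (exp (f x)) \<partial>measure_pmf P)"
    by (rule nn_integral_cmult) simp
  also have "\<dots> \<le> ennreal (exp (- t)) * ennreal (exp c)"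
    by (intro mult_left_mono assms) simp
  also have "\<dots> = ennreal (exp (c - t))" by (simp add: algebra_simps flip: ennreal_mult exp_add)
  finally show ?thesis by (simp add: measure_pmf.emeasure_eq_measure)
qed

text \<open>The right-hand side is free of z: every z gives a coupling of the same columns with a
  boundary model.\<close>

lemma map_bulk_pmf_columns: "map_pmf (\<lambda>X j. snd (X j)) (bulk_pmf m n z p) = columns_pmf m n p"
proof -
  have "columns_pmf m n p = Pi_pmf {..<n} (\<lambda>_. False)
      (\<lambda>j. map_pmf snd (pair_pmf (queue_pmf z (p j)) (bernoullis m (p j))))"
    by (simp add: columns_pmf_def map_snd_pair_pmf)
  also have "\<dots> = map_pmf (\<lambda>X. snd \<circ> X) (bulk_pmf m n z p)"
    unfolding bulk_pmf_def by (rule Pi_pmf_map) auto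
  finally show ?thesis by (simp add: comp_def)
qed

lemma map_columns_pmf_rows:
  assumes "i \<le> m"
  shows "map_pmf (\<lambda>C j k. if k < i then C j k else False) (columns_pmf m n p) = columns_pmf i n p"
proof -
  have "bernoullis i q = map_pmf (\<lambda>f k. if k < i then f k else False) (bernoullis m q)" for q
    using Pi_pmf_subset[of "{..<m}" "{..<i}" False "\<lambda>_. bernoulli_pmf q"] assms by auto
  then have "columns_pmf i n p = Pi_pmf {..<n} (\<lambda>_. False)
      (\<lambda>j. map_pmf (\<lambda>f k. if k < i then f k else False) (bernoullis m (p j)))"
    by (simp add: columns_pmf_def)
  also have "\<dots> = map_pmf (\<lambda>C. (\<lambda>f k. if k < i then f k else False) \<circ> C) (columns_pmf m n p)"
    unfolding columns_pmf_def by (rule Pi_pmf_map) auto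
  finally show ?thesis by (simp add: comp_def)
qed

section \<open>Rotating the random matrix\<close>

lemma Pi_pmf_reindex_involution:
  assumes A: "finite A" and h: "\<And>x. h (h x) = x" "\<And>x. x \<in> A \<Longrightarrow> h x \<in> A"
  shows "map_pmf (\<lambda>g. g \<circ> h) (Pi_pmf A d q) = Pi_pmf A d (\<lambda>x. q (h x))"
proof (rule pmf_eqI)
  fix f :: "'a \<Rightarrow> 'b"
  have hA: "h x \<in> A \<longleftrightarrow> x \<in> A" for x using h by metis
  have inj: "inj (\<lambda>g. g \<circ> h)"
    by (rule injI) (metis comp_assoc h(1) comp_def comp_id eq_id_iff)
  have f: "f = (\<lambda>g. g \<circ> h) (f \<circ> h)" using h(1) by (simp add: fun_eq_iff)
  have "pmf (map_pmf (\<lambda>g. g \<circ> h) (Pi_pmf A d q)) f = pmf (Pi_pmf A d q) (f \<circ> h)"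
    by (subst f, rule pmf_map_inj'[OF inj])
  also have "\<dots> = pmf (Pi_pmf A d (\<lambda>x. q (h x))) f"
  proof -
    have "(\<Prod>x\<in>A. pmf (q x) (f (h x))) = (\<Prod>x\<in>A. pmf (q (h x)) (f x))"
      by (rule prod.reindex_bij_witness[of _ h h]) (use h in auto)
    moreover have "(\<forall>x. x \<notin> A \<longrightarrow> f (h x) = d) \<longleftrightarrow> (\<forall>x. x \<notin> A \<longrightarrow> f x = d)"
      using hA h(1) by metis
    ultimately show ?thesis by (auto simp: pmf_Pi[OF A])
  qed
  finally show "pmf (map_pmf (\<lambda>g. g \<circ> h) (Pi_pmf A d q)) f = pmf (Pi_pmf A d (\<lambda>x. q (h x))) f" .
qed

text \<open>The reversal of \<open>{..<m}\<close>, extended by the identity so that it is an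
  involution on all indices and composition with it keeps the default values outside.\<close>

definition flip_below :: "nat \<Rightarrow> nat \<Rightarrow> nat" where
  "flip_below m i = (if i < m then m - Suc i else i)"

lemma flip_below_involution [simp]: "flip_below m (flip_below m i) = i"
  by (auto simp: flip_below_def)

lemma map_bernoullis_flip:
  "map_pmf (\<lambda>f. f \<circ> flip_below m) (bernoullis m q) = bernoullis m q"
  by (subst Pi_pmf_reindex_involution) (auto simp: flip_below_def)

lemma map_columns_pmf_flip:
  "map_pmf (\<lambda>C j. C (flip_below n j) \<circ> flip_below m) (columns_pmf m n p)
    = columns_pmf m n (\<lambda>j. p (n - Suc j))"
proof -
  have "columns_pmf m n (\<lambda>j. p (n - Suc j)) = Pi_pmf {..<n} (\<lambda>_. False)
      (\<lambda>j. map_pmf (\<lambda>f. f \<circ> flip_below m) (bernoullis m (p (flip_below n j))))"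
    unfolding columns_pmf_def map_bernoullis_flip
    by (intro Pi_pmf_cong) (auto simp: flip_below_def)
  also have "\<dots> = map_pmf (\<lambda>C. (\<lambda>f. f \<circ> flip_below m) \<circ> C)
      (Pi_pmf {..<n} (\<lambda>_. False) (\<lambda>j. bernoullis m (p (flip_below n j))))"
    by (rule Pi_pmf_map) auto
  also have "Pi_pmf {..<n} (\<lambda>_. False) (\<lambda>j. bernoullis m (p (flip_below n j))) =
      map_pmf (\<lambda>C. C \<circ> flip_below n) (columns_pmf m n p)"
    unfolding columns_pmf_def by (subst Pi_pmf_reindex_involution) (auto simp: flip_below_def)
  finally show ?thesis by (simp add: map_pmf_comp comp_def)
qed

text \<open>An empty station without services outputs exactly its arrivals, so the first column of a
  matrix acts as a left boundary for the others.\<close>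

lemma columns_passage_first_column:
  "columns_passage (case_nat v C) i (Suc j) = passage v (\<lambda>j. (0, C j)) i j"
proof -
  have dep: "departures 0 (\<lambda>_. False) v = v"
    by (auto simp: departures_def fun_eq_iff)
  have "services (\<lambda>_. False) (\<lambda>j. (0, case_nat v C j)) (Suc j) = services v (\<lambda>j. (0, C j)) j" for j
    by (induction j) (auto simp: dep)
  then show ?thesis by (simp add: columns_passage_def passage_def del: services.simps)
qed

lemma columns_passage_append_column_flip:
  "columns_passage (C(n := S)) m (Suc n) =
    passage (S \<circ> flip_below m) (\<lambda>j. (0, C (flip_below n j) \<circ> flip_below m)) m n"
proof -
  have "columns_passage (C(n := S)) m (Suc n) =
      columns_passage (\<lambda>j i. (C(n := S)) (Suc n - 1 - j) (m - 1 - i)) m (Suc n)"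
    by (rule columns_passage_rotate[symmetric])
  also have "\<dots> = columns_passage (case_nat (S \<circ> flip_below m)
      (\<lambda>j. C (flip_below n j) \<circ> flip_below m)) m (Suc n)"
    by (rule columns_passage_cong) (auto simp: flip_below_def split: nat.splits)
  finally show ?thesis by (simp add: columns_passage_first_column)
qed

lemma map_pmf_append_column_flip:
  "map_pmf (\<lambda>(C, S). (S \<circ> flip_below m, \<lambda>j. C (flip_below n j) \<circ> flip_below m))
     (pair_pmf (columns_pmf m n p) (bernoullis m w)) =
   pair_pmf (bernoullis m w) (columns_pmf m n (\<lambda>j. p (n - Suc j)))"
proof -
  have "pair_pmf (bernoullis m w) (columns_pmf m n (\<lambda>j. p (n - Suc j))) =
    pair_pmf (map_pmf (\<lambda>f. f \<circ> flip_below m) (bernoullis m w))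
      (map_pmf (\<lambda>C j. C (flip_below n j) \<circ> flip_below m) (columns_pmf m n p))"
    by (simp only: map_bernoullis_flip map_columns_pmf_flip)
  also have "\<dots> = map_pmf (\<lambda>(C, S). (S \<circ> flip_below m, \<lambda>j. C (flip_below n j) \<circ> flip_below m))
     (pair_pmf (columns_pmf m n p) (bernoullis m w))"
    by (subst pair_commute_pmf)
      (simp add: map_pair[symmetric] map_pmf_comp case_prod_beta' comp_def)
  finally show ?thesis ..
qed

text \<open>Adding independent points raises the density of a Bernoulli sequence while keeping it
  above the original one; this couples two left boundaries of different density.\<close>

lemma bernoulli_or:
  assumes "0 \<le> z" "z \<le> 1" "0 \<le> q" "q \<le> 1"
  shows "do {y \<leftarrow> bernoulli_pmf z; e \<leftarrow> bernoulli_pmf q; return_pmf (y \<or> e)} =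
    bernoulli_pmf (1 - (1 - z) * (1 - q))"
proof (rule pmf_eqI)
  fix b
  have "(1 - z) * (1 - q) \<le> 1" "0 \<le> (1 - z) * (1 - q)" using assms by (auto intro: mult_le_one)
  then show "pmf (do {y \<leftarrow> bernoulli_pmf z; e \<leftarrow> bernoulli_pmf q; return_pmf (y \<or> e)}) b =
      pmf (bernoulli_pmf (1 - (1 - z) * (1 - q))) b"
    using assms by (cases b) (simp_all add: pmf_bind algebra_simps)
qed

lemma bernoullis_or:
  assumes z: "0 \<le> z" "z \<le> 1" and q: "0 \<le> q" "q \<le> 1"
  shows "do {v \<leftarrow> bernoullis m z; x \<leftarrow> bernoullis m q; K (\<lambda>i. v i \<or> x i)} =
    bind_pmf (bernoullis m (1 - (1 - z) * (1 - q))) K"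
proof (induction m arbitrary: K)
  case 0
  show ?case by (simp add: bind_return_pmf)
next
  case (Suc m)
  let ?r = "1 - (1 - z) * (1 - q)"
  have or: "do {y \<leftarrow> bernoulli_pmf z; e \<leftarrow> bernoulli_pmf q; K' (y \<or> e)} = bind_pmf (bernoulli_pmf ?r) K'"
    for K' :: "bool \<Rightarrow> 'b pmf"
    using arg_cong[OF bernoulli_or[OF z q], of "\<lambda>D. bind_pmf D K'"]
    by (simp add: bind_assoc_pmf bind_return_pmf)
  have upd: "(\<lambda>i. (v(m := y)) i \<or> (x(m := e)) i) = (\<lambda>i. v i \<or> x i)(m := y \<or> e)" for v x y e
    by auto
  have "do {v \<leftarrow> bernoullis (Suc m) z; x \<leftarrow> bernoullis (Suc m) q; K (\<lambda>i. v i \<or> x i)} =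
    do {v \<leftarrow> bernoullis m z; y \<leftarrow> bernoulli_pmf z; x \<leftarrow> bernoullis m q;
      e \<leftarrow> bernoulli_pmf q; K ((\<lambda>i. v i \<or> x i)(m := y \<or> e))}"
    unfolding bind_bernoullis_Suc upd ..
  also have "\<dots> = do {v \<leftarrow> bernoullis m z; x \<leftarrow> bernoullis m q; y \<leftarrow> bernoulli_pmf z;
      e \<leftarrow> bernoulli_pmf q; K ((\<lambda>i. v i \<or> x i)(m := y \<or> e))}"
    by (rule bind_pmf_cong[OF refl], rule bind_commute_pmf)
  also have "\<dots> = do {v \<leftarrow> bernoullis m z; x \<leftarrow> bernoullis m q; y \<leftarrow> bernoulli_pmf ?r;
      K ((\<lambda>i. v i \<or> x i)(m := y))}"
  proof (rule bind_pmf_cong[OF refl], rule bind_pmf_cong[OF refl])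
    fix v x
    show "do {y \<leftarrow> bernoulli_pmf z; e \<leftarrow> bernoulli_pmf q; K ((\<lambda>i. v i \<or> x i)(m := y \<or> e))} =
        do {y \<leftarrow> bernoulli_pmf ?r; K ((\<lambda>i. v i \<or> x i)(m := y))}"
      by (rule or[of "\<lambda>c. K ((\<lambda>i. v i \<or> x i)(m := c))"])
  qed
  also have "\<dots> = do {v \<leftarrow> bernoullis m ?r; y \<leftarrow> bernoulli_pmf ?r; K (v(m := y))}"
    by (rule Suc.IH)
  also have "\<dots> = bind_pmf (bernoullis (Suc m) ?r) K"
    unfolding bind_bernoullis_Suc ..
  finally show ?case .
qed

lemma nn_integral_bernoulli_sum_exp:
  assumes w: "0 \<le> w" "w \<le> 1" and I: "I \<subseteq> {..<m}"
  shows "(\<integral>\<^sup>+S. ennreal (exp (\<theta> * (\<Sum>i\<in>I. of_bool (S i)))) \<partial>bernoullis m w) =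
    ennreal ((1 - w + w * exp \<theta>) ^ card I)"
proof -
  have fin: "finite I" using I finite_subset by blast
  have "ennreal (exp (\<theta> * (\<Sum>i\<in>I. of_bool (S i)))) =
      (\<Prod>i<m. if i \<in> I then ennreal (exp (\<theta> * of_bool (S i))) else 1)" for S
  proof -
    have "exp (\<theta> * (\<Sum>i\<in>I. of_bool (S i))) = (\<Prod>i\<in>I. exp (\<theta> * of_bool (S i)))"
      by (simp only: sum_distrib_left exp_sum[OF fin])
    moreover have "(\<Prod>i<m. if i \<in> I then ennreal (exp (\<theta> * of_bool (S i))) else 1) =
        (\<Prod>i\<in>I. ennreal (exp (\<theta> * of_bool (S i))))"
      using I by (subst prod.inter_restrict[symmetric]) (auto simp: Int_absorb1)
    ultimately show ?thesis by (simp only: prod_ennreal[OF exp_ge_zero])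
  qed
  then have "(\<integral>\<^sup>+S. ennreal (exp (\<theta> * (\<Sum>i\<in>I. of_bool (S i)))) \<partial>bernoullis m w) =
      (\<integral>\<^sup>+S. (\<Prod>i<m. (\<lambda>y. if i \<in> I then ennreal (exp (\<theta> * of_bool y)) else 1) (S i)) \<partial>bernoullis m w)"
    by (simp only:)
  also have "\<dots> = (\<Prod>i<m. \<integral>\<^sup>+y. (if i \<in> I then ennreal (exp (\<theta> * of_bool y)) else 1) \<partial>bernoulli_pmf w)"
    by (rule nn_integral_prod_Pi_pmf) simp
  also have "\<dots> = (\<Prod>i<m. if i \<in> I then ennreal (1 - w + w * exp \<theta>) else 1)"
  proof (intro prod.cong refl)
    fix i
    have "ennreal (exp \<theta>) * ennreal w + ennreal (1 - w) = ennreal (1 - w + w * exp \<theta>)"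
      using w by (simp add: algebra_simps flip: ennreal_mult'' ennreal_plus)
    then show "(\<integral>\<^sup>+y. (if i \<in> I then ennreal (exp (\<theta> * of_bool y)) else 1) \<partial>bernoulli_pmf w) =
        (if i \<in> I then ennreal (1 - w + w * exp \<theta>) else 1)"
      using w by (simp flip: ennreal_plus)
  qed
  also have "\<dots> = (\<Prod>i\<in>I. ennreal (1 - w + w * exp \<theta>))"
    using I by (subst prod.inter_restrict[symmetric]) (auto simp: Int_absorb1)
  also have "\<dots> = ennreal ((1 - w + w * exp \<theta>) ^ card I)"
    using w by (simp only: prod_constant) (rule ennreal_power, simp)
  finally show ?thesis .
qed

section \<open>Chernoff bounds for the boundary models\<close>

context bounded_environment
begin

lemma passage_tail:
  assumes w: "b < w" "w < 1" and z: "b < z" "z < 1" and \<theta>: "\<theta> = logit z - logit w"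
  shows "measure_pmf.prob (pair_pmf (bernoullis m w) (bulk_pmf m n z p))
      {(v, X). \<theta> * x \<le> \<theta> * real (passage v X m n)}
    \<le> exp (log_partition m n p z - log_partition m n p w - \<theta> * x)"
proof -
  have "(\<integral>\<^sup>+(v, X). ennreal (exp (\<theta> * real (passage v X m n)))
      \<partial>pair_pmf (bernoullis m w) (bulk_pmf m n z p)) =
    ennreal (exp (log_partition m n p z - log_partition m n p w))"
  proof (rule passage_mgf[OF _ _ _ _ _ \<theta>])
    show "0 \<le> p j \<and> p j < z \<and> p j < w" if "j < n" for j using p[OF that] w z by auto
  qed (use w z b in auto)
  then show ?thesis
    using prob_le_exp_moment[where f = "\<lambda>(v, X). \<theta> * real (passage v X m n)"
        and P = "pair_pmf (bernoullis m w) (bulk_pmf m n z p)"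
        and c = "log_partition m n p z - log_partition m n p w" and t = "\<theta> * x"]
    by (simp add: case_prod_unfold)
qed

text \<open>Left weights increase with w, bottom weights decrease with z. Hence for w < z the model
  lies stochastically below the stationary models with parameters w and z, which suits an upper
  tail; for z < w it lies above them, which suits a lower tail.\<close>

lemma passage_upper_tail:
  assumes "b < w" "w < z" "z < 1"
  shows "measure_pmf.prob (pair_pmf (bernoullis m w) (bulk_pmf m n z p))
      {(v, X). x \<le> real (passage v X m n)}
    \<le> exp (log_partition m n p z - log_partition m n p w - (logit z - logit w) * x)"
proof -
  have "0 < logit z - logit w" using logit_diff_ge[of w z] assms b by auto
  then have "{(v, X). x \<le> real (passage v X m n)} =
      {(v, X). (logit z - logit w) * x \<le> (logit z - logit w) * real (passage v X m n)}" by auto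
  then show ?thesis using passage_tail[of w z _ m x, OF _ _ _ _ refl] assms by simp
qed

lemma passage_lower_tail:
  assumes "b < z" "z < w" "w < 1"
  shows "measure_pmf.prob (pair_pmf (bernoullis m w) (bulk_pmf m n z p))
      {(v, X). real (passage v X m n) \<le> x}
    \<le> exp ((logit w - logit z) * x - (log_partition m n p w - log_partition m n p z))"
proof -
  have "logit z - logit w < 0" using logit_diff_ge[of z w] assms b by auto
  then have "{(v, X). real (passage v X m n) \<le> x} =
      {(v, X). (logit z - logit w) * x \<le> (logit z - logit w) * real (passage v X m n)}" by auto
  moreover have "(logit w - logit z) * x - (log_partition m n p w - log_partition m n p z) =
      log_partition m n p z - log_partition m n p w - (logit z - logit w) * x"
    by (simp add: algebra_simps)
  ultimately show ?thesis
    using passage_tail[of w z _ m x, OF _ _ _ _ refl] assms by (simp only:)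
qed

text \<open>The event does not involve z, which is thus a free parameter of the bound: bottom
  weights are added only to make the moment computable.\<close>

lemma left_upper_tail:
  assumes "b < w" "w < z" "z < 1"
  shows "measure_pmf.prob (pair_pmf (bernoullis m w) (columns_pmf m n p))
      {(v, C). x \<le> real (passage v (\<lambda>j. (0, C j)) m n)}
    \<le> exp (log_partition m n p z - log_partition m n p w - (logit z - logit w) * x)"
proof -
  have "pair_pmf (bernoullis m w) (columns_pmf m n p) =
    map_pmf (\<lambda>(v, X). (v, \<lambda>j. snd (X j))) (pair_pmf (bernoullis m w) (bulk_pmf m n z p))"
    unfolding map_bulk_pmf_columns[where z = z, symmetric] by (simp add: pair_map_pmf2 apsnd_def map_prod_def)
  then have "measure_pmf.prob (pair_pmf (bernoullis m w) (columns_pmf m n p))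
      {(v, C). x \<le> real (passage v (\<lambda>j. (0, C j)) m n)} =
    measure_pmf.prob (pair_pmf (bernoullis m w) (bulk_pmf m n z p))
      {(v, X). x \<le> real (passage v (no_bottom X) m n)}"
    by (simp add: vimage_def case_prod_unfold no_bottom_def[abs_def])
  also have "\<dots> \<le> measure_pmf.prob (pair_pmf (bernoullis m w) (bulk_pmf m n z p))
      {(v, X). x \<le> real (passage v X m n)}"
  proof (rule measure_pmf.finite_measure_mono)
    have "real (passage v (no_bottom X) m n) \<le> real (passage v X m n)" for v X
      using passage_max_plus[of v X m n] by simp
    then show "{(v, X). x \<le> real (passage v (no_bottom X) m n)} \<subseteq> {(v, X). x \<le> real (passage v X m n)}"
      by (clarify, meson order_trans)
  qed simp
  also note passage_upper_tail[OF assms]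
  finally show ?thesis .
qed

lemma bottom_upper_tail:
  assumes "b < w" "w < z" "z < 1"
  shows "measure_pmf.prob (bulk_pmf m n z p) {X. x \<le> real (passage (\<lambda>_. False) X m n)}
    \<le> exp (log_partition m n p z - log_partition m n p w - (logit z - logit w) * x)"
proof -
  let ?P = "pair_pmf (bernoullis m w) (bulk_pmf m n z p)"
  have "measure_pmf.prob (bulk_pmf m n z p) {X. x \<le> real (passage (\<lambda>_. False) X m n)} =
    measure_pmf.prob (map_pmf snd ?P) {X. x \<le> real (passage (\<lambda>_. False) X m n)}"
    by (simp add: map_snd_pair_pmf)
  also have "\<dots> = measure_pmf.prob ?P {(v, X). x \<le> real (passage (\<lambda>_. False) X m n)}"
    by (simp add: vimage_def case_prod_unfold)
  also have "\<dots> \<le> measure_pmf.prob ?P {(v, X). x \<le> real (passage v X m n)}"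
  proof (rule measure_pmf.finite_measure_mono)
    have "real (passage (\<lambda>_. False) X m n) \<le> real (passage v X m n)" for v X
      using passage_max_plus[of v X m n] by simp
    then show "{(v, X). x \<le> real (passage (\<lambda>_. False) X m n)} \<subseteq> {(v, X). x \<le> real (passage v X m n)}"
      by (clarify, meson order_trans)
  qed simp
  also note passage_upper_tail[OF assms]
  finally show ?thesis .
qed

text \<open>Stated as a moment, not as a tail, because it gets multiplied by the moment of an
  independent appended column. Only the lower i rows enter, so the exponent is that of a model with
  i rows.\<close>

lemma columns_passage_moment:
  assumes "b < w" "w < z" "z < 1" and i: "i \<le> m"
  shows "(\<integral>\<^sup>+C. ennreal (exp ((logit z - logit w) * real (columns_passage C i n))) \<partial>columns_pmf m n p)
    \<le> ennreal (exp (log_partition i n p z - log_partition i n p w))"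
proof -
  let ?\<theta> = "logit z - logit w"
  have \<theta>: "0 < ?\<theta>" using logit_diff_ge[of w z] assms b by auto
  have "(\<integral>\<^sup>+C. ennreal (exp (?\<theta> * real (columns_passage C i n))) \<partial>columns_pmf m n p) =
    (\<integral>\<^sup>+C. ennreal (exp (?\<theta> * real (columns_passage (\<lambda>j k. if k < i then C j k else False) i n)))
      \<partial>columns_pmf m n p)"
  proof -
    have "columns_passage C i n = columns_passage (\<lambda>j k. if k < i then C j k else False) i n" for C
      by (rule columns_passage_cong) simp
    then show ?thesis by metis
  qed
  also have "\<dots> = (\<integral>\<^sup>+C. ennreal (exp (?\<theta> * real (columns_passage C i n))) \<partial>columns_pmf i n p)"
    unfolding map_columns_pmf_rows[OF i, symmetric] by simp
  also have "\<dots> = (\<integral>\<^sup>+(v, X). ennreal (exp (?\<theta> * real (columns_passage (\<lambda>j. snd (X j)) i n)))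
      \<partial>pair_pmf (bernoullis i w) (bulk_pmf i n z p))"
    unfolding map_bulk_pmf_columns[where z = z, symmetric] by (simp add: nn_integral_pair_pmf')
  also have "\<dots> \<le> (\<integral>\<^sup>+(v, X). ennreal (exp (?\<theta> * real (passage v X i n)))
      \<partial>pair_pmf (bernoullis i w) (bulk_pmf i n z p))"
  proof (intro nn_integral_mono, clarify)
    fix v X
    have "columns_passage (\<lambda>j. snd (X j)) i n = passage (\<lambda>_. False) (no_bottom X) i n"
      by (simp add: columns_passage_def no_bottom_def[abs_def])
    also have "\<dots> \<le> passage (\<lambda>_. False) X i n"
      using passage_max_plus[of "\<lambda>_. False" X i n] by simp
    also have "\<dots> \<le> passage v X i n"
      using passage_max_plus[of v X i n] by simp
    finally show "ennreal (exp (?\<theta> * real (columns_passage (\<lambda>j. snd (X j)) i n)))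
        \<le> ennreal (exp (?\<theta> * real (passage v X i n)))"
      using \<theta> by (intro ennreal_leI) simp
  qed
  also have "\<dots> = ennreal (exp (log_partition i n p z - log_partition i n p w))"
  proof (rule passage_mgf[OF _ _ _ _ _ refl])
    show "0 \<le> p j \<and> p j < z \<and> p j < w" if "j < n" for j using p[OF that] assms by auto
  qed (use assms b in auto)
  finally show ?thesis .
qed

end

section \<open>Deviations in a fixed environment\<close>

context near_critical
begin

lemma b_less: "b < a - 5 * h" and a_less: "a + 7 * h < 1"
  using h a by linarith+

text \<open>The level is the mean at the right end. It exceeds the means on the left half of the
  interval by m h^2 / 2 and is not exceeded on the right half, so the left half, of length h,
  produces the gain m h^3 / 2. The next three estimates are obtained in the same way.\<close>

lemma log_partition_right_upper:
  "log_partition m n p (a + 3 * h) - log_partition m n p (a + h)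
    \<le> (logit (a + 3 * h) - logit (a + h)) * \<Phi> (a + 3 * h) - real m * h ^ 3 / 2"
proof -
  have "log_partition m n p (a + 2 * h) - log_partition m n p (a + h)
      \<le> (logit (a + 2 * h) - logit (a + h)) * \<Phi> (a + 3 * h) - ((a + 2 * h) - (a + h)) * (real m * h\<^sup>2 / 2)"
  proof (rule log_partition_diff_le)
    fix \<xi> assume "a + h < \<xi>" "\<xi> < a + 2 * h"
    then show "\<Phi> \<xi> \<le> \<Phi> (a + 3 * h) - real m * h\<^sup>2 / 2"
      using mean_right_increase[of \<xi> "a + 3 * h"] h a_less by simp
  qed (use a h a_less in auto)
  moreover have "log_partition m n p (a + 3 * h) - log_partition m n p (a + 2 * h)
      \<le> (logit (a + 3 * h) - logit (a + 2 * h)) * \<Phi> (a + 3 * h) - ((a + 3 * h) - (a + 2 * h)) * 0"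
  proof (rule log_partition_diff_le)
    fix \<xi> assume "a + 2 * h < \<xi>" "\<xi> < a + 3 * h"
    then show "\<Phi> \<xi> \<le> \<Phi> (a + 3 * h) - 0"
      using mean_right_mono[of \<xi> "a + 3 * h"] h a_less by simp
  qed (use a h a_less in auto)
  ultimately show ?thesis by (simp add: algebra_simps power3_eq_cube power2_eq_square)
qed

lemma log_partition_right_lower:
  "(logit (a + 5 * h) - logit (a + 3 * h)) * \<Phi> (a + 3 * h) + real m * h ^ 3 / 2
    \<le> log_partition m n p (a + 5 * h) - log_partition m n p (a + 3 * h)"
proof -
  have "(logit (a + 5 * h) - logit (a + 4 * h)) * \<Phi> (a + 3 * h) + ((a + 5 * h) - (a + 4 * h)) * (real m * h\<^sup>2 / 2)
      \<le> log_partition m n p (a + 5 * h) - log_partition m n p (a + 4 * h)"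
  proof (rule log_partition_diff_ge)
    fix \<xi> assume "a + 4 * h < \<xi>" "\<xi> < a + 5 * h"
    then show "\<Phi> (a + 3 * h) + real m * h\<^sup>2 / 2 \<le> \<Phi> \<xi>"
      using mean_right_increase[of "a + 3 * h" \<xi>] h a_less by simp
  qed (use a h a_less in auto)
  moreover have "(logit (a + 4 * h) - logit (a + 3 * h)) * \<Phi> (a + 3 * h) + ((a + 4 * h) - (a + 3 * h)) * 0
      \<le> log_partition m n p (a + 4 * h) - log_partition m n p (a + 3 * h)"
  proof (rule log_partition_diff_ge)
    fix \<xi> assume "a + 3 * h < \<xi>" "\<xi> < a + 4 * h"
    then show "\<Phi> (a + 3 * h) + 0 \<le> \<Phi> \<xi>"
      using mean_right_mono[of "a + 3 * h" \<xi>] h a_less by simp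
  qed (use a h a_less in auto)
  ultimately show ?thesis by (simp add: algebra_simps power3_eq_cube power2_eq_square)
qed

lemma log_partition_left_upper:
  "log_partition m n p (a - h) - log_partition m n p (a - 3 * h)
    \<le> (logit (a - h) - logit (a - 3 * h)) * \<Phi> (a - 3 * h) - real m * h ^ 3 / 2"
proof -
  have "log_partition m n p (a - h) - log_partition m n p (a - 2 * h)
      \<le> (logit (a - h) - logit (a - 2 * h)) * \<Phi> (a - 3 * h) - ((a - h) - (a - 2 * h)) * (real m * h\<^sup>2 / 2)"
  proof (rule log_partition_diff_le)
    fix \<xi> assume "a - 2 * h < \<xi>" "\<xi> < a - h"
    then show "\<Phi> \<xi> \<le> \<Phi> (a - 3 * h) - real m * h\<^sup>2 / 2"
      using mean_left_decrease[of "a - 3 * h" \<xi>] h b_less by simp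
  qed (use a h b_less in auto)
  moreover have "log_partition m n p (a - 2 * h) - log_partition m n p (a - 3 * h)
      \<le> (logit (a - 2 * h) - logit (a - 3 * h)) * \<Phi> (a - 3 * h) - ((a - 2 * h) - (a - 3 * h)) * 0"
  proof (rule log_partition_diff_le)
    fix \<xi> assume "a - 3 * h < \<xi>" "\<xi> < a - 2 * h"
    then show "\<Phi> \<xi> \<le> \<Phi> (a - 3 * h) - 0"
      using mean_left_mono[of "a - 3 * h" \<xi>] h b_less by simp
  qed (use a h b_less in auto)
  ultimately show ?thesis by (simp add: algebra_simps power3_eq_cube power2_eq_square)
qed

lemma log_partition_left_lower:
  "(logit (a - 3 * h) - logit (a - 5 * h)) * \<Phi> (a - 3 * h) + real m * h ^ 3 / 2
    \<le> log_partition m n p (a - 3 * h) - log_partition m n p (a - 5 * h)"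
proof -
  have "(logit (a - 4 * h) - logit (a - 5 * h)) * \<Phi> (a - 3 * h) + ((a - 4 * h) - (a - 5 * h)) * (real m * h\<^sup>2 / 2)
      \<le> log_partition m n p (a - 4 * h) - log_partition m n p (a - 5 * h)"
  proof (rule log_partition_diff_ge)
    fix \<xi> assume "a - 5 * h < \<xi>" "\<xi> < a - 4 * h"
    then show "\<Phi> (a - 3 * h) + real m * h\<^sup>2 / 2 \<le> \<Phi> \<xi>"
      using mean_left_decrease[of \<xi> "a - 3 * h"] h b_less by simp
  qed (use a h b_less in auto)
  moreover have "(logit (a - 3 * h) - logit (a - 4 * h)) * \<Phi> (a - 3 * h) + ((a - 3 * h) - (a - 4 * h)) * 0
      \<le> log_partition m n p (a - 3 * h) - log_partition m n p (a - 4 * h)"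
  proof (rule log_partition_diff_ge)
    fix \<xi> assume "a - 4 * h < \<xi>" "\<xi> < a - 3 * h"
    then show "\<Phi> (a - 3 * h) + 0 \<le> \<Phi> \<xi>"
      using mean_left_mono[of \<xi> "a - 3 * h"] h b_less by simp
  qed (use a h b_less in auto)
  ultimately show ?thesis by (simp add: algebra_simps power3_eq_cube power2_eq_square)
qed

text \<open>The distance of the level from \<open>\<Phi> a\<close> is twice the bound of
  \<open>mean_near_le\<close>. So the stationary means between \<open>a\<close> and
  \<open>a + h\<close> stay below the level by at least m h^2, which the tilt turns into m
  h^3.\<close>

lemma columns_passage_upper_tail:
  "measure_pmf.prob (columns_pmf m n p)
     {C. \<Phi> a + 252 / (a - b) * (real m * h\<^sup>2) \<le> real (columns_passage C m n)}
   \<le> exp (- (real m * h ^ 3))"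
proof -
  let ?x = "\<Phi> a + 252 / (a - b) * (real m * h\<^sup>2)" and ?\<theta> = "logit (a + h) - logit a"
  have \<theta>: "0 < ?\<theta>" using logit_diff_ge[of a "a + h"] a b h a_less by auto
  have "log_partition m n p (a + h) - log_partition m n p a
      \<le> ?\<theta> * ?x - (a + h - a) * (126 / (a - b) * (real m * h\<^sup>2))"
  proof (rule log_partition_diff_le)
    fix \<xi> assume "a < \<xi>" "\<xi> < a + h"
    then show "\<Phi> \<xi> \<le> ?x - 126 / (a - b) * (real m * h\<^sup>2)"
      using mean_near_le[of \<xi>] h by (simp add: diff_divide_distrib)
  qed (use a h a_less in auto)
  also have "(a + h - a) * (126 / (a - b) * (real m * h\<^sup>2)) = 126 / (a - b) * (real m * h ^ 3)"
    by (simp add: power3_eq_cube power2_eq_square)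
  finally have L: "log_partition m n p (a + h) - log_partition m n p a - ?\<theta> * ?x
      \<le> - (126 / (a - b) * (real m * h ^ 3))" by linarith
  have "1 * (real m * h ^ 3) \<le> 126 / (a - b) * (real m * h ^ 3)"
    using a b h by (intro mult_right_mono) auto
  then have L': "log_partition m n p (a + h) - log_partition m n p a - ?\<theta> * ?x \<le> - (real m * h ^ 3)"
    using L by linarith
  have "(\<integral>\<^sup>+C. ennreal (exp (?\<theta> * real (columns_passage C m n))) \<partial>columns_pmf m n p)
      \<le> ennreal (exp (log_partition m n p (a + h) - log_partition m n p a))"
    using a h a_less by (intro columns_passage_moment) auto
  from prob_le_exp_moment[OF this, of "?\<theta> * ?x"]
  have "measure_pmf.prob (columns_pmf m n p) {C. ?\<theta> * ?x \<le> ?\<theta> * real (columns_passage C m n)}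
      \<le> exp (log_partition m n p (a + h) - log_partition m n p a - ?\<theta> * ?x)" .
  also have "\<dots> \<le> exp (- (real m * h ^ 3))" using L' by simp
  also have "{C. ?\<theta> * ?x \<le> ?\<theta> * real (columns_passage C m n)} =
      {C. ?x \<le> real (columns_passage C m n)}" using \<theta> by auto
  finally show ?thesis .
qed

text \<open>A left boundary of density slightly above \<open>a\<close> makes the geodesic leave along that boundary;
  then the lower tail of the stationary model becomes one for the model without bottom boundary.\<close>

lemma left_boundary_lower_tail:
  "measure_pmf.prob (pair_pmf (bernoullis m (a + 5 * h)) (columns_pmf m n p))
     {(v, C). real (passage v (\<lambda>j. (0, C j)) m n) \<le> \<Phi> a}
   \<le> 2 * exp (- (real m * h ^ 3 / 2))"
proof -
  \<comment> \<open>Two bounds meet at the level \<open>\<Phi> (a + 3 * h)\<close>: means to the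
    right of \<open>a + 3 * h\<close> are larger, so the full model with left density
    \<open>a + 5 * h\<close> exceeds the level; means between \<open>a + h\<close> and
    \<open>a + 3 * h\<close> are smaller, so the bottom boundary alone does not reach it.\<close>
  let ?w = "a + 5 * h" and ?z = "a + 3 * h"
  let ?P = "pair_pmf (bernoullis m ?w) (bulk_pmf m n ?z p)"
  have "pair_pmf (bernoullis m ?w) (columns_pmf m n p) =
    map_pmf (\<lambda>(v, X). (v, \<lambda>j. snd (X j))) ?P"
    unfolding map_bulk_pmf_columns[where z = ?z, symmetric]
    by (simp add: pair_map_pmf2 apsnd_def map_prod_def)
  then have "measure_pmf.prob (pair_pmf (bernoullis m ?w) (columns_pmf m n p))
      {(v, C). real (passage v (\<lambda>j. (0, C j)) m n) \<le> \<Phi> a} =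
    measure_pmf.prob ?P {(v, X). real (passage v (no_bottom X) m n) \<le> \<Phi> a}"
    by (simp add: vimage_def case_prod_unfold no_bottom_def[abs_def])
  also have "\<dots> \<le> measure_pmf.prob ?P ({(v, X). real (passage v X m n) \<le> \<Phi> ?z} \<union>
      {(v, X). \<Phi> ?z \<le> real (passage (\<lambda>_. False) X m n)})"
  proof (rule measure_pmf.finite_measure_mono)
    have "\<Phi> a \<le> \<Phi> ?z" using mean_critical_le[of ?z] h a_less by auto
    then have "real (passage v X m n) \<le> \<Phi> ?z \<or> \<Phi> ?z \<le> real (passage (\<lambda>_. False) X m n)"
      if "real (passage v (no_bottom X) m n) \<le> \<Phi> a" for v X
      using passage_max_plus[of v X m n] that by (auto simp: max_def split: if_splits)
    then show "{(v, X). real (passage v (no_bottom X) m n) \<le> \<Phi> a} \<subseteq>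
      {(v, X). real (passage v X m n) \<le> \<Phi> ?z} \<union>
      {(v, X). \<Phi> ?z \<le> real (passage (\<lambda>_. False) X m n)}"
      by blast
  qed simp
  also have "\<dots> \<le> measure_pmf.prob ?P {(v, X). real (passage v X m n) \<le> \<Phi> ?z} +
      measure_pmf.prob ?P {(v, X). \<Phi> ?z \<le> real (passage (\<lambda>_. False) X m n)}"
    by (rule measure_Un_le) auto
  also have "measure_pmf.prob ?P {(v, X). \<Phi> ?z \<le> real (passage (\<lambda>_. False) X m n)} =
      measure_pmf.prob (map_pmf snd ?P) {X. \<Phi> ?z \<le> real (passage (\<lambda>_. False) X m n)}"
    by (simp add: vimage_def case_prod_unfold)
  also have "\<dots> \<le> exp (- (real m * h ^ 3 / 2))"
  proof -
    have "measure_pmf.prob (bulk_pmf m n ?z p) {X. \<Phi> ?z \<le> real (passage (\<lambda>_. False) X m n)}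
        \<le> exp (log_partition m n p ?z - log_partition m n p (a + h) - (logit ?z - logit (a + h)) * \<Phi> ?z)"
      by (rule bottom_upper_tail) (use a h a_less in auto)
    also have "\<dots> \<le> exp (- (real m * h ^ 3 / 2))" using log_partition_right_upper by simp
    finally show ?thesis by (simp add: map_snd_pair_pmf)
  qed
  also have "measure_pmf.prob ?P {(v, X). real (passage v X m n) \<le> \<Phi> ?z} \<le> exp (- (real m * h ^ 3 / 2))"
  proof -
    have "measure_pmf.prob ?P {(v, X). real (passage v X m n) \<le> \<Phi> ?z}
      \<le> exp ((logit ?w - logit ?z) * \<Phi> ?z - (log_partition m n p ?w - log_partition m n p ?z))"
      by (rule passage_lower_tail) (use a h a_less in auto)
    also have "\<dots> \<le> exp (- (real m * h ^ 3 / 2))" using log_partition_right_lower by simp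
    finally show ?thesis .
  qed
  finally show ?thesis by simp
qed

text \<open>The counterpart below \<open>a\<close>, where \<open>\<Phi>\<close> decreases: the level
  \<open>\<Phi> w\<close> is too high for the left boundary alone, by comparison with means up to
  \<open>a - h\<close>, and too low for the full model, by comparison with means down to
  \<open>z\<close>. So geodesics leave along the bottom.\<close>

lemma left_exit_tail:
  defines "w \<equiv> a - 3 * h" and "z \<equiv> a - 5 * h"
  shows "measure_pmf.prob (pair_pmf (bernoullis m w) (bulk_pmf m n z p))
     {(v, X). passage (\<lambda>_. False) X m n < passage v (no_bottom X) m n}
   \<le> 2 * exp (- (real m * h ^ 3 / 2))"
proof -
  let ?P = "pair_pmf (bernoullis m w) (bulk_pmf m n z p)"
  have "measure_pmf.prob ?P {(v, X). passage (\<lambda>_. False) X m n < passage v (no_bottom X) m n}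
    \<le> measure_pmf.prob ?P ({(v, X). real (passage v X m n) \<le> \<Phi> w} \<union>
      {(v, X). \<Phi> w \<le> real (passage v (no_bottom X) m n)})"
  proof (rule measure_pmf.finite_measure_mono)
    have "real (passage v X m n) \<le> \<Phi> w \<or> \<Phi> w \<le> real (passage v (no_bottom X) m n)"
      if "passage (\<lambda>_. False) X m n < passage v (no_bottom X) m n" for v X
      using passage_max_plus[of v X m n] that by (auto simp: max_def split: if_splits)
    then show "{(v, X). passage (\<lambda>_. False) X m n < passage v (no_bottom X) m n} \<subseteq>
      {(v, X). real (passage v X m n) \<le> \<Phi> w} \<union>
      {(v, X). \<Phi> w \<le> real (passage v (no_bottom X) m n)}"
      by blast
  qed simp
  also have "\<dots> \<le> measure_pmf.prob ?P {(v, X). real (passage v X m n) \<le> \<Phi> w} +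
      measure_pmf.prob ?P {(v, X). \<Phi> w \<le> real (passage v (no_bottom X) m n)}"
    by (rule measure_Un_le) auto
  also have "measure_pmf.prob ?P {(v, X). \<Phi> w \<le> real (passage v (no_bottom X) m n)} =
      measure_pmf.prob (map_pmf (\<lambda>(v, X). (v, \<lambda>j. snd (X j))) ?P)
        {(v, C). \<Phi> w \<le> real (passage v (\<lambda>j. (0, C j)) m n)}"
    by (simp add: vimage_def case_prod_unfold no_bottom_def[abs_def])
  also have "map_pmf (\<lambda>(v, X). (v, \<lambda>j. snd (X j))) ?P =
      pair_pmf (bernoullis m w) (columns_pmf m n p)"
    unfolding map_bulk_pmf_columns[where z = z, symmetric]
    by (simp add: pair_map_pmf2 apsnd_def map_prod_def)
  also have "measure_pmf.prob \<dots> {(v, C). \<Phi> w \<le> real (passage v (\<lambda>j. (0, C j)) m n)}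
      \<le> exp (- (real m * h ^ 3 / 2))"
  proof -
    have "measure_pmf.prob (pair_pmf (bernoullis m w) (columns_pmf m n p))
        {(v, C). \<Phi> w \<le> real (passage v (\<lambda>j. (0, C j)) m n)}
      \<le> exp (log_partition m n p (a - h) - log_partition m n p w - (logit (a - h) - logit w) * \<Phi> w)"
      by (rule left_upper_tail) (use a h b_less in \<open>auto simp: w_def\<close>)
    also have "\<dots> \<le> exp (- (real m * h ^ 3 / 2))" using log_partition_left_upper by (simp add: w_def)
    finally show ?thesis .
  qed
  also have "measure_pmf.prob ?P {(v, X). real (passage v X m n) \<le> \<Phi> w} \<le> exp (- (real m * h ^ 3 / 2))"
  proof -
    have "measure_pmf.prob ?P {(v, X). real (passage v X m n) \<le> \<Phi> w}
      \<le> exp ((logit w - logit z) * \<Phi> w - (log_partition m n p w - log_partition m n p z))"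
      by (rule passage_lower_tail) (use a h b_less in \<open>auto simp: w_def z_def\<close>)
    also have "\<dots> \<le> exp (- (real m * h ^ 3 / 2))"
      using log_partition_left_lower by (simp add: w_def z_def)
    finally show ?thesis .
  qed
  finally show ?thesis by simp
qed

lemma last_column_lower_tail:
  "measure_pmf.prob (pair_pmf (columns_pmf m n p) (bernoullis m (a + 5 * h)))
     {(C, S). real (columns_passage (C(n := S)) m (Suc n)) \<le> \<Phi> a}
   \<le> 2 * exp (- (real m * h ^ 3 / 2))"
proof -
  \<comment> \<open>Rotation reverses the environment, but the slope at \<open>a\<close> is a sum
    over the columns and ignores their order, so the same \<open>h\<close> serves.\<close>
  interpret R: near_critical n "\<lambda>j. p (n - Suc j)" b m a h
    by unfold_locales (use p b a h slope in \<open>auto simp: stationary_slope_rev\<close>)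
  have "measure_pmf.prob (pair_pmf (columns_pmf m n p) (bernoullis m (a + 5 * h)))
     {(C, S). real (columns_passage (C(n := S)) m (Suc n)) \<le> \<Phi> a} =
    measure_pmf.prob (map_pmf (\<lambda>(C, S). (S \<circ> flip_below m, \<lambda>j. C (flip_below n j) \<circ> flip_below m))
     (pair_pmf (columns_pmf m n p) (bernoullis m (a + 5 * h))))
     {(v, C). real (passage v (\<lambda>j. (0, C j)) m n) \<le> \<Phi> a}"
    by (simp add: vimage_def case_prod_unfold columns_passage_append_column_flip)
  also have "\<dots> \<le> 2 * exp (- (real m * h ^ 3 / 2))"
    unfolding map_pmf_append_column_flip
    using R.left_boundary_lower_tail by (simp add: stationary_mean_rev)
  finally show ?thesis .
qed

text \<open>The first factor bounds the derivative of \<open>logit\<close> between \<open>a\<close>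
  and (1 + a) / 2, the second is the constant of \<open>mean_near_le\<close>, and the 1 provides the
  exponent m h^3 in \<open>far_exit_tail\<close>.\<close>

definition "exit_scale = (1 / a + 2 / (1 - a)) * (126 / (a - b)) + 1"

lemma exit_scale_ge_1: "1 \<le> exit_scale"
  unfolding exit_scale_def using a b by (auto intro!: mult_nonneg_nonneg add_nonneg_nonneg)

text \<open>A column of density \<open>a + 6 * h\<close> would have the moment (1 - w') / (1 - y)
  per row, which exactly replaces the rows missing from the first factor. The true density is
  smaller by h and gains exp (- h^2) per row; over \<open>exit_scale * m * h\<close> rows this
  outweighs the excess of order m h^3 that the means above \<open>\<Phi> a\<close> cause.\<close>

lemma far_exit_tail:
  assumes i: "i \<le> m" and far: "exit_scale * real m * h \<le> real (m - i)"
  shows "measure_pmf.prob (pair_pmf (columns_pmf m n p) (bernoullis m (a + 5 * h)))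
     {(C, S). \<Phi> a \<le> real (columns_passage C i n) + (\<Sum>l\<in>{i..<m}. of_bool (S l))}
   \<le> exp (- (real m * h ^ 3))"
proof -
  define w w' y where "w = a + 5 * h" and "w' = a + 6 * h" and "y = a + 7 * h"
  define \<theta> where "\<theta> = logit y - logit w'"
  note defs = w_def w'_def y_def
  have ord: "0 < w" "w < w'" "w' < y" "y < 1" "b < w'" using a b h a_less by (auto simp: defs)
  have \<theta>: "0 < \<theta>" using logit_diff_ge[of w' y] ord by (simp add: \<theta>_def)
  have \<theta>_le: "\<theta> \<le> h * (1 / a + 2 / (1 - a))"
  proof -
    have "\<theta> \<le> (y - w') * (1 / a + 1 / (1 - (1 + a) / 2))"
      unfolding \<theta>_def by (rule logit_diff_le) (use a b h in \<open>auto simp: defs field_simps\<close>)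
    also have "1 / (1 - (1 + a) / 2) = 2 / (1 - a)" by (simp add: field_simps)
    finally show ?thesis by (simp add: defs)
  qed
  let ?B = "1 - w + w * exp \<theta>"
  have exp\<theta>: "exp \<theta> = y * (1 - w') / (w' * (1 - y))"
    using ord by (simp add: \<theta>_def logit_def exp_diff divide_simps)
  have "?B * (1 - y) / (1 - w') \<le> exp (- h\<^sup>2)"
  proof -
    have "?B * (1 - y) / (1 - w') = 1 - (w' - w) * (y - w') / (w' * (1 - w'))"
      unfolding exp\<theta> using ord by (simp add: divide_simps) (simp add: algebra_simps)
    also have "\<dots> = 1 - h\<^sup>2 / (w' * (1 - w'))" by (simp add: defs power2_eq_square)
    also have "\<dots> \<le> 1 - h\<^sup>2"
    proof -
      have "w' * (1 - w') \<le> 1 * 1" using ord by (intro mult_mono) auto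
      then have "h\<^sup>2 / 1 \<le> h\<^sup>2 / (w' * (1 - w'))" using ord by (intro divide_left_mono) auto
      then show ?thesis by simp
    qed
    also have "\<dots> \<le> exp (- h\<^sup>2)" using exp_ge_add_one_self[of "- h\<^sup>2"] by simp
    finally show ?thesis .
  qed
  then have "?B \<le> exp (- h\<^sup>2) * ((1 - w') / (1 - y))" using ord by (simp add: field_simps exp_minus)
  also have "\<dots> = exp (- h\<^sup>2 + ln (1 - w') - ln (1 - y))" using ord by (simp add: exp_add exp_diff exp_minus divide_simps)
  finally have B: "?B \<le> exp (- h\<^sup>2 + ln (1 - w') - ln (1 - y))" .
  have B0: "0 \<le> ?B" using ord by simp
  let ?k = "m - i"
  have "?B ^ ?k \<le> exp (- h\<^sup>2 + ln (1 - w') - ln (1 - y)) ^ ?k" using B B0 by (rule power_mono)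
  also have "\<dots> = exp (real ?k * (- h\<^sup>2 + ln (1 - w') - ln (1 - y)))" by (simp add: exp_of_nat_mult)
  finally have Bk: "?B ^ ?k \<le> exp (real ?k * (- h\<^sup>2 + ln (1 - w') - ln (1 - y)))" .
  have Li: "log_partition i n p y - log_partition i n p w' =
      log_partition m n p y - log_partition m n p w' + real ?k * (ln (1 - y) - ln (1 - w'))"
    using i by (simp add: log_partition_def of_nat_diff algebra_simps)
  let ?P = "pair_pmf (columns_pmf m n p) (bernoullis m w)"
  have "(\<integral>\<^sup>+(C, S). ennreal (exp (\<theta> * (real (columns_passage C i n) + (\<Sum>l\<in>{i..<m}. of_bool (S l))))) \<partial>?P) =
    (\<integral>\<^sup>+C. ennreal (exp (\<theta> * real (columns_passage C i n))) *
      (\<integral>\<^sup>+S. ennreal (exp (\<theta> * (\<Sum>l\<in>{i..<m}. of_bool (S l)))) \<partial>bernoullis m w) \<partial>columns_pmf m n p)"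
    by (simp add: nn_integral_pair_pmf' distrib_left exp_add ennreal_mult nn_integral_cmult
        del: sum_of_bool_eq)
  also have "\<dots> = (\<integral>\<^sup>+C. ennreal (exp (\<theta> * real (columns_passage C i n))) \<partial>columns_pmf m n p) *
      ennreal (?B ^ ?k)"
    using ord by (subst nn_integral_bernoulli_sum_exp) (auto simp: nn_integral_multc)
  also have "\<dots> \<le> ennreal (exp (log_partition i n p y - log_partition i n p w')) *
      ennreal (exp (real ?k * (- h\<^sup>2 + ln (1 - w') - ln (1 - y))))"
    unfolding \<theta>_def
    by (intro mult_mono columns_passage_moment ennreal_leI Bk[unfolded \<theta>_def]) (use ord i in auto)
  also have "\<dots> = ennreal (exp (log_partition m n p y - log_partition m n p w' - real ?k * h\<^sup>2))"
    unfolding Li by (simp add: algebra_simps flip: ennreal_mult exp_add)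
  finally have "(\<integral>\<^sup>+x. ennreal (exp (case x of (C, S) \<Rightarrow> \<theta> * (real (columns_passage C i n) +
      (\<Sum>l\<in>{i..<m}. of_bool (S l))))) \<partial>?P)
      \<le> ennreal (exp (log_partition m n p y - log_partition m n p w' - real ?k * h\<^sup>2))"
    by (simp add: case_prod_unfold del: sum_of_bool_eq)
  from prob_le_exp_moment[OF this, of "\<theta> * \<Phi> a"]
  have "measure_pmf.prob ?P {(C, S). \<theta> * \<Phi> a \<le> \<theta> * (real (columns_passage C i n) + (\<Sum>l\<in>{i..<m}. of_bool (S l)))}
      \<le> exp (log_partition m n p y - log_partition m n p w' - real ?k * h\<^sup>2 - \<theta> * \<Phi> a)"
    by (simp add: case_prod_unfold del: sum_of_bool_eq)
  also have "\<dots> \<le> exp (- (real m * h ^ 3))"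
  proof -
    have "log_partition m n p y - log_partition m n p w' \<le>
        (logit y - logit w') * (\<Phi> a + 126 / (a - b) * (real m * h\<^sup>2)) - (y - w') * 0"
    proof (rule log_partition_diff_le)
      fix \<xi> assume "w' < \<xi>" "\<xi> < y"
      then show "\<Phi> \<xi> \<le> \<Phi> a + 126 / (a - b) * (real m * h\<^sup>2) - 0"
        using mean_near_le[of \<xi>] h by (simp add: defs)
    qed (use ord in auto)
    then have 1: "log_partition m n p y - log_partition m n p w' - \<theta> * \<Phi> a
        \<le> \<theta> * (126 / (a - b) * (real m * h\<^sup>2))" by (simp add: \<theta>_def algebra_simps)
    also have "\<dots> \<le> h * (1 / a + 2 / (1 - a)) * (126 / (a - b) * (real m * h\<^sup>2))"
      using \<theta>_le a h by (intro mult_right_mono) auto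
    also have "\<dots> = exit_scale * real m * h * h\<^sup>2 - real m * h ^ 3"
      by (simp add: exit_scale_def algebra_simps power3_eq_cube power2_eq_square)
    also have "exit_scale * real m * h * h\<^sup>2 \<le> real ?k * h\<^sup>2"
      using far by (intro mult_right_mono) auto
    finally show ?thesis by simp
  qed
  also have "{(C, S). \<theta> * \<Phi> a \<le> \<theta> * (real (columns_passage C i n) + (\<Sum>l\<in>{i..<m}. of_bool (S l)))} =
      {(C, S). \<Phi> a \<le> real (columns_passage C i n) + (\<Sum>l\<in>{i..<m}. of_bool (S l))}"
    using \<theta> by (simp del: sum_of_bool_eq)
  finally show ?thesis by (simp only: w_def)
qed

text \<open>On so few rows a Chernoff bound with tilt h suffices. The densities differ by 10 h and
  the second order terms of the exponentials add at most 2 h^2, so each row costs a factor exp (12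
  h^2); the additional 1 in the level leaves the exponent m h^3.\<close>

lemma near_exit_tail:
  assumes i: "i \<le> m" and near: "real (m - i) \<le> exit_scale * real m * h"
  shows "measure_pmf.prob (pair_pmf (bernoullis m (a - 5 * h)) (bernoullis m (a + 5 * h)))
     {(T, S). (12 * exit_scale + 1) * (real m * h\<^sup>2) \<le>
        (\<Sum>l\<in>{i..<m}. of_bool (S l)) - (\<Sum>l\<in>{i..<m}. of_bool (T l))}
   \<le> exp (- (real m * h ^ 3))"
proof -
  define w z where "w = a + 5 * h" and "z = a - 5 * h"
  have ord: "0 < z" "z < w" "w < 1" using a b h a_less b_less by (auto simp: w_def z_def)
  let ?A = "1 - w + w * exp h" and ?B = "1 - z + z * exp (- h)" and ?k = "m - i"
  have "?A * ?B \<le> exp (12 * h\<^sup>2)"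
  proof -
    have e1: "exp h \<le> 1 + h + h\<^sup>2" using h h_le by (intro exp_bound) auto
    have e2: "exp (- h) \<le> 1 - h + h\<^sup>2"
    proof -
      have "1 \<le> (1 - h + h\<^sup>2) * (1 + h)" using h
        by (simp add: algebra_simps power2_eq_square)
      also have "\<dots> \<le> (1 - h + h\<^sup>2) * exp h"
        using h_le zero_le_power2[of h] by (intro mult_left_mono exp_ge_add_one_self) linarith
      finally show ?thesis by (simp add: exp_minus field_simps)
    qed
    have "?A \<le> exp (w * (exp h - 1))" using exp_ge_add_one_self[of "w * (exp h - 1)"]
      by (simp add: algebra_simps)
    also have "\<dots> \<le> exp (w * (h + h\<^sup>2))" using e1 ord by simp
    finally have A: "?A \<le> exp (w * (h + h\<^sup>2))" .
    have "?B \<le> exp (z * (exp (- h) - 1))" using exp_ge_add_one_self[of "z * (exp (- h) - 1)"]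
      by (simp add: algebra_simps)
    also have "\<dots> \<le> exp (z * (- h + h\<^sup>2))" using e2 ord by simp
    finally have B: "?B \<le> exp (z * (- h + h\<^sup>2))" .
    have "?A * ?B \<le> exp (w * (h + h\<^sup>2)) * exp (z * (- h + h\<^sup>2))"
      using ord by (intro mult_mono A B) auto
    also have "\<dots> = exp ((w - z) * h + (w + z) * h\<^sup>2)" by (simp add: algebra_simps flip: exp_add)
    also have "\<dots> \<le> exp (12 * h\<^sup>2)"
    proof -
      have "(w + z) * h\<^sup>2 \<le> 2 * h\<^sup>2" using ord by (intro mult_right_mono) auto
      moreover have "(w - z) * h = 10 * h\<^sup>2" by (simp add: w_def z_def power2_eq_square)
      ultimately show ?thesis by simp
    qed
    finally show ?thesis .
  qed
  then have "(?A * ?B) ^ ?k \<le> exp (12 * h\<^sup>2) ^ ?k" using ord by (intro power_mono) auto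
  also have "\<dots> = exp (real ?k * (12 * h\<^sup>2))" by (simp add: exp_of_nat_mult)
  also have "\<dots> \<le> exp (exit_scale * real m * h * (12 * h\<^sup>2))"
    using near by (simp add: mult_right_mono)
  finally have AB: "(?A * ?B) ^ ?k \<le> exp (exit_scale * real m * h * (12 * h\<^sup>2))" .
  let ?P = "pair_pmf (bernoullis m z) (bernoullis m w)"
  have "(\<integral>\<^sup>+x. ennreal (exp (case x of (T, S) \<Rightarrow> h * ((\<Sum>l\<in>{i..<m}. of_bool (S l)) -
      (\<Sum>l\<in>{i..<m}. of_bool (T l))))) \<partial>?P) =
    (\<integral>\<^sup>+T. ennreal (exp ((- h) * (\<Sum>l\<in>{i..<m}. of_bool (T l)))) *
      (\<integral>\<^sup>+S. ennreal (exp (h * (\<Sum>l\<in>{i..<m}. of_bool (S l)))) \<partial>bernoullis m w) \<partial>bernoullis m z)"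
    by (simp add: nn_integral_pair_pmf' case_prod_unfold nn_integral_cmult[symmetric] algebra_simps
        flip: ennreal_mult exp_add del: sum_of_bool_eq)
  also have "\<dots> = (\<integral>\<^sup>+T. ennreal (exp ((- h) * (\<Sum>l\<in>{i..<m}. of_bool (T l)))) \<partial>bernoullis m z) *
      ennreal (?A ^ ?k)"
    using ord by (subst nn_integral_bernoulli_sum_exp) (auto simp: nn_integral_multc)
  also have "\<dots> = ennreal (?B ^ ?k) * ennreal (?A ^ ?k)"
    using ord by (subst nn_integral_bernoulli_sum_exp) auto
  also have "\<dots> = ennreal ((?A * ?B) ^ ?k)"
    using ord by (simp add: power_mult_distrib mult.commute flip: ennreal_mult)
  also have "\<dots> \<le> ennreal (exp (exit_scale * real m * h * (12 * h\<^sup>2)))"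
    by (rule ennreal_leI[OF AB])
  finally have "(\<integral>\<^sup>+x. ennreal (exp (case x of (T, S) \<Rightarrow> h * ((\<Sum>l\<in>{i..<m}. of_bool (S l)) -
      (\<Sum>l\<in>{i..<m}. of_bool (T l))))) \<partial>?P) \<le> ennreal (exp (exit_scale * real m * h * (12 * h\<^sup>2)))" .
  from prob_le_exp_moment[OF this, of "h * ((12 * exit_scale + 1) * (real m * h\<^sup>2))"]
  have "measure_pmf.prob ?P {(T, S). h * ((12 * exit_scale + 1) * (real m * h\<^sup>2)) \<le>
        h * ((\<Sum>l\<in>{i..<m}. of_bool (S l)) - (\<Sum>l\<in>{i..<m}. of_bool (T l)))}
      \<le> exp (exit_scale * real m * h * (12 * h\<^sup>2) - h * ((12 * exit_scale + 1) * (real m * h\<^sup>2)))"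
    by (simp add: case_prod_unfold del: sum_of_bool_eq)
  also have "exit_scale * real m * h * (12 * h\<^sup>2) - h * ((12 * exit_scale + 1) * (real m * h\<^sup>2)) =
      - (real m * h ^ 3)"
    by (simp add: algebra_simps power3_eq_cube power2_eq_square)
  also have "{(T, S). h * ((12 * exit_scale + 1) * (real m * h\<^sup>2)) \<le>
        h * ((\<Sum>l\<in>{i..<m}. of_bool (S l)) - (\<Sum>l\<in>{i..<m}. of_bool (T l)))} =
      {(T, S). (12 * exit_scale + 1) * (real m * h\<^sup>2) \<le>
        (\<Sum>l\<in>{i..<m}. of_bool (S l)) - (\<Sum>l\<in>{i..<m}. of_bool (T l))}"
    using h by (simp del: sum_of_bool_eq)
  finally show ?thesis by (simp only: w_def z_def)
qed

text \<open>Appending a column of density slightly above \<open>a\<close> raises the passage time above \<open>\<Phi> a\<close> but, since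
  geodesics use only its last \<open>O(m h)\<close> entries and the increments of the original model there dominate
  independent Bernoulli variables of parameter slightly below \<open>a\<close>, only by \<open>O(m h\<^sup>2)\<close>.\<close>

lemma columns_passage_lower_tail:
  "measure_pmf.prob (columns_pmf m n p)
     {C. real (columns_passage C m n) \<le> \<Phi> a - (12 * exit_scale + 1) * (real m * h\<^sup>2)}
   \<le> (real m + 5) * exp (- (real m * h ^ 3 / 2))"
proof -
  define w w' z where "w = a + 5 * h" and "w' = a - 3 * h" and "z = a - 5 * h"
  \<comment> \<open>With this density the union of a Bernoulli(z) and a Bernoulli(q) sequence is
    Bernoulli(w'). Burke's theorem needs the parameter z on both boundaries, the exit estimate the
    larger density w' on the left; the coupling provides both.\<close>
  define q where "q = (w' - z) / (1 - z)"
  define s where "s = (12 * exit_scale + 1) * (real m * h\<^sup>2)"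
  have ord: "0 < z" "z < w'" "w' < 1" "0 < w" "w < 1" "b < z"
    using a b h a_less b_less by (auto simp: w_def w'_def z_def)
  have q: "0 \<le> q" "q \<le> 1" "1 - (1 - z) * (1 - q) = w'"
    using ord by (auto simp: q_def field_simps)
  let ?P = "pair_pmf (bernoullis m z) (pair_pmf (bernoullis m q)
      (pair_pmf (bulk_pmf m n z p) (bernoullis m w)))"
  note norm = pair_pmf_def map_pmf_def bind_assoc_pmf bind_return_pmf
  have M1: "map_pmf (\<lambda>(v, x, X, S) j. snd (X j)) ?P = columns_pmf m n p"
    unfolding map_bulk_pmf_columns[where z = z, symmetric] by (simp add: norm)
  have M2: "map_pmf (\<lambda>(v, x, X, S). (\<lambda>i. v i \<or> x i, X)) ?P =
      pair_pmf (bernoullis m w') (bulk_pmf m n z p)"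
    using bernoullis_or[of z q m "\<lambda>u. bind_pmf (bulk_pmf m n z p) (\<lambda>X. return_pmf (u, X))"] ord q
    by (simp add: norm)
  have M3: "map_pmf (\<lambda>(v, x, X, S). (\<lambda>j. snd (X j), S)) ?P =
      pair_pmf (columns_pmf m n p) (bernoullis m w)"
    unfolding map_bulk_pmf_columns[where z = z, symmetric] by (simp add: norm)
  \<comment> \<open>By Burke's theorem the increments in the last column of the stationary model are
    independent Bernoulli(z) variables; they are compared with the appended column.\<close>
  have M4: "map_pmf (\<lambda>(v, x, X, S). (services v X n, S)) ?P =
      pair_pmf (bernoullis m z) (bernoullis m w)"
  proof -
    have "0 \<le> p j \<and> p j < z" if "j < n" for j using p[OF that] ord by auto
    from burke[OF this, where m = m and K = "\<lambda>s _. bind_pmf (bernoullis m w) (\<lambda>S. return_pmf (s, S))"]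
    show ?thesis using ord by (simp add: norm)
  qed
  define B1 where "B1 = {(C, S). real (columns_passage (C(n := S)) m (Suc n)) \<le> \<Phi> a}"
  define B2 where "B2 = {(v, X). passage (\<lambda>_. False) X m n < passage v (no_bottom X) m n}"
  define B3 where "B3 i = {(C, S). \<Phi> a \<le> real (columns_passage C i n) + (\<Sum>l\<in>{i..<m}. of_bool (S l))}" for i
  define B4 where "B4 i = {(T, S). s \<le> (\<Sum>l\<in>{i..<m}. of_bool (S l)) - (\<Sum>l\<in>{i..<m}. of_bool (T l) :: real)}" for i
  define E1 where "E1 = {(v :: nat \<Rightarrow> bool, x :: nat \<Rightarrow> bool, X, S). (\<lambda>j. snd (X j :: nat \<times> (nat \<Rightarrow> bool)), S) \<in> B1}"
  define E2 where "E2 = {(v, x, X, S :: nat \<Rightarrow> bool). (\<lambda>i. v i \<or> x i, X) \<in> B2}"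
  \<comment> \<open>Entering the appended column far below the top is excluded by moments, entering
    it near the top by comparing increments. The entry row is random, so a union over all rows is
    taken, which is the origin of the factor m in the bound.\<close>
  define E34 where "E34 i = (if exit_scale * real m * h \<le> real (m - i)
      then {(v :: nat \<Rightarrow> bool, x :: nat \<Rightarrow> bool, X, S). (\<lambda>j. snd (X j :: nat \<times> (nat \<Rightarrow> bool)), S) \<in> B3 i}
      else {(v, x, X, S). (services v X n, S) \<in> B4 i})" for i
  have PE1: "measure_pmf.prob ?P E1 \<le> 2 * exp (- (real m * h ^ 3 / 2))"
  proof -
    have "measure_pmf.prob ?P E1 = measure_pmf.prob (map_pmf (\<lambda>(v, x, X, S). (\<lambda>j. snd (X j), S)) ?P) B1"
      by (simp add: E1_def vimage_def case_prod_unfold)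
    also have "\<dots> \<le> 2 * exp (- (real m * h ^ 3 / 2))"
      unfolding M3 unfolding B1_def w_def by (rule last_column_lower_tail)
    finally show ?thesis .
  qed
  have PE2: "measure_pmf.prob ?P E2 \<le> 2 * exp (- (real m * h ^ 3 / 2))"
  proof -
    have "measure_pmf.prob ?P E2 = measure_pmf.prob (map_pmf (\<lambda>(v, x, X, S). (\<lambda>i. v i \<or> x i, X)) ?P) B2"
      by (simp add: E2_def vimage_def case_prod_unfold)
    also have "\<dots> \<le> 2 * exp (- (real m * h ^ 3 / 2))"
      unfolding M2 unfolding B2_def w'_def z_def by (rule left_exit_tail)
    finally show ?thesis .
  qed
  have PE34: "measure_pmf.prob ?P (E34 i) \<le> exp (- (real m * h ^ 3 / 2))" if i: "i \<le> m" for i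
  proof -
    have "measure_pmf.prob ?P (E34 i) \<le> exp (- (real m * h ^ 3))"
    proof (cases "exit_scale * real m * h \<le> real (m - i)")
      case True
      then have "measure_pmf.prob ?P (E34 i) =
          measure_pmf.prob (map_pmf (\<lambda>(v, x, X, S). (\<lambda>j. snd (X j), S)) ?P) (B3 i)"
        by (simp add: E34_def vimage_def case_prod_unfold)
      also have "\<dots> \<le> exp (- (real m * h ^ 3))"
        unfolding M3 unfolding B3_def w_def by (rule far_exit_tail[OF i True])
      finally show ?thesis .
    next
      case False
      then have "measure_pmf.prob ?P (E34 i) =
          measure_pmf.prob (map_pmf (\<lambda>(v, x, X, S). (services v X n, S)) ?P) (B4 i)"
        by (simp add: E34_def vimage_def case_prod_unfold)
      also have "\<dots> \<le> exp (- (real m * h ^ 3))"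
        unfolding M4 unfolding B4_def w_def z_def s_def by (rule near_exit_tail[OF i]) (use False in simp)
      finally show ?thesis .
    qed
    also have "\<dots> \<le> exp (- (real m * h ^ 3 / 2))" using h by simp
    finally show ?thesis .
  qed
  have incl: "{(v, x, X, S). real (columns_passage (\<lambda>j. snd (X j)) m n) \<le> \<Phi> a - s}
      \<subseteq> E1 \<union> E2 \<union> (\<Union>i\<in>{..m}. E34 i)"
  proof clarify
    fix v x S :: "nat \<Rightarrow> bool" and X :: "nat \<Rightarrow> nat \<times> (nat \<Rightarrow> bool)"
    assume le: "real (columns_passage (\<lambda>j. snd (X j)) m n) \<le> \<Phi> a - s"
      and 34: "(v, x, X, S) \<notin> (\<Union>i\<in>{..m}. E34 i)" and 2: "(v, x, X, S) \<notin> E2"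
    show "(v, x, X, S) \<in> E1"
    proof (rule ccontr)
      assume "(v, x, X, S) \<notin> E1"
      let ?C = "\<lambda>j. snd (X j)"
      have big: "\<Phi> a < real (columns_passage (?C(n := S)) m (Suc n))"
        using \<open>(v, x, X, S) \<notin> E1\<close> by (simp add: E1_def B1_def)
      obtain i where i: "i \<le> m" and "columns_passage (?C(n := S)) m (Suc n) =
          columns_passage (?C(n := S)) i n + (\<Sum>l\<in>{i..<m}. of_bool ((?C(n := S)) n l))"
        using columns_passage_last_column[of m "?C(n := S)" n] by blast
      moreover have "columns_passage (?C(n := S)) i n = columns_passage ?C i n"
        by (rule columns_passage_cong) auto
      ultimately have last: "real (columns_passage (?C(n := S)) m (Suc n)) =
          real (columns_passage ?C i n) + (\<Sum>l\<in>{i..<m}. of_bool (S l))"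
        by simp
      show False
      proof (cases "exit_scale * real m * h \<le> real (m - i)")
        case True
        have "(v, x, X, S) \<notin> E34 i" using 34 i by blast
        with True big last show False
          by (simp add: E34_def B3_def del: sum_of_bool_eq)
      next
        case False
        have "(v, x, X, S) \<notin> E34 i" using 34 i by blast
        with False have near: "(\<Sum>l\<in>{i..<m}. of_bool (S l)) <
            s + (\<Sum>l\<in>{i..<m}. of_bool (services v X n l) :: real)"
          by (simp add: E34_def B4_def del: sum_of_bool_eq)
        have exit: "passage (\<lambda>i. v i \<or> x i) (no_bottom X) m n \<le> passage (\<lambda>_. False) X m n"
          using 2 by (simp add: E2_def B2_def)
        have "(\<Sum>l\<in>{i..<m}. of_bool (services v X n l) :: real) \<le>
            (\<Sum>l\<in>{i..<m}. of_bool (services (\<lambda>_. False) (no_bottom X) n l))"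
          by (rule sum_mono) (use increments_dominate_if_bottom_exit[OF exit, of v] in auto)
        also have "real (columns_passage ?C i n) + \<dots> = real (columns_passage ?C m n)"
          using passage_increment[OF i, of "\<lambda>_. False" "no_bottom X" n]
          by (simp add: columns_passage_def no_bottom_def[abs_def])
        finally have "real (columns_passage ?C i n) +
            (\<Sum>l\<in>{i..<m}. of_bool (services v X n l)) \<le> real (columns_passage ?C m n)"
          by linarith
        \<comment> \<open>With G(k) the passage time to (k, n), and S and T the sums over the
          appended column and over the stationary increments: \<Phi> a < G(i) + S < G(i) + T + s
          \<le> G(m) + s \<le> \<Phi> a.\<close>
        with near big last le show False by linarith
      qed
    qed
  qed
  have "measure_pmf.prob (columns_pmf m n p) {C. real (columns_passage C m n) \<le> \<Phi> a - s} =
      measure_pmf.prob ?P {(v, x, X, S). real (columns_passage (\<lambda>j. snd (X j)) m n) \<le> \<Phi> a - s}"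
    unfolding M1[symmetric] by (simp add: vimage_def case_prod_unfold)
  also have "\<dots> \<le> measure_pmf.prob ?P (E1 \<union> E2 \<union> (\<Union>i\<in>{..m}. E34 i))"
    by (rule measure_pmf.finite_measure_mono[OF incl]) simp
  also have "\<dots> \<le> measure_pmf.prob ?P E1 + measure_pmf.prob ?P E2 + measure_pmf.prob ?P (\<Union>i\<in>{..m}. E34 i)"
    using measure_Un_le[of "E1 \<union> E2" "measure_pmf ?P" "\<Union>i\<in>{..m}. E34 i"]
      measure_Un_le[of E1 "measure_pmf ?P" E2] by simp
  also have "measure_pmf.prob ?P (\<Union>i\<in>{..m}. E34 i) \<le> (\<Sum>i\<in>{..m}. measure_pmf.prob ?P (E34 i))"
    by (rule measure_UNION_le) auto
  also have "\<dots> \<le> (\<Sum>i\<in>{..m}. exp (- (real m * h ^ 3 / 2)))"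
    by (intro sum_mono PE34) auto
  finally have "measure_pmf.prob (columns_pmf m n p) {C. real (columns_passage C m n) \<le> \<Phi> a - s}
      \<le> 2 * exp (- (real m * h ^ 3 / 2)) + 2 * exp (- (real m * h ^ 3 / 2)) +
        (real m + 1) * exp (- (real m * h ^ 3 / 2))"
    using PE1 PE2 by (simp add: add_ac)
  then show ?thesis by (simp add: s_def algebra_simps)
qed

theorem columns_passage_deviation:
  "measure_pmf.prob (columns_pmf m n p)
     {C. (12 * exit_scale + 252 / (a - b)) * (real m * h\<^sup>2) < \<bar>real (columns_passage C m n) - \<Phi> a\<bar>}
   \<le> (real m + 6) * exp (- (real m * h ^ 3 / 2))"
proof -
  let ?c = "(12 * exit_scale + 252 / (a - b)) * (real m * h\<^sup>2)"
  have c1: "252 / (a - b) * (real m * h\<^sup>2) \<le> ?c"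
    using exit_scale_ge_1 by (intro mult_right_mono) auto
  have "1 \<le> 252 / (a - b)" using a b by simp
  then have c2: "(12 * exit_scale + 1) * (real m * h\<^sup>2) \<le> ?c"
    by (intro mult_right_mono) auto
  have "measure_pmf.prob (columns_pmf m n p) {C. ?c < \<bar>real (columns_passage C m n) - \<Phi> a\<bar>}
    \<le> measure_pmf.prob (columns_pmf m n p)
      ({C. real (columns_passage C m n) \<le> \<Phi> a - (12 * exit_scale + 1) * (real m * h\<^sup>2)} \<union>
       {C. \<Phi> a + 252 / (a - b) * (real m * h\<^sup>2) \<le> real (columns_passage C m n)})"
    by (rule measure_pmf.finite_measure_mono) (use c1 c2 in auto)
  also have "\<dots> \<le> (real m + 5) * exp (- (real m * h ^ 3 / 2)) + exp (- (real m * h ^ 3))"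
    by (rule order_trans[OF measure_Un_le add_mono[OF columns_passage_lower_tail columns_passage_upper_tail]])
      auto
  also have "exp (- (real m * h ^ 3)) \<le> exp (- (real m * h ^ 3 / 2))" using h by simp
  finally show ?thesis by (simp add: algebra_simps)
qed

end

section \<open>The distribution of the environment\<close>

text \<open>Laws with equal distribution functions agree; this identifies the law of each
  \<open>p j\<close> with \<open>dF F\<close>.\<close>

lemma (in real_distribution) interval_measure_cdf_eq: "interval_measure (cdf M) = M"
proof (rule cdf_unique)
  note cdf = cdf_nondecreasing cdf_is_right_cont cdf_lim_at_bot cdf_lim_at_top_prob
  show "real_distribution (interval_measure (cdf M))"
    by (rule real_distribution_interval_measure) (use cdf in auto)
  show "cdf (interval_measure (cdf M)) = cdf M"
    by (rule cdf_interval_measure) (use cdf in auto)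
qed (rule real_distribution_axioms)

locale environment_distribution = real_distribution "dF F" for F :: "real \<Rightarrow> real" +
  assumes cdf_F: "cdf (dF F) = F"
    and F: "unit_interval_cdf F" "nondegenerate_cdf F" and edge_less_1: "right_edge F < 1"
begin

abbreviation "b \<equiv> right_edge F"

lemma F_mono: "x \<le> y \<Longrightarrow> F x \<le> F y"
  using F(1) by (simp add: unit_interval_cdf_def monoD)

lemma F_neg: "x < 0 \<Longrightarrow> F x = 0"
  using F(1) by (simp add: unit_interval_cdf_def)

lemma F_le_1: "F x \<le> 1"
  using cdf_bounded_prob[of x] cdf_F by simp

text \<open>Right continuity makes the infimum of the points with \<open>F s = 1\<close> a minimum,
  so the \<open>LEAST\<close> in \<open>right_edge\<close> is attained.\<close>

lemma F_edge: "F b = 1" and edge_least: "F s = 1 \<Longrightarrow> b \<le> s"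
proof -
  define S where "S = {s. F s = 1}"
  have "bdd_below S"
  proof (rule bdd_belowI[of _ 0])
    show "0 \<le> s" if "s \<in> S" for s using that F_neg[of s] by (cases "s < 0") (auto simp: S_def)
  qed
  moreover have "S \<noteq> {}" using F(1) by (auto simp: S_def unit_interval_cdf_def)
  ultimately have S: "S \<noteq> {}" "bdd_below S" by auto
  have above: "F x = 1" if x: "Inf S < x" for x
  proof -
    obtain s where "s \<in> S" "s < x" using x cInf_less_iff[OF S, of x] by blast
    then show ?thesis using F_mono[of s x] F_le_1[of x] by (simp add: S_def)
  qed
  have "(F \<longlongrightarrow> F (Inf S)) (at_right (Inf S))"
    using F(1) by (simp add: unit_interval_cdf_def continuous_within)
  moreover have "(F \<longlongrightarrow> 1) (at_right (Inf S))"
    by (rule tendsto_eventually) (auto simp: eventually_at_filter above)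
  ultimately have Inf: "F (Inf S) = 1"
    using tendsto_unique trivial_limit_at_right_real by blast
  have le: "Inf S \<le> s" if "F s = 1" for s using that S by (intro cInf_lower) (auto simp: S_def)
  have "b = Inf S" unfolding right_edge_def by (rule Least_equality) (use Inf le in auto)
  then show "F b = 1" "F s = 1 \<Longrightarrow> b \<le> s" using Inf le by auto
qed

lemma edge_pos: "0 < b"
proof -
  obtain s where s: "0 < F s" "F s < 1" using F(2) by (auto simp: nondegenerate_cdf_def)
  then have "0 \<le> s" using F_neg[of s] by (cases "s < 0") auto
  moreover have "s < b" using s F_mono[of b s] F_edge by (cases "b \<le> s") auto
  ultimately show ?thesis by simp
qed

lemma AE_range: "AE p in dF F. 0 \<le> p \<and> p \<le> b"
proof -
  have "AE p in dF F. p \<le> b"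
    using prob_eq_1[of "{..b}"] F_edge cdf_F by (simp add: cdf_def fun_eq_iff)
  moreover have "AE p in dF F. - inverse (real (Suc k)) < p" for k
  proof -
    have "measure (dF F) {.. - inverse (real (Suc k))} = 0"
      using F_neg[of "- inverse (real (Suc k))"] fun_cong[OF cdf_F, of "- inverse (real (Suc k))"]
      by (simp add: cdf_def)
    then have "AE p in dF F. p \<notin> {.. - inverse (real (Suc k))}"
      by (subst (asm) prob_eq_0) auto
    then show ?thesis by eventually_elim auto
  qed
  then have "AE p in dF F. \<forall>k. - inverse (real (Suc k)) < p" by (simp add: AE_all_countable)
  ultimately show ?thesis
  proof eventually_elim
    case (elim p)
    show ?case
    proof (rule ccontr)
      assume "\<not> ?thesis"
      with elim have "p < 0" by auto
      then obtain k where "inverse (real (Suc k)) < - p" using reals_Archimedean[of "- p"] by auto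
      with elim show False by (metis less_minus_iff less_asym)
    qed
  qed
qed

section \<open>The equation that determines \<open>a\<close>\<close>

lemma quad_integrand_bound:
  assumes "b < l" "l \<le> x" "0 \<le> p" "p \<le> b"
  shows "0 \<le> p * (1 - p) / (x - p)\<^sup>2" "norm (p * (1 - p) / (x - p)\<^sup>2) \<le> 1 / (l - b)\<^sup>2"
proof -
  have "p * (1 - p) \<le> 1 * 1" using assms edge_less_1 by (intro mult_mono) auto
  moreover have "(l - b)\<^sup>2 \<le> (x - p)\<^sup>2" using assms by (intro power_mono) auto
  ultimately have "p * (1 - p) / (x - p)\<^sup>2 \<le> 1 / (l - b)\<^sup>2"
    using assms edge_less_1 by (intro frac_le) auto
  moreover show "0 \<le> p * (1 - p) / (x - p)\<^sup>2" using assms edge_less_1 by simp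
  ultimately show "norm (p * (1 - p) / (x - p)\<^sup>2) \<le> 1 / (l - b)\<^sup>2"
    by (simp only: real_norm_def abs_of_nonneg)
qed

text \<open>Right of the edge the expectation is finite, and a real-valued version gives access to
  continuity and the intermediate value theorem.\<close>

definition quad_mean_real :: "real \<Rightarrow> real" where
  "quad_mean_real x = (\<integral>p. p * (1 - p) / (x - p)\<^sup>2 \<partial>dF F)"

lemma integrable_quad: "b < x \<Longrightarrow> integrable (dF F) (\<lambda>p. p * (1 - p) / (x - p)\<^sup>2)"
proof (rule integrable_const_bound[of _ "1 / (x - b)\<^sup>2"])
  assume x: "b < x"
  show "AE p in dF F. norm (p * (1 - p) / (x - p)\<^sup>2) \<le> 1 / (x - b)\<^sup>2"
    using AE_range by eventually_elim (rule quad_integrand_bound(2)[OF x], auto)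
qed simp

lemma quad_mean_eq: "b < x \<Longrightarrow> quad_mean F x = ennreal (quad_mean_real x)"
proof -
  assume x: "b < x"
  have "quad_mean F x = (\<integral>\<^sup>+p. ennreal (p * (1 - p) / (x - p)\<^sup>2) \<partial>dF F)"
    unfolding quad_mean_def
    by (rule nn_integral_cong_AE, rule eventually_mono[OF AE_range])
      (use x edge_less_1 in \<open>auto intro!: divide_ennreal mult_nonneg_nonneg zero_less_power\<close>)
  also have "\<dots> = ennreal (quad_mean_real x)"
    unfolding quad_mean_real_def
    by (rule nn_integral_eq_integral[OF integrable_quad[OF x]], use AE_range in eventually_elim)
      (rule quad_integrand_bound(1)[OF x], auto)
  finally show ?thesis .
qed

lemma quad_mean_real_nonneg: "b < x \<Longrightarrow> 0 \<le> quad_mean_real x"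
  unfolding quad_mean_real_def
  by (rule integral_nonneg_AE, use AE_range in eventually_elim) (rule quad_integrand_bound(1)[of x x], auto)

lemma continuous_on_quad_mean_real:
  assumes l: "b < l"
  shows "continuous_on {l..} quad_mean_real"
proof (unfold continuous_on_sequentially comp_def, intro ballI allI impI)
  fix x :: "nat \<Rightarrow> real" and y assume y: "y \<in> {l..}" and "(\<forall>n. x n \<in> {l..}) \<and> x \<longlonglongrightarrow> y"
  then have x: "\<And>n. l \<le> x n" "x \<longlonglongrightarrow> y" by auto
  show "(\<lambda>n. quad_mean_real (x n)) \<longlonglongrightarrow> quad_mean_real y"
    unfolding quad_mean_real_def
  proof (rule integral_dominated_convergence[where w = "\<lambda>_. 1 / (l - b)\<^sup>2"])
    show "AE p in dF F. (\<lambda>n. p * (1 - p) / (x n - p)\<^sup>2) \<longlonglongrightarrow> p * (1 - p) / (y - p)\<^sup>2"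
      using AE_range by eventually_elim (use x y l in \<open>auto intro!: tendsto_intros\<close>)
    show "AE p in dF F. norm (p * (1 - p) / (x n - p)\<^sup>2) \<le> 1 / (l - b)\<^sup>2" for n
      using AE_range by eventually_elim (rule quad_integrand_bound(2)[OF l x(1)], auto)
  qed auto
qed

text \<open>Strict decrease in a form that tolerates infinite values, from y - p \<ge> (x - p) * (1
  + (y - x)). It holds down to the edge, so uniqueness of \<open>a\<close> covers the closed
  interval.\<close>

lemma quad_mean_gap:
  assumes "b \<le> x" "x \<le> y" "y \<le> 1"
  shows "ennreal (1 + (y - x)) * quad_mean F y \<le> quad_mean F x"
proof (cases "x = y")
  case False
  then have y: "b < y" using assms by simp
  have "ennreal (1 + (y - x)) * quad_mean F y =
      (\<integral>\<^sup>+p. ennreal (1 + (y - x)) * (ennreal (p * (1 - p)) / ennreal ((y - p)\<^sup>2)) \<partial>dF F)"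
    unfolding quad_mean_def by (rule nn_integral_cmult[symmetric]) simp
  also have "\<dots> \<le> quad_mean F x"
    unfolding quad_mean_def
  proof (rule nn_integral_mono_AE, use AE_range in eventually_elim)
    case (elim p)
    show ?case
    \<comment> \<open>Since p \<le> b \<le> x, this point can only be the edge, where the integrand
      on the right is infinite for p > 0.\<close>
    proof (cases "p = x")
      case True
      show ?thesis
      proof (cases "p = 0")
        case False
        then have "0 < p * (1 - p)" using elim edge_less_1 by simp
        then show ?thesis using True by (simp add: ennreal_zero_less_divide divide_ennreal_def ennreal_mult_top)
      qed simp
    next
      case False
      then have px: "p < x" "p \<le> b" "0 \<le> p" "p < 1" using elim assms edge_less_1 by auto
      have "(x - p) * (1 + (y - x)) \<le> y - p"
        using mult_right_mono[of "x - p" 1 "y - x"] px assms by (simp add: algebra_simps)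
      then have "((x - p) * (1 + (y - x)))\<^sup>2 \<le> (y - p)\<^sup>2"
        using px assms by (intro power_mono) auto
      then have "(1 + (y - x))\<^sup>2 * (x - p)\<^sup>2 \<le> (y - p)\<^sup>2" by (simp add: power_mult_distrib mult.commute)
      moreover have "(1 + (y - x)) * (x - p)\<^sup>2 \<le> (1 + (y - x))\<^sup>2 * (x - p)\<^sup>2"
        using assms by (intro mult_right_mono self_le_power) auto
      ultimately have "(1 + (y - x)) * (x - p)\<^sup>2 \<le> (y - p)\<^sup>2" by linarith
      then have "p * (1 - p) * ((1 + (y - x)) * (x - p)\<^sup>2) \<le> p * (1 - p) * (y - p)\<^sup>2"
        using px by (intro mult_left_mono) auto
      then have "(1 + (y - x)) * (p * (1 - p) / (y - p)\<^sup>2) \<le> p * (1 - p) / (x - p)\<^sup>2"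
        using px assms by (simp add: field_simps)
      moreover have "ennreal (1 + (y - x)) * (ennreal (p * (1 - p)) / ennreal ((y - p)\<^sup>2)) =
          ennreal ((1 + (y - x)) * (p * (1 - p) / (y - p)\<^sup>2))"
      proof -
        have "0 \<le> p * (1 - p)" "0 < (y - p)\<^sup>2" using px assms by auto
        then show ?thesis
          by (simp only: divide_ennreal) (rule ennreal_mult[symmetric], use assms in auto)
      qed
      moreover have "ennreal (p * (1 - p)) / ennreal ((x - p)\<^sup>2) = ennreal (p * (1 - p) / (x - p)\<^sup>2)"
        using px by (intro divide_ennreal) auto
      ultimately show ?thesis by (simp only: ennreal_leI)
    qed
  qed
  finally show ?thesis .
qed simp

text \<open>Fatou's lemma along parameters decreasing to the edge. Continuity of
  \<open>inverse\<close> on extended reals lets the integrand converge even at p = b, where its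
  limit is infinite.\<close>

lemma quad_mean_edge_le:
  assumes "\<And>x. b < x \<Longrightarrow> x < 1 \<Longrightarrow> quad_mean F x \<le> c"
  shows "quad_mean F b \<le> c"
proof -
  define x where "x k = b + (1 - b) / real (Suc (Suc k))" for k
  have x: "b < x k" "x k < 1" for k
  proof -
    have "(1 - b) / real (Suc (Suc k)) < (1 - b) / 1"
      using edge_less_1 by (intro divide_strict_left_mono) auto
    then show "x k < 1" by (simp add: x_def)
  qed (use edge_less_1 in \<open>simp add: x_def\<close>)
  have "(\<lambda>k. b + (1 - b) * inverse (real (Suc (Suc k)))) \<longlonglongrightarrow> b + (1 - b) * 0"
    by (rule tendsto_add[OF tendsto_const
        tendsto_mult[OF tendsto_const LIMSEQ_Suc[OF LIMSEQ_inverse_real_of_nat]]])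
  then have xlim: "x \<longlonglongrightarrow> b" by (simp add: x_def[abs_def] divide_inverse)
  let ?f = "\<lambda>x p. ennreal (p * (1 - p)) / ennreal ((x - p)\<^sup>2)"
  have "(\<lambda>k. ?f (x k) p) \<longlonglongrightarrow> ?f b p" for p
  proof -
    have "(\<lambda>k. ennreal ((x k - p)\<^sup>2)) \<longlonglongrightarrow> ennreal ((b - p)\<^sup>2)"
      by (intro tendsto_ennrealI tendsto_intros xlim)
    moreover have "isCont inverse (y :: ennreal)" for y
      using continuous_on_inverse_ennreal[OF continuous_on_id, of UNIV]
      by (simp add: continuous_on_eq_continuous_at)
    ultimately have "(\<lambda>k. inverse (ennreal ((x k - p)\<^sup>2))) \<longlonglongrightarrow> inverse (ennreal ((b - p)\<^sup>2))"
      by (rule isCont_tendsto_compose[rotated])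
    then show ?thesis
      unfolding divide_ennreal_def by (intro ennreal_tendsto_cmult) auto
  qed
  then have "quad_mean F b = (\<integral>\<^sup>+p. liminf (\<lambda>k. ?f (x k) p) \<partial>dF F)"
    unfolding quad_mean_def
    by (intro nn_integral_cong lim_imp_Liminf[symmetric]) simp_all
  also have "\<dots> \<le> liminf (\<lambda>k. quad_mean F (x k))"
    unfolding quad_mean_def by (rule nn_integral_liminf) simp
  also have "\<dots> \<le> liminf (\<lambda>k. c)"
    by (intro Liminf_mono always_eventually allI assms x)
  finally show ?thesis by (simp add: Liminf_const)
qed

theorem growth_a_exists:
  assumes \<alpha>: "0 < \<alpha>" "alpha_crit' F < ennreal \<alpha>" "ennreal \<alpha> < alpha_crit F"
  shows "\<exists>!a. is_growth_a \<alpha> F a"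
    and "b < growth_a \<alpha> F" "growth_a \<alpha> F < 1" "\<alpha> * quad_mean_real (growth_a \<alpha> F) = 1"
proof -
  \<comment> \<open>This identifies the upper critical value with the reciprocal of
    \<open>quad_mean\<close> at 1, the right end for the intermediate value theorem.\<close>
  have "quad_mean F 1 = (\<integral>\<^sup>+p. ennreal p / ennreal (1 - p) \<partial>dF F)"
    unfolding quad_mean_def
  proof (rule nn_integral_cong_AE, use AE_range in eventually_elim)
    case (elim p)
    then have "0 \<le> p" "0 < 1 - p" using edge_less_1 by auto
    then show ?case by (simp add: divide_ennreal power2_eq_square)
  qed
  then have less: "ennreal \<alpha> < inverse (ennreal (quad_mean_real 1))"
    using \<alpha>(3) quad_mean_eq[OF edge_less_1] by (simp add: alpha_crit_def)
  have Q1: "quad_mean_real 1 < 1 / \<alpha>"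
  proof (cases "quad_mean_real 1 = 0")
    case False
    then have pos: "0 < quad_mean_real 1" using quad_mean_real_nonneg[OF edge_less_1] by simp
    then have "\<alpha> < inverse (quad_mean_real 1)"
      using less \<alpha>(1) by (simp add: inverse_ennreal ennreal_less_iff)
    then show ?thesis using pos \<alpha>(1) by (simp add: field_simps)
  qed (use \<alpha> in simp)
  \<comment> \<open>If all values right of the edge were at most 1 / \<alpha>, so would be the value
    at the edge, contradicting the lower critical condition.\<close>
  have "\<exists>l>b. l < 1 \<and> 1 / \<alpha> < quad_mean_real l"
  proof (rule ccontr)
    assume "\<not> ?thesis"
    then have "quad_mean F x \<le> ennreal (1 / \<alpha>)" if "b < x" "x < 1" for x
      using that by (simp add: quad_mean_eq ennreal_leI) (meson ennreal_leI not_less)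
    then have "quad_mean F b \<le> ennreal (1 / \<alpha>)" by (rule quad_mean_edge_le)
    then obtain r where r: "quad_mean F b = ennreal r" "0 \<le> r" "r \<le> 1 / \<alpha>"
      using \<alpha>(1) by (cases "quad_mean F b") (auto simp: ennreal_le_iff top_unique)
    have "inverse (ennreal r) < ennreal \<alpha>" using \<alpha>(2) r(1) by (simp add: alpha_crit'_def)
    then show False
      using r \<alpha>(1) by (cases "r = 0") (auto simp: inverse_ennreal ennreal_less_iff field_simps)
  qed
  then obtain l where l: "b < l" "l < 1" "1 / \<alpha> < quad_mean_real l" by blast
  have "\<exists>a\<ge>l. a \<le> 1 \<and> quad_mean_real a = 1 / \<alpha>"
    by (rule IVT2') (use l Q1 continuous_on_subset[OF continuous_on_quad_mean_real[OF l(1)]] in auto)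
  then obtain a where a: "l \<le> a" "a \<le> 1" "quad_mean_real a = 1 / \<alpha>" by blast
  have a': "b < a" "a < 1" using a l Q1 by (auto simp: less_le)
  have eq: "ennreal \<alpha> * quad_mean F x = 1 \<longleftrightarrow> quad_mean F x = ennreal (1 / \<alpha>)" for x
  proof
    assume "ennreal \<alpha> * quad_mean F x = 1"
    then have "ennreal (1 / \<alpha>) * (ennreal \<alpha> * quad_mean F x) = ennreal (1 / \<alpha>)" by simp
    then show "quad_mean F x = ennreal (1 / \<alpha>)"
      using \<alpha>(1) by (simp add: mult.assoc[symmetric] flip: ennreal_mult)
  qed (use \<alpha>(1) in \<open>simp flip: ennreal_mult\<close>)
  have ga: "is_growth_a \<alpha> F a"
    using a a' \<alpha>(1) by (simp add: is_growth_a_def quad_mean_eq flip: ennreal_mult)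
  have no_gap: False if "is_growth_a \<alpha> F x" "is_growth_a \<alpha> F y" "x < y" for x y
  proof -
    have "ennreal (1 + (y - x)) * quad_mean F y \<le> quad_mean F x"
      using that by (intro quad_mean_gap) (auto simp: is_growth_a_def)
    moreover have "quad_mean F x = ennreal (1 / \<alpha>)" "quad_mean F y = ennreal (1 / \<alpha>)"
      using that by (auto simp: is_growth_a_def eq)
    ultimately have "ennreal ((1 + (y - x)) * (1 / \<alpha>)) \<le> ennreal (1 / \<alpha>)"
      using that \<alpha>(1) by (subst ennreal_mult) simp_all
    then have "(1 + (y - x)) * (1 / \<alpha>) \<le> 1 / \<alpha>" using \<alpha>(1) by (simp add: ennreal_le_iff)
    then show False using that \<alpha>(1) by (simp add: field_simps)
  qed
  then have unique: "x = a" if "is_growth_a \<alpha> F x" for x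
    using that ga by (meson linorder_neqE)
  show "\<exists>!a. is_growth_a \<alpha> F a" using ga unique by blast
  have "growth_a \<alpha> F = a" unfolding growth_a_def using ga unique by blast
  then show "b < growth_a \<alpha> F" "growth_a \<alpha> F < 1" "\<alpha> * quad_mean_real (growth_a \<alpha> F) = 1"
    using a a' \<alpha>(1) by auto
qed

end

section \<open>The random environment\<close>

locale disordered = prob_space M for M :: "'a measure" +
  fixes F :: "real \<Rightarrow> real" and \<alpha> :: real
    and p :: "nat \<Rightarrow> 'a \<Rightarrow> real" and \<epsilon> :: "nat \<Rightarrow> nat \<Rightarrow> 'a \<Rightarrow> bool"
  assumes cdf: "unit_interval_cdf F" "nondegenerate_cdf F" "right_edge F < 1"
    and \<alpha>: "0 < \<alpha>" "alpha_crit' F < ennreal \<alpha>" "ennreal \<alpha> < alpha_crit F"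
    and array: "disordered_array M F p \<epsilon>"
begin

lemma indep_p: "indep_vars (\<lambda>_. borel) p UNIV"
  using array by (simp add: disordered_array_def)

lemma measurable_p [measurable]: "p j \<in> borel_measurable M"
  using indep_p by (simp add: indep_vars_def)

lemma measurable_entry [measurable]: "\<epsilon> i j \<in> measurable M (count_space UNIV)"
  using array by (simp add: disordered_array_def)

lemma real_distribution_p: "real_distribution (distr M borel (p j))"
  by (rule real_distribution_distr) simp

lemma distr_p: "distr M borel (p j) = dF F"
  using real_distribution.interval_measure_cdf_eq[OF real_distribution_p[of j]] array
  by (simp add: disordered_array_def)

lemma environment: "environment_distribution F"
proof (intro environment_distribution.intro environment_distribution_axioms.intro cdf)
  show "real_distribution (dF F)" using real_distribution_p[of 0] distr_p by simp
  have "cdf (distr M borel (p 0)) = F" using array by (simp add: disordered_array_def)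
  then show "cdf (dF F) = F" unfolding distr_p .
qed

sublocale env: environment_distribution F
  by (rule environment)

abbreviation "b \<equiv> right_edge F"
abbreviation "a \<equiv> growth_a \<alpha> F"

lemmas a_bounds = env.growth_a_exists(2,3)[OF \<alpha>]

lemma AE_p_range: "AE \<omega> in M. \<forall>j. 0 \<le> p j \<omega> \<and> p j \<omega> \<le> b"
proof -
  have "AE \<omega> in M. 0 \<le> p j \<omega> \<and> p j \<omega> \<le> b" for j
  proof -
    have "AE x in distr M borel (p j). 0 \<le> x \<and> x \<le> b" unfolding distr_p by (rule env.AE_range)
    then show ?thesis by (subst (asm) AE_distr_iff) auto
  qed
  then show ?thesis by (simp add: AE_all_countable)
qed

lemma expectation_p:
  assumes [measurable]: "f \<in> borel_measurable borel"
  shows "expectation (\<lambda>\<omega>. f (p j \<omega>)) = (\<integral>x. f x \<partial>dF F :: real)"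
  unfolding distr_p[of j, symmetric] by (rule integral_distr[symmetric]) auto

text \<open>Hoeffding's inequality and Borel-Cantelli: a deviation m^(3/5) of about \<alpha> m
  bounded terms has an exponent of order m^(1/5). The power 3/5 lies above the Gaussian 1/2 and
  below the 7/10 allowed for the slope at \<open>a\<close>.\<close>

lemma AE_env_sum_concentrates:
  assumes [measurable]: "f \<in> borel_measurable borel"
    and f: "\<And>x. 0 \<le> x \<Longrightarrow> x \<le> b \<Longrightarrow> f x \<in> {0..B}" and B: "0 < B"
  shows "AE \<omega> in M. \<forall>\<^sub>F m in sequentially.
    \<bar>(\<Sum>j<nat \<lfloor>\<alpha> * real m\<rfloor>. f (p j \<omega>)) - real (nat \<lfloor>\<alpha> * real m\<rfloor>) * (\<integral>x. f x \<partial>dF F)\<bar> < real m powr (3/5)"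
proof -
  define N where "N m = nat \<lfloor>\<alpha> * real m\<rfloor>" for m
  define f_mean where "f_mean = (\<integral>x. f x \<partial>dF F)"
  define E where "E m = {\<omega> \<in> space M. \<bar>(\<Sum>j<N m. f (p j \<omega>)) - real (N m) * f_mean\<bar> \<ge> real m powr (3/5)}" for m
  have [measurable]: "E m \<in> events" for m unfolding E_def by measurable
  define k where "k = 2 / (\<alpha> * B\<^sup>2)"
  have k: "0 < k" using B \<alpha> by (simp add: k_def)
  obtain m0 :: nat where m0: "1 / \<alpha> \<le> real m0" using real_arch_simple by blast
  have bound: "prob (E m) \<le> 2 * exp (- k * real m powr (1/5))" if m: "m0 \<le> m" for m
  proof -
    have am: "1 \<le> \<alpha> * real m"
    proof -
      have "1 / \<alpha> \<le> real m" using m0 m by (meson of_nat_mono order_trans)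
      then show ?thesis using \<alpha>(1) by (simp add: field_simps)
    qed
    then have Npos: "0 < N m" and N_le: "real (N m) \<le> \<alpha> * real m" by (auto simp: N_def)
    have mpos: "0 < real m" using am by (cases m) auto
    interpret Hoeffding_ineq_iid M "{..<N m}" "\<lambda>j \<omega>. f (p j \<omega>)" "\<lambda>\<omega>. f (p 0 \<omega>)" 0 B
      "expectation (\<lambda>\<omega>. f (p 0 \<omega>))"
    proof unfold_locales
      show "indep_vars (\<lambda>_. borel) (\<lambda>j \<omega>. f (p j \<omega>)) {..<N m}"
        by (rule indep_vars_subset[OF indep_vars_compose2[OF indep_p]]) auto
      show "distr M borel (\<lambda>\<omega>. f (p j \<omega>)) = distr M borel (\<lambda>\<omega>. f (p 0 \<omega>))" for j
        using distr_distr[of f borel borel "p j" M] distr_distr[of f borel borel "p 0" M]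
        by (simp add: distr_p comp_def)
      show "AE \<omega> in M. f (p 0 \<omega>) \<in> {0..B}"
        using AE_p_range by eventually_elim (use f in blast)
    qed auto
    have f_mean: "expectation (\<lambda>\<omega>. f (p 0 \<omega>)) = f_mean" unfolding f_mean_def by (rule expectation_p) simp
    have "prob (E m) \<le> 2 * exp (- 2 * (real m powr (3/5))\<^sup>2 / (real (N m) * (B - 0)\<^sup>2))"
      using Hoeffding_ineq_abs_ge[of "real m powr (3/5)"] B Npos
      by (simp add: E_def f_mean lessThan_empty_iff)
    also have "\<dots> \<le> 2 * exp (- k * real m powr (1/5))"
    proof -
      have "(real m powr (3/5))\<^sup>2 = real m powr (1/5) * real m"
      proof -
        have "(real m powr (3/5))\<^sup>2 = real m powr (6/5)" by (simp add: power2_eq_square flip: powr_add)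
        also have "\<dots> = real m powr (1/5 + 1)" by simp
        also have "\<dots> = real m powr (1/5) * real m" using mpos by (simp only: powr_add powr_one)
        finally show ?thesis .
      qed
      then have "k * real m powr (1/5) = 2 * (real m powr (3/5))\<^sup>2 / (\<alpha> * real m * B\<^sup>2)"
        using mpos \<alpha>(1) B by (simp add: k_def field_simps)
      also have "\<dots> \<le> 2 * (real m powr (3/5))\<^sup>2 / (real (N m) * (B - 0)\<^sup>2)"
        using N_le Npos B mpos \<alpha>(1) by (intro divide_left_mono mult_mono mult_pos_pos) auto
      finally show ?thesis by simp
    qed
    finally show ?thesis .
  qed
  have "summable (\<lambda>m. prob (E m))"
  proof (rule summable_comparison_test_ev)
    have "\<forall>\<^sub>F m in sequentially. 2 * exp (- k * real m powr (1/5)) \<le> 1 / real m ^ 2"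
      using k by real_asymp
    then show "\<forall>\<^sub>F m in sequentially. norm (prob (E m)) \<le> 1 / real m ^ 2"
      using eventually_ge_at_top[of m0] by eventually_elim (use bound in fastforce)
    show "summable (\<lambda>m. 1 / real m ^ 2)" by (rule inverse_power_summable[simplified inverse_eq_divide]) simp
  qed
  then have "AE \<omega> in M. \<forall>\<^sub>F m in sequentially. \<omega> \<in> space M - E m"
    by (intro borel_cantelli_AE1) (auto simp: emeasure_eq_measure)
  then show ?thesis
  proof eventually_elim
    case (elim \<omega>)
    then show ?case by eventually_elim (auto simp: E_def N_def f_mean_def not_le)
  qed
qed

text \<open>Entries outside the corner get the default \<open>False\<close> of
  \<open>columns_pmf\<close>, so only finitely many matrices can occur.\<close>

definition entries :: "nat \<Rightarrow> nat \<Rightarrow> 'a \<Rightarrow> nat \<Rightarrow> nat \<Rightarrow> bool" where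
  "entries m n \<omega> j i \<longleftrightarrow> j < n \<and> i < m \<and> \<epsilon> i j \<omega>"

section \<open>From a fixed environment to the random array\<close>

lemma subalgebra_env: "subalgebra M (env_algebra M p)"
proof -
  have "(\<lambda>\<omega> j. p j \<omega>) \<in> measurable M (\<Pi>\<^sub>M j\<in>UNIV. (borel :: real measure))"
    by (rule measurable_PiM_single') auto
  then show ?thesis
    unfolding subalgebra_def env_algebra_def using sets_image_in_sets[OF refl, of _ M] by simp
qed

sublocale sub: finite_measure_subalgebra M "env_algebra M p"
  by unfold_locales (rule subalgebra_env)

lemma measurable_p_env [measurable]: "p j \<in> borel_measurable (env_algebra M p)"
proof -
  have "(\<lambda>\<omega> j. p j \<omega>) \<in> measurable (env_algebra M p) (\<Pi>\<^sub>M j\<in>UNIV. (borel :: real measure))"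
    unfolding env_algebra_def by (rule measurable_vimage_algebra1) (auto simp: space_PiM)
  from measurable_compose[OF this measurable_component_singleton[of j UNIV]]
  show ?thesis by simp
qed

lemma space_env: "space (env_algebra M p) = space M"
  by (simp add: env_algebra_def)

lemma sets_env_events: "A \<in> sets (env_algebra M p) \<Longrightarrow> A \<in> events"
  using subalgebra_env by (auto simp: subalgebra_def)

lemma pmf_columns_pmf:
  assumes C: "\<And>j i. C j i \<Longrightarrow> j < n \<and> i < m" and q: "\<And>j. j < n \<Longrightarrow> 0 \<le> q j \<and> q j \<le> 1"
  shows "pmf (columns_pmf m n q) C = (\<Prod>(i, j)\<in>{..<m} \<times> {..<n}. if C j i then q j else 1 - q j)"
proof -
  have "pmf (columns_pmf m n q) C = (\<Prod>j<n. pmf (bernoullis m (q j)) (C j))"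
    unfolding columns_pmf_def by (subst pmf_Pi) (use C in \<open>auto simp: fun_eq_iff\<close>)
  also have "\<dots> = (\<Prod>j<n. \<Prod>i<m. if C j i then q j else 1 - q j)"
  proof (rule prod.cong[OF refl])
    fix j assume j: "j \<in> {..<n}"
    have "pmf (bernoulli_pmf (q j)) y = (if y then q j else 1 - q j)" for y
      using q j by (cases y) auto
    then show "pmf (bernoullis m (q j)) (C j) = (\<Prod>i<m. if C j i then q j else 1 - q j)"
      by (subst pmf_Pi) (use C in auto)
  qed
  also have "\<dots> = (\<Prod>i<m. \<Prod>j<n. if C j i then q j else 1 - q j)"
    by (rule prod.swap)
  finally show ?thesis by (simp add: prod.cartesian_product)
qed

text \<open>The event is split over the finitely many matrices C. For each of them the remaining
  condition lies in \<open>env_algebra\<close>, so the conditional expectation may replace the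
  indicator of C by its product probability. \<open>R\<close> may depend on the environment, as the
  centering of \<open>H\<close> does.\<close>

lemma annealed_le_quenched:
  assumes G: "G \<in> sets (env_algebra M p)"
    and R: "\<And>C. {\<omega> \<in> space M. R C (\<lambda>j. p j \<omega>)} \<in> sets (env_algebra M p)"
    and range: "\<And>\<omega> j. \<omega> \<in> G \<Longrightarrow> j < n \<Longrightarrow> 0 \<le> p j \<omega> \<and> p j \<omega> \<le> 1"
    and bound: "\<And>\<omega>. \<omega> \<in> G \<Longrightarrow>
      measure_pmf.prob (columns_pmf m n (\<lambda>j. p j \<omega>)) {C. R C (\<lambda>j. p j \<omega>)} \<le> \<delta>"
    and \<delta>: "0 \<le> \<delta>"
  shows "{\<omega> \<in> G. R (entries m n \<omega>) (\<lambda>j. p j \<omega>)} \<in> events"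
    and "prob {\<omega> \<in> G. R (entries m n \<omega>) (\<lambda>j. p j \<omega>)} \<le> \<delta>"
proof -
  let ?K = "{..<m} \<times> {..<n}"
  define CC :: "(nat \<Rightarrow> nat \<Rightarrow> bool) set" where "CC = {C. \<forall>j i. C j i \<longrightarrow> j < n \<and> i < m}"
  have "CC \<subseteq> (\<lambda>S j i. (i, j) \<in> S) ` Pow ?K"
  proof
    fix C assume "C \<in> CC"
    then have "C = (\<lambda>S j i. (i, j) \<in> S) {(i, j). C j i}" "{(i, j). C j i} \<in> Pow ?K"
      by (auto simp: CC_def)
    then show "C \<in> (\<lambda>S j i. (i, j) \<in> S) ` Pow ?K" by blast
  qed
  then have fin: "finite CC" by (rule finite_subset) simp
  define E where "E C = {\<omega> \<in> space M. \<forall>(i, j)\<in>?K. \<epsilon> i j \<omega> = C j i}" for C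
  have E [measurable]: "E C \<in> events" for C
    unfolding E_def by measurable
  define A where "A C = G \<inter> {\<omega> \<in> space M. R C (\<lambda>j. p j \<omega>)}" for C
  have A_env: "A C \<in> sets (env_algebra M p)" for C unfolding A_def using G R by blast
  then have A [measurable]: "A C \<in> events" for C by (rule sets_env_events)
  have GM: "G \<subseteq> space M" using sets.sets_into_space[OF sets_env_events[OF G]] .
  have entries_iff: "entries m n \<omega> = C \<longleftrightarrow> \<omega> \<in> E C" if "\<omega> \<in> space M" "C \<in> CC" for \<omega> C
    using that by (fastforce simp: entries_def E_def CC_def fun_eq_iff)
  have split: "{\<omega> \<in> G. R (entries m n \<omega>) (\<lambda>j. p j \<omega>)} = (\<Union>C\<in>CC. A C \<inter> E C)"
  proof (intro set_eqI iffI)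
    fix \<omega> assume \<omega>: "\<omega> \<in> {\<omega> \<in> G. R (entries m n \<omega>) (\<lambda>j. p j \<omega>)}"
    have "entries m n \<omega> \<in> CC" by (auto simp: CC_def entries_def)
    with \<omega> GM entries_iff[of \<omega> "entries m n \<omega>"] show "\<omega> \<in> (\<Union>C\<in>CC. A C \<inter> E C)"
      by (auto simp: A_def)
  next
    fix \<omega> assume "\<omega> \<in> (\<Union>C\<in>CC. A C \<inter> E C)"
    with GM entries_iff show "\<omega> \<in> {\<omega> \<in> G. R (entries m n \<omega>) (\<lambda>j. p j \<omega>)}"
      by (auto simp: A_def)
  qed
  show "{\<omega> \<in> G. R (entries m n \<omega>) (\<lambda>j. p j \<omega>)} \<in> events"
    unfolding split using fin by (intro sets.finite_UN) auto
  define W where "W \<omega> C = (\<Prod>(i, j)\<in>?K. if C j i then p j \<omega> else 1 - p j \<omega>)" for \<omega> C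
  have [measurable]: "(\<lambda>\<omega>. W \<omega> C) \<in> borel_measurable M" for C
    unfolding W_def case_prod_unfold by measurable
  have W_pmf: "W \<omega> C = pmf (columns_pmf m n (\<lambda>j. p j \<omega>)) C" if "\<omega> \<in> G" "C \<in> CC" for \<omega> C
    using pmf_columns_pmf[of C n m "\<lambda>j. p j \<omega>"] that range by (auto simp: W_def CC_def)
  have intble: "integrable M (\<lambda>\<omega>. indicator (A C) \<omega> * W \<omega> C)" if "C \<in> CC" for C
  proof (rule integrable_const_bound[of _ 1])
    show "AE \<omega> in M. norm (indicator (A C) \<omega> * W \<omega> C) \<le> 1"
      using W_pmf[OF _ that] by (auto simp: indicator_def A_def pmf_le_1)
  qed simp
  have prob_AE: "prob (A C \<inter> E C) = (\<integral>\<omega>. indicator (A C) \<omega> * W \<omega> C \<partial>M)" for C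
  proof -
    have ce: "AE \<omega> in M. real_cond_exp M (env_algebra M p) (indicat_real (E C)) \<omega> = W \<omega> C"
    proof -
      have "\<forall>K e. finite K \<longrightarrow> (AE \<omega> in M. real_cond_exp M (env_algebra M p)
          (indicat_real {\<omega> \<in> space M. \<forall>(i, j)\<in>K. \<epsilon> i j \<omega> = e i j}) \<omega> =
          (\<Prod>(i, j)\<in>K. if e i j then p j \<omega> else 1 - p j \<omega>))"
        using array by (simp add: disordered_array_def)
      from this[rule_format, of ?K "\<lambda>i j. C j i"] show ?thesis by (simp add: E_def W_def)
    qed
    have "prob (A C \<inter> E C) = (\<integral>\<omega>. indicator (A C \<inter> E C) \<omega> \<partial>M)" by simp
    also have "\<dots> = (\<integral>\<omega>\<in>A C. indicat_real (E C) \<omega> \<partial>M)"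
      unfolding set_lebesgue_integral_def by (simp add: indicator_inter_arith)
    also have "\<dots> = (\<integral>\<omega>\<in>A C. real_cond_exp M (env_algebra M p) (indicat_real (E C)) \<omega> \<partial>M)"
      by (rule sub.real_cond_exp_intA[OF _ A_env]) (auto simp: emeasure_eq_measure)
    also have "\<dots> = (\<integral>\<omega>. indicator (A C) \<omega> * W \<omega> C \<partial>M)"
      unfolding set_lebesgue_integral_def
      by (rule integral_cong_AE) (use ce in \<open>auto elim!: eventually_mono\<close>)
    finally show ?thesis .
  qed
  have "prob {\<omega> \<in> G. R (entries m n \<omega>) (\<lambda>j. p j \<omega>)} \<le> (\<Sum>C\<in>CC. prob (A C \<inter> E C))"
    unfolding split using fin by (intro measure_UNION_le) auto
  also have "\<dots> = (\<integral>\<omega>. (\<Sum>C\<in>CC. indicator (A C) \<omega> * W \<omega> C) \<partial>M)"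
    unfolding prob_AE using intble by (intro Bochner_Integration.integral_sum[symmetric]) auto
  \<comment> \<open>For each environment the sum over C is at most a quenched probability on
    \<open>G\<close> and vanishes off \<open>G\<close>.\<close>
  also have "\<dots> \<le> (\<integral>\<omega>. \<delta> \<partial>M)"
  proof (rule integral_mono)
    show "integrable M (\<lambda>\<omega>. \<Sum>C\<in>CC. indicator (A C) \<omega> * W \<omega> C)"
      using intble by (intro Bochner_Integration.integrable_sum) auto
    fix \<omega> assume \<omega>: "\<omega> \<in> space M"
    show "(\<Sum>C\<in>CC. indicator (A C) \<omega> * W \<omega> C) \<le> \<delta>"
    proof (cases "\<omega> \<in> G")
      case False
      then show ?thesis using \<delta> by (simp add: A_def)
    next
      case True
      let ?Q = "columns_pmf m n (\<lambda>j. p j \<omega>)" and ?S = "{C \<in> CC. R C (\<lambda>j. p j \<omega>)}"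
      have "(\<Sum>C\<in>CC. indicator (A C) \<omega> * W \<omega> C) = (\<Sum>C\<in>CC. if R C (\<lambda>j. p j \<omega>) then pmf ?Q C else 0)"
        by (rule sum.cong) (use True \<omega> W_pmf in \<open>auto simp: A_def indicator_def\<close>)
      also have "\<dots> = measure_pmf.prob ?Q ?S"
        using fin by (simp add: measure_measure_pmf_finite sum.inter_filter)
      also have "\<dots> \<le> measure_pmf.prob ?Q {C. R C (\<lambda>j. p j \<omega>)}"
        by (rule measure_pmf.finite_measure_mono) auto
      also have "\<dots> \<le> \<delta>" by (rule bound[OF True])
      finally show ?thesis .
    qed
  qed simp
  finally show "prob {\<omega> \<in> G. R (entries m n \<omega>) (\<lambda>j. p j \<omega>)} \<le> \<delta>" by (simp add: prob_space)
qed

abbreviation n_columns :: "nat \<Rightarrow> nat" where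
  "n_columns m \<equiv> nat \<lfloor>\<alpha> * real m\<rfloor>"

lemma n_columns_bounds: "real (n_columns m) \<le> \<alpha> * real m" "\<alpha> * real m - 1 < real (n_columns m)"
proof -
  have "0 \<le> \<lfloor>\<alpha> * real m\<rfloor>" using \<alpha>(1) by simp
  then have "real (n_columns m) = real_of_int \<lfloor>\<alpha> * real m\<rfloor>" by simp
  then show "real (n_columns m) \<le> \<alpha> * real m" "\<alpha> * real m - 1 < real (n_columns m)" by linarith+
qed

text \<open>By the choice of \<open>a\<close> the summands have mean 1 / \<alpha>, so the slope is a
  centered sum up to a rounding error of at most 1 / \<alpha> from the number of columns.\<close>

lemma AE_slope_small:
  "AE \<omega> in M. \<forall>\<^sub>F m in sequentially.
    \<bar>stationary_slope m (n_columns m) (\<lambda>j. p j \<omega>) a\<bar> \<le> real m * real m powr (-3/10) / 4"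
proof -
  let ?f = "\<lambda>x. x * (1 - x) / (a - x)\<^sup>2"
  have "?f x \<in> {0..1 / (a - b)\<^sup>2}" if "0 \<le> x" "x \<le> b" for x
    using env.quad_integrand_bound[OF a_bounds(1) order_refl that]
    by (simp only: real_norm_def abs_of_nonneg atLeastAtMost_iff)
  then have "AE \<omega> in M. \<forall>\<^sub>F m in sequentially.
    \<bar>(\<Sum>j<n_columns m. ?f (p j \<omega>)) - real (n_columns m) * (\<integral>x. ?f x \<partial>dF F)\<bar> < real m powr (3/5)"
    using a_bounds by (intro AE_env_sum_concentrates) auto
  moreover have "(\<integral>x. ?f x \<partial>dF F) = 1 / \<alpha>"
    using env.growth_a_exists(4)[OF \<alpha>] \<alpha>(1) by (simp add: env.quad_mean_real_def field_simps)
  ultimately have "AE \<omega> in M. \<forall>\<^sub>F m in sequentially.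
    \<bar>(\<Sum>j<n_columns m. ?f (p j \<omega>)) - real (n_columns m) * (1 / \<alpha>)\<bar> < real m powr (3/5)"
    by simp
  then show ?thesis
  proof eventually_elim
    case (elim \<omega>)
    have "\<forall>\<^sub>F m in sequentially. 1 / \<alpha> + real m powr (3/5) \<le> real m * real m powr (-3/10) / 4"
      using \<alpha>(1) by real_asymp
    with elim show ?case
    proof eventually_elim
      case (elim m)
      have "\<bar>real m - real (n_columns m) * (1 / \<alpha>)\<bar> \<le> 1 / \<alpha>"
      proof -
        have "\<bar>x - N * (1 / \<alpha>)\<bar> \<le> 1 / \<alpha>" if "N \<le> \<alpha> * x" "\<alpha> * x - 1 < N" for x N
        proof -
          have "x - N * (1 / \<alpha>) = (\<alpha> * x - N) / \<alpha>" using \<alpha>(1) by (simp add: field_simps)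
          moreover have "\<bar>\<alpha> * x - N\<bar> \<le> 1" using that by (simp add: abs_le_iff)
          ultimately show ?thesis using \<alpha>(1) by (simp only: abs_divide) (simp add: divide_right_mono)
        qed
        then show ?thesis using n_columns_bounds by blast
      qed
      with elim show ?case unfolding stationary_slope_def by linarith
    qed
  qed
qed

lemma H_eq: "H \<alpha> \<epsilon> m \<omega> = columns_passage (entries m (n_columns m) \<omega>) m (n_columns m)"
  unfolding H_def longest_path_eq_passage by (rule columns_passage_cong) (auto simp: entries_def)

text \<open>The failure probabilities (m + 6) exp (- m^(1/10) / 2) are summable. The resulting
  almost sure bound serves both the growth rate and the limit theorem.\<close>

theorem AE_H_near_stationary_mean:
  "\<exists>c. AE \<omega> in M. \<forall>\<^sub>F m in sequentially.
    \<bar>real (H \<alpha> \<epsilon> m \<omega>) - stationary_mean m (n_columns m) (\<lambda>j. p j \<omega>) a\<bar> \<le> c * real m powr (2/5)"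
proof -
  \<comment> \<open>\<open>exit_scale\<close> depends on \<open>a\<close> and \<open>b\<close> only,
    so c is the same for all sizes and environments.\<close>
  define c where "c = 12 * near_critical.exit_scale b a + 252 / (a - b)"
  define h where "h m = real m powr (-3/10)" for m
  define G where "G m = {\<omega> \<in> space M. (\<forall>j\<in>{..<n_columns m}. 0 \<le> p j \<omega> \<and> p j \<omega> \<le> b) \<and>
    \<bar>stationary_slope m (n_columns m) (\<lambda>j. p j \<omega>) a\<bar> \<le> real m * h m / 4}" for m
  define R where "R m C q \<longleftrightarrow>
    c * (real m * (h m)\<^sup>2) < \<bar>real (columns_passage C m (n_columns m)) - stationary_mean m (n_columns m) q a\<bar>"
    for m C q
  define \<delta> where "\<delta> m = (real m + 6) * exp (- (real m * h m ^ 3 / 2))" for m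
  have G: "G m \<in> sets (env_algebra M p)" for m
    unfolding G_def stationary_slope_def space_env[symmetric] by measurable
  have R: "{\<omega> \<in> space M. R m C (\<lambda>j. p j \<omega>)} \<in> sets (env_algebra M p)" for m C
    unfolding R_def stationary_mean_def space_env[symmetric] by measurable
  have bounded: "bounded_environment n q b" if "\<And>j. j < n \<Longrightarrow> 0 \<le> q j \<and> q j \<le> b" for n q
    by unfold_locales (use that env.edge_pos cdf in auto)
  define Bad where "Bad m = {\<omega> \<in> G m. R m (entries m (n_columns m) \<omega>) (\<lambda>j. p j \<omega>)}" for m
  have quenched: "measure_pmf.prob (columns_pmf m (n_columns m) (\<lambda>j. p j \<omega>)) {C. R m C (\<lambda>j. p j \<omega>)} \<le> \<delta> m"
    if m: "0 < m" "14 * h m \<le> 1 - a" "10 * h m \<le> a - b" and \<omega>: "\<omega> \<in> G m" for m \<omega>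
  proof -
    interpret near_critical "n_columns m" "\<lambda>j. p j \<omega>" b m a "h m"
      by (intro near_critical.intro bounded near_critical_axioms.intro)
        (use m \<omega> a_bounds in \<open>auto simp: G_def h_def\<close>)
    show ?thesis using columns_passage_deviation unfolding R_def \<delta>_def c_def .
  qed
  have h_le: "\<forall>\<^sub>F m in sequentially. 14 * h m \<le> d" if "0 < d" for d
    unfolding h_def using that by real_asymp
  have "\<forall>\<^sub>F m in sequentially. 14 * h m \<le> 1 - a" "\<forall>\<^sub>F m in sequentially. 14 * h m \<le> a - b"
    using a_bounds by (intro h_le; simp)+
  then have small: "\<forall>\<^sub>F m in sequentially. 0 < m \<and> 14 * h m \<le> 1 - a \<and> 10 * h m \<le> a - b"
    using eventually_gt_at_top[of 0]
  proof eventually_elim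
    case (elim m)
    moreover have "0 \<le> h m" by (simp add: h_def)
    ultimately show ?case by simp
  qed
  have \<delta>0: "0 \<le> \<delta> m" for m by (simp add: \<delta>_def)
  have range: "0 \<le> p j \<omega> \<and> p j \<omega> \<le> 1" if "\<omega> \<in> G m" "j < n_columns m" for \<omega> j m
  proof -
    have "0 \<le> p j \<omega> \<and> p j \<omega> \<le> b" using that by (simp add: G_def)
    then show ?thesis using cdf(3) by linarith
  qed
  have Bad: "Bad m \<in> events" for m
    unfolding Bad_def
    by (rule annealed_le_quenched(1)[OF G R range, where \<delta> = 1]) auto
  have "summable (\<lambda>m. prob (Bad m))"
  proof (rule summable_comparison_test_ev)
    have "\<forall>\<^sub>F m in sequentially. \<delta> m \<le> 1 / real m ^ 2"
      unfolding \<delta>_def h_def by real_asymp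
    with small show "\<forall>\<^sub>F m in sequentially. norm (prob (Bad m)) \<le> 1 / real m ^ 2"
    proof eventually_elim
      case (elim m)
      have "prob (Bad m) \<le> \<delta> m"
        unfolding Bad_def
        by (rule annealed_le_quenched(2)[OF G R range quenched \<delta>0]) (use elim in auto)
      then show ?case using elim by simp
    qed
    show "summable (\<lambda>m. 1 / real m ^ 2)" by (rule inverse_power_summable[simplified inverse_eq_divide]) simp
  qed
  then have "AE \<omega> in M. \<forall>\<^sub>F m in sequentially. \<omega> \<in> space M - Bad m"
    by (intro borel_cantelli_AE1 Bad) (auto simp: emeasure_eq_measure)
  then have "AE \<omega> in M. \<forall>\<^sub>F m in sequentially.
    \<bar>real (H \<alpha> \<epsilon> m \<omega>) - stationary_mean m (n_columns m) (\<lambda>j. p j \<omega>) a\<bar> \<le> c * real m powr (2/5)"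
    using AE_slope_small AE_p_range AE_space
  proof eventually_elim
    case (elim \<omega>)
    from elim(1,2) show ?case
      using eventually_gt_at_top[of 0]
    proof eventually_elim
      case (elim m)
      have "real m * (h m)\<^sup>2 = real m powr (2/5)"
      proof -
        have "real m powr (2/5) = real m powr (1 + (-3/10 + -3/10))" by simp
        also have "\<dots> = real m powr 1 * (real m powr (-3/10) * real m powr (-3/10))"
          by (simp only: powr_add)
        finally show ?thesis using elim by (simp add: h_def power2_eq_square)
      qed
      then show ?case
        using elim \<open>\<forall>j. 0 \<le> p j \<omega> \<and> p j \<omega> \<le> b\<close> \<open>\<omega> \<in> space M\<close>
        by (auto simp: Bad_def G_def R_def h_def H_eq not_less)
    qed
  qed
  then show ?thesis by blast
qed

end

section \<open>Fluctuations\<close>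

text \<open>Slutsky's lemma by characteristic functions: their difference is the expectation of a
  bounded quantity that tends to 0 almost surely.\<close>

lemma (in prob_space) weak_conv_m_AE_close:
  fixes Y Z :: "nat \<Rightarrow> 'a \<Rightarrow> real"
  assumes [measurable]: "\<And>m. Y m \<in> borel_measurable M" "\<And>m. Z m \<in> borel_measurable M"
    and conv: "weak_conv_m (\<lambda>m. distr M borel (Y m)) \<mu>" and \<mu>: "real_distribution \<mu>"
    and close: "AE \<omega> in M. (\<lambda>m. Z m \<omega> - Y m \<omega>) \<longlonglongrightarrow> 0"
  shows "weak_conv_m (\<lambda>m. distr M borel (Z m)) \<mu>"
proof (rule levy_continuity[OF real_distribution_distr \<mu>])
  fix t
  have char: "char (distr M borel (W m)) t = (CLINT \<omega>|M. iexp (t * W m \<omega>))"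
    if [measurable]: "\<And>m. W m \<in> borel_measurable M" for W :: "nat \<Rightarrow> 'a \<Rightarrow> real" and m
    unfolding char_def by (rule integral_distr) auto
  have int: "integrable M (\<lambda>\<omega>. iexp (t * W m \<omega>))"
    if [measurable]: "\<And>m. W m \<in> borel_measurable M" for W :: "nat \<Rightarrow> 'a \<Rightarrow> real" and m
    by (rule integrable_const_bound[of _ 1]) auto
  have "(\<lambda>m. CLINT \<omega>|M. (iexp (t * Z m \<omega>) - iexp (t * Y m \<omega>))) \<longlonglongrightarrow> (CLINT \<omega>|M. 0)"
  proof (rule integral_dominated_convergence[where w = "\<lambda>_. 2"])
    show "AE \<omega> in M. (\<lambda>m. iexp (t * Z m \<omega>) - iexp (t * Y m \<omega>)) \<longlonglongrightarrow> 0"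
      using close
    proof eventually_elim
      case (elim \<omega>)
      have "(\<lambda>m. iexp (t * (Z m \<omega> - Y m \<omega>)) - 1) \<longlonglongrightarrow> iexp (t * 0) - 1"
        by (intro tendsto_intros elim)
      then have "(\<lambda>m. iexp (t * (Z m \<omega> - Y m \<omega>)) - 1) \<longlonglongrightarrow> 0" by simp
      then have "(\<lambda>m. norm (iexp (t * (Z m \<omega> - Y m \<omega>)) - 1)) \<longlonglongrightarrow> 0"
        by (rule tendsto_norm_zero)
      moreover have "norm (iexp (t * Z m \<omega>) - iexp (t * Y m \<omega>)) = norm (iexp (t * (Z m \<omega> - Y m \<omega>)) - 1)" for m
      proof -
        have "iexp (t * Z m \<omega>) - iexp (t * Y m \<omega>) =
            iexp (t * Y m \<omega>) * (iexp (t * (Z m \<omega> - Y m \<omega>)) - 1)"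
          by (simp add: algebra_simps flip: exp_add)
        then show ?thesis by (simp add: norm_mult)
      qed
      ultimately have "(\<lambda>m. norm (iexp (t * Z m \<omega>) - iexp (t * Y m \<omega>))) \<longlonglongrightarrow> 0" by (simp only:)
      then show ?case by (rule tendsto_norm_zero_cancel)
    qed
    show "AE \<omega> in M. norm (iexp (t * Z m \<omega>) - iexp (t * Y m \<omega>)) \<le> 2" for m
      by (intro AE_I2 order_trans[OF norm_triangle_ineq4]) simp
  qed auto
  moreover have "(CLINT \<omega>|M. (iexp (t * Z m \<omega>) - iexp (t * Y m \<omega>))) =
      char (distr M borel (Z m)) t - char (distr M borel (Y m)) t" for m
    by (subst char[OF assms(2)], subst char[OF assms(1)])
      (rule Bochner_Integration.integral_diff[OF int[OF assms(2)] int[OF assms(1)]])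
  ultimately have diff: "(\<lambda>m. char (distr M borel (Z m)) t - char (distr M borel (Y m)) t) \<longlonglongrightarrow> 0"
    by (simp only: Bochner_Integration.integral_zero)
  have "(\<lambda>m. char (distr M borel (Y m)) t) \<longlonglongrightarrow> char \<mu> t"
    by (rule levy_continuity1[OF real_distribution_distr \<mu> conv]) simp
  then show "(\<lambda>m. char (distr M borel (Z m)) t) \<longlonglongrightarrow> char \<mu> t"
    using diff by (rule Lim_transform)
qed simp

lemma measurable_columns_passage:
  assumes [measurable]: "\<And>i j. \<epsilon> i j \<in> measurable M (count_space UNIV)"
  shows "(\<lambda>\<omega>. columns_passage (\<lambda>j i. \<epsilon> i j \<omega>) i j) \<in> measurable M (count_space UNIV)"
proof (induction i arbitrary: j)
  case 0
  show ?case by (simp add: columns_passage_simps)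
next
  case (Suc i)
  note [measurable] = Suc.IH
  show ?case
  proof (induction j)
    case 0
    show ?case by (simp add: columns_passage_simps)
  next
    case (Suc j)
    note [measurable] = Suc.IH
    show ?case unfolding columns_passage_simps by measurable
  qed
qed

context disordered
begin

text \<open>The contribution of one column to the stationary mean at \<open>a\<close>.\<close>

definition weight :: "real \<Rightarrow> real" where
  "weight x = (1 - a) * x / (a - x)"

definition "weight_mean = (\<integral>x. weight x \<partial>dF F)"

lemma measurable_weight [measurable]: "weight \<in> borel_measurable borel"
  unfolding weight_def by measurable

lemma weight_bounds: "0 \<le> x \<Longrightarrow> x \<le> b \<Longrightarrow> weight x \<in> {0..1 / (a - b)}"
proof -
  assume x: "0 \<le> x" "x \<le> b"
  then have "(1 - a) * x \<le> 1 * 1" using a_bounds env.edge_pos cdf(3) by (intro mult_mono) auto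
  then show ?thesis
    unfolding weight_def using x a_bounds by (auto intro!: frac_le)
qed

lemma AE_weight_bounds: "AE x in dF F. weight x \<in> {0..1 / (a - b)}"
  using env.AE_range by eventually_elim (use weight_bounds in blast)

lemma AE_weight_p_bounds: "AE \<omega> in M. weight (p j \<omega>) \<in> {0..1 / (a - b)}"
  using AE_p_range by eventually_elim (use weight_bounds in blast)

lemma weight_mean_nonneg: "0 \<le> weight_mean"
  unfolding weight_mean_def by (rule integral_nonneg_AE) (use AE_weight_bounds in \<open>auto elim!: eventually_mono\<close>)

lemma growth_c_eq: "growth_c \<alpha> F = a + \<alpha> * weight_mean"
proof -
  have "weight_mean = (1 - a) * (\<integral>p. p / (a - p) \<partial>dF F)"
    unfolding weight_mean_def weight_def integral_mult_right_zero[symmetric] by simp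
  then show ?thesis by (simp add: growth_c_def Let_def)
qed

lemma growth_tau_eq: "(growth_tau \<alpha> F)\<^sup>2 = (\<integral>x. (weight x - weight_mean)\<^sup>2 \<partial>dF F)"
  by (simp add: growth_tau_def Let_def weight_mean_def weight_def integral_nonneg_AE)

text \<open>If the variance vanished, \<open>weight\<close> would be almost surely constant. As it
  is injective, \<open>dF F\<close> would be a point mass at the preimage of
  \<open>weight_mean\<close>, against nondegeneracy.\<close>

lemma growth_tau_pos: "0 < growth_tau \<alpha> F"
proof -
  have nonneg: "0 \<le> growth_tau \<alpha> F"
    by (simp add: growth_tau_def Let_def integral_nonneg_AE)
  moreover have "growth_tau \<alpha> F \<noteq> 0"
  proof
    assume "growth_tau \<alpha> F = 0"
    then have 0: "(\<integral>x. (weight x - weight_mean)\<^sup>2 \<partial>dF F) = 0"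
      using growth_tau_eq by simp
    have "integrable (dF F) (\<lambda>x. (weight x - weight_mean)\<^sup>2)"
    proof (rule env.integrable_const_bound[of _ "(1 / (a - b) + weight_mean)\<^sup>2"])
      show "AE x in dF F. norm ((weight x - weight_mean)\<^sup>2) \<le> (1 / (a - b) + weight_mean)\<^sup>2"
        using AE_weight_bounds
      proof eventually_elim
        case (elim x)
        then have "\<bar>weight x - weight_mean\<bar> \<le> 1 / (a - b) + weight_mean"
          using weight_mean_nonneg by (auto simp: abs_le_iff)
        then show ?case using power_mono[of "\<bar>weight x - weight_mean\<bar>" _ 2] by simp
      qed
    qed simp
    then have "AE x in dF F. (weight x - weight_mean)\<^sup>2 = 0"
      using 0 by (subst (asm) integral_nonneg_eq_0_iff_AE) auto
    then have const: "AE x in dF F. x = weight_mean * a / (1 - a + weight_mean)"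
      using env.AE_range
    proof eventually_elim
      case (elim x)
      then have "(1 - a) * x = weight_mean * (a - x)"
        using a_bounds by (simp add: weight_def field_simps)
      then have "x * (1 - a + weight_mean) = weight_mean * a" by (simp add: algebra_simps)
      then show ?case using a_bounds weight_mean_nonneg by (simp add: eq_divide_eq)
    qed
    obtain s where s: "0 < F s" "F s < 1" using cdf(2) by (auto simp: nondegenerate_cdf_def)
    have Fs: "F s = measure (dF F) {..s}" using env.cdf_F by (metis cdf_def)
    show False
    proof (cases "weight_mean * a / (1 - a + weight_mean) \<le> s")
      case True
      then have "AE x in dF F. x \<in> {..s}" using const by (auto elim!: eventually_mono)
      then have "measure (dF F) {..s} = 1" by (subst env.prob_eq_1) auto
      then show False using Fs s by simp
    next
      case False
      then have "AE x in dF F. x \<notin> {..s}" using const by (auto elim!: eventually_mono)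
      then have "measure (dF F) {..s} = 0" by (subst env.prob_eq_0) auto
      then show False using Fs s by simp
    qed
  qed
  ultimately show ?thesis by simp
qed

lemma weak_conv_env_sum:
  "weak_conv_m (\<lambda>n. distr M borel (\<lambda>\<omega>.
      (\<Sum>j<n. weight (p j \<omega>) - weight_mean) / sqrt (real n * (growth_tau \<alpha> F)\<^sup>2))) std_normal_distribution"
proof (rule central_limit_theorem)
  show "indep_vars (\<lambda>_. borel) (\<lambda>j \<omega>. weight (p j \<omega>)) UNIV"
    by (rule indep_vars_compose2[OF indep_p]) auto
  show mean: "expectation (\<lambda>\<omega>. weight (p j \<omega>)) = weight_mean" for j
    unfolding weight_mean_def by (rule expectation_p) simp
  show "variance (\<lambda>\<omega>. weight (p j \<omega>)) = (growth_tau \<alpha> F)\<^sup>2" for j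
    unfolding mean growth_tau_eq by (rule expectation_p) simp
  show "distr M borel (\<lambda>\<omega>. weight (p j \<omega>)) = distr (dF F) borel weight" for j
    unfolding distr_p[of j, symmetric] by (simp add: distr_distr comp_def)
  show "integrable M (\<lambda>\<omega>. (weight (p j \<omega>))\<^sup>2)" for j
  proof (rule integrable_const_bound[of _ "(1 / (a - b))\<^sup>2"])
    show "AE \<omega> in M. norm ((weight (p j \<omega>))\<^sup>2) \<le> (1 / (a - b))\<^sup>2"
      using AE_weight_p_bounds[of j]
      by eventually_elim (auto simp: power_mono simp del: power_divide power_one_over)
  qed simp
qed (rule growth_tau_pos)

lemma n_columns_at_top: "filterlim n_columns at_top sequentially"
proof (rule filterlim_at_top_mono)
  have "\<forall>\<^sub>F m in sequentially. real n \<le> \<alpha> * real m - 1" for n :: nat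
    using \<alpha>(1) by real_asymp
  then show "filterlim (\<lambda>m. nat \<lfloor>\<alpha> * real m\<rfloor>) at_top sequentially"
    unfolding filterlim_at_top
  proof (intro allI)
    fix n
    have "\<forall>\<^sub>F m in sequentially. real n \<le> \<alpha> * real m - 1" by fact
    then show "\<forall>\<^sub>F m in sequentially. n \<le> n_columns m"
      by eventually_elim (use n_columns_bounds(2) in \<open>smt (verit) of_nat_le_iff\<close>)
  qed
qed simp

lemma measurable_H [measurable]: "(\<lambda>\<omega>. real (H \<alpha> \<epsilon> m \<omega>)) \<in> borel_measurable M"
  unfolding H_def longest_path_eq_passage
  by (intro measurable_compose[OF measurable_columns_passage]) auto

text \<open>Besides the deviation of order m^(2/5) only the rounding of the number of columns
  enters: it differs from \<alpha> m by at most 1, which costs at most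
  \<open>weight_mean\<close>.\<close>

lemma AE_H_expansion:
  obtains e where "0 < e" and "AE \<omega> in M. \<forall>\<^sub>F m in sequentially.
    \<bar>real (H \<alpha> \<epsilon> m \<omega>) - growth_c \<alpha> F * real m
      - (\<Sum>j<n_columns m. weight (p j \<omega>) - weight_mean)\<bar> \<le> e * (real m powr (2/5) + 1)"
proof -
  obtain c where c: "AE \<omega> in M. \<forall>\<^sub>F m in sequentially.
    \<bar>real (H \<alpha> \<epsilon> m \<omega>) - stationary_mean m (n_columns m) (\<lambda>j. p j \<omega>) a\<bar> \<le> c * real m powr (2/5)"
    using AE_H_near_stationary_mean by blast
  define e where "e = \<bar>c\<bar> + weight_mean + 1"
  have "AE \<omega> in M. \<forall>\<^sub>F m in sequentially.
    \<bar>real (H \<alpha> \<epsilon> m \<omega>) - growth_c \<alpha> F * real m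
      - (\<Sum>j<n_columns m. weight (p j \<omega>) - weight_mean)\<bar> \<le> e * (real m powr (2/5) + 1)"
    using c
  proof eventually_elim
    case (elim \<omega>)
    then show ?case
    proof eventually_elim
      case (elim m)
      let ?N = "n_columns m" and ?r = "real m powr (2/5)"
      have "stationary_mean m ?N (\<lambda>j. p j \<omega>) a = real m * a + (\<Sum>j<?N. weight (p j \<omega>))"
        by (simp add: stationary_mean_def weight_def sum_distrib_left)
      then have "real (H \<alpha> \<epsilon> m \<omega>) - growth_c \<alpha> F * real m - (\<Sum>j<?N. weight (p j \<omega>) - weight_mean) =
          (real (H \<alpha> \<epsilon> m \<omega>) - stationary_mean m ?N (\<lambda>j. p j \<omega>) a) + (real ?N - \<alpha> * real m) * weight_mean"
        by (simp add: growth_c_eq sum_subtractf algebra_simps)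
      moreover have "\<bar>(real ?N - \<alpha> * real m) * weight_mean\<bar> \<le> 1 * weight_mean"
      proof -
        have "\<bar>real ?N - \<alpha> * real m\<bar> \<le> 1" using n_columns_bounds[of m] by linarith
        then show ?thesis
          unfolding abs_mult abs_of_nonneg[OF weight_mean_nonneg]
          using weight_mean_nonneg by (rule mult_right_mono)
      qed
      moreover have "c * ?r \<le> \<bar>c\<bar> * ?r" by (intro mult_right_mono) auto
      moreover have "\<bar>c\<bar> * ?r + weight_mean \<le> e * (?r + 1)"
        using weight_mean_nonneg by (simp add: e_def algebra_simps)
      ultimately show ?case using elim by linarith
    qed
  qed
  moreover have "0 < e" using weight_mean_nonneg by (simp add: e_def)
  ultimately show ?thesis using that by blast
qed

lemma AE_weight_sum_small:
  "AE \<omega> in M. \<forall>\<^sub>F m in sequentially.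
    \<bar>\<Sum>j<n_columns m. weight (p j \<omega>) - weight_mean\<bar> < real m powr (3/5)"
  using AE_env_sum_concentrates[of weight "1 / (a - b)"] weight_bounds a_bounds
  by (simp add: sum_subtractf weight_mean_def)

theorem AE_growth_rate: "AE \<omega> in M. (\<lambda>m. real (H \<alpha> \<epsilon> m \<omega>) / real m) \<longlonglongrightarrow> growth_c \<alpha> F"
proof -
  obtain e where e: "0 < e" "AE \<omega> in M. \<forall>\<^sub>F m in sequentially.
    \<bar>real (H \<alpha> \<epsilon> m \<omega>) - growth_c \<alpha> F * real m
      - (\<Sum>j<n_columns m. weight (p j \<omega>) - weight_mean)\<bar> \<le> e * (real m powr (2/5) + 1)"
    using AE_H_expansion by blast
  let ?B = "\<lambda>m. (e * (real m powr (2/5) + 1) + real m powr (3/5)) / real m"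
  have B: "?B \<longlonglongrightarrow> 0" using e(1) by real_asymp
  show ?thesis
    using e(2) AE_weight_sum_small
  proof eventually_elim
    case (elim \<omega>)
    from elim eventually_gt_at_top[of 0]
    have "\<forall>\<^sub>F m in sequentially. norm (real (H \<alpha> \<epsilon> m \<omega>) / real m - growth_c \<alpha> F) \<le> ?B m"
    proof eventually_elim
      case (elim m)
      have "real (H \<alpha> \<epsilon> m \<omega>) / real m - growth_c \<alpha> F = (real (H \<alpha> \<epsilon> m \<omega>) - growth_c \<alpha> F * real m) / real m"
        using elim by (simp add: field_simps)
      moreover have "\<bar>real (H \<alpha> \<epsilon> m \<omega>) - growth_c \<alpha> F * real m\<bar> \<le> e * (real m powr (2/5) + 1) + real m powr (3/5)"
        using elim by linarith
      ultimately show ?case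
        by (simp only: real_norm_def abs_divide abs_of_nat) (intro divide_right_mono, auto)
    qed
    then have "(\<lambda>m. real (H \<alpha> \<epsilon> m \<omega>) / real m - growth_c \<alpha> F) \<longlonglongrightarrow> 0"
      using B by (rule Lim_null_comparison)
    then show ?case by (simp add: LIM_zero_iff)
  qed
qed

theorem normal_fluctuations:
  "weak_conv_m
     (\<lambda>m. distr M borel (\<lambda>\<omega>. (real (H \<alpha> \<epsilon> m \<omega>) - growth_c \<alpha> F * real m)
        / (growth_tau \<alpha> F * sqrt \<alpha> * sqrt (real m))))
     std_normal_distribution"
proof -
  let ?\<tau> = "growth_tau \<alpha> F"
  note \<tau> = growth_tau_pos
  obtain e where e: "0 < e" "AE \<omega> in M. \<forall>\<^sub>F m in sequentially.
    \<bar>real (H \<alpha> \<epsilon> m \<omega>) - growth_c \<alpha> F * real m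
      - (\<Sum>j<n_columns m. weight (p j \<omega>) - weight_mean)\<bar> \<le> e * (real m powr (2/5) + 1)"
    using AE_H_expansion by blast
  define Y where "Y m \<omega> = (\<Sum>j<n_columns m. weight (p j \<omega>) - weight_mean)
      / sqrt (real (n_columns m) * ?\<tau>\<^sup>2)" for m \<omega>
  define Z where "Z m \<omega> = (real (H \<alpha> \<epsilon> m \<omega>) - growth_c \<alpha> F * real m) / (?\<tau> * sqrt \<alpha> * sqrt (real m))" for m \<omega>
  \<comment> \<open>The central limit theorem for the first n terms is read along
    \<open>n_columns m\<close>, which tends to infinity.\<close>
  have Y: "weak_conv_m (\<lambda>m. distr M borel (Y m)) std_normal_distribution"
    unfolding weak_conv_m_def weak_conv_def Y_def
  proof (intro allI impI)
    fix x assume "isCont (cdf std_normal_distribution) x"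
    then have "(\<lambda>n. cdf (distr M borel (\<lambda>\<omega>. (\<Sum>j<n. weight (p j \<omega>) - weight_mean) / sqrt (real n * ?\<tau>\<^sup>2))) x)
        \<longlonglongrightarrow> cdf std_normal_distribution x"
      using weak_conv_env_sum by (simp add: weak_conv_m_def weak_conv_def)
    from filterlim_compose[OF this n_columns_at_top]
    show "(\<lambda>m. cdf (distr M borel (\<lambda>\<omega>. (\<Sum>j<n_columns m. weight (p j \<omega>) - weight_mean)
        / sqrt (real (n_columns m) * ?\<tau>\<^sup>2))) x) \<longlonglongrightarrow> cdf std_normal_distribution x" .
  qed
  \<comment> \<open>The first term is the error of the expansion over m^(1/2). The second comes from
    normalizing by the number of columns instead of \<alpha> m: a sum below m^(3/5) times a
    difference of order m^(-3/2).\<close>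
  let ?B = "\<lambda>m. e * (real m powr (2/5) + 1) / (?\<tau> * sqrt \<alpha> * sqrt (real m)) +
      real m powr (3/5) * (1 / sqrt (\<alpha> * real m - 1) - 1 / sqrt (\<alpha> * real m)) / ?\<tau>"
  have "(\<lambda>m. e * (real m powr (2/5) + 1) / (t * sqrt \<alpha> * sqrt (real m)) +
      real m powr (3/5) * (1 / sqrt (\<alpha> * real m - 1) - 1 / sqrt (\<alpha> * real m)) / t) \<longlonglongrightarrow> 0"
    if "0 < t" for t
    using e(1) that \<alpha>(1) by real_asymp
  from this[OF \<tau>] have B: "?B \<longlonglongrightarrow> 0" .
  have large: "\<forall>\<^sub>F m in sequentially. 1 < \<alpha> * real m" using \<alpha>(1) by real_asymp
  have close: "AE \<omega> in M. (\<lambda>m. Z m \<omega> - Y m \<omega>) \<longlonglongrightarrow> 0"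
    using e(2) AE_weight_sum_small
  proof eventually_elim
    case (elim \<omega>)
    from elim large have "\<forall>\<^sub>F m in sequentially. norm (Z m \<omega> - Y m \<omega>) \<le> ?B m"
    proof eventually_elim
      case (elim m)
      define N where "N = real (n_columns m)"
      define S where "S = (\<Sum>j<n_columns m. weight (p j \<omega>) - weight_mean)"
      define D where "D = real (H \<alpha> \<epsilon> m \<omega>) - growth_c \<alpha> F * real m - S"
      have N: "0 < N" "\<alpha> * real m - 1 < N" "N \<le> \<alpha> * real m"
        using n_columns_bounds[of m] elim by (auto simp: N_def)
      have "sqrt \<alpha> * sqrt (real m) = sqrt (\<alpha> * real m)" by (simp add: real_sqrt_mult)
      then have den: "?\<tau> * sqrt \<alpha> * sqrt (real m) = ?\<tau> * sqrt (\<alpha> * real m)" by simp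
      have pos: "0 < sqrt (\<alpha> * real m)" "0 < sqrt N" using elim N by auto
      have ZD: "Z m \<omega> = (D + S) / (?\<tau> * sqrt (\<alpha> * real m))" by (simp add: Z_def D_def den)
      have YS: "Y m \<omega> = S / (?\<tau> * sqrt N)"
        using \<tau> by (simp add: Y_def S_def N_def real_sqrt_mult mult.commute)
      have diff: "Z m \<omega> - Y m \<omega> = D / (?\<tau> * sqrt (\<alpha> * real m)) -
          S * (1 / sqrt N - 1 / sqrt (\<alpha> * real m)) / ?\<tau>"
      proof -
        have "(D + S) / (t * x) - S / (t * y) = D / (t * x) - S * (1 / y - 1 / x) / t"
          if "0 < t" "0 < x" "0 < y" for t x y
          using that by (simp add: field_simps)
        from this[OF \<tau> pos] show ?thesis
          by (simp only: ZD YS)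
      qed
      have gap0: "0 \<le> 1 / sqrt N - 1 / sqrt (\<alpha> * real m)"
        using N pos by (simp add: frac_le)
      have gap: "1 / sqrt N - 1 / sqrt (\<alpha> * real m) \<le> 1 / sqrt (\<alpha> * real m - 1) - 1 / sqrt (\<alpha> * real m)"
        using N elim by (simp add: frac_le)
      have "\<bar>D\<bar> / (?\<tau> * sqrt (\<alpha> * real m)) \<le> e * (real m powr (2/5) + 1) / (?\<tau> * sqrt (\<alpha> * real m))"
        using elim \<tau> pos by (intro divide_right_mono) (auto simp: D_def S_def)
      moreover have "\<bar>S\<bar> * (1 / sqrt N - 1 / sqrt (\<alpha> * real m)) / ?\<tau> \<le>
          real m powr (3/5) * (1 / sqrt (\<alpha> * real m - 1) - 1 / sqrt (\<alpha> * real m)) / ?\<tau>"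
        using elim \<tau> gap gap0 by (intro divide_right_mono mult_mono) (auto simp: S_def)
      moreover have "\<bar>Z m \<omega> - Y m \<omega>\<bar> \<le> \<bar>D\<bar> / (?\<tau> * sqrt (\<alpha> * real m)) +
          \<bar>S\<bar> * (1 / sqrt N - 1 / sqrt (\<alpha> * real m)) / ?\<tau>"
      proof -
        have "\<bar>D / (?\<tau> * sqrt (\<alpha> * real m))\<bar> = \<bar>D\<bar> / (?\<tau> * sqrt (\<alpha> * real m))"
          using \<tau> pos by (simp add: abs_divide abs_mult)
        moreover have "\<bar>S * (1 / sqrt N - 1 / sqrt (\<alpha> * real m)) / ?\<tau>\<bar> =
            \<bar>S\<bar> * (1 / sqrt N - 1 / sqrt (\<alpha> * real m)) / ?\<tau>"
          using \<tau> gap0 by (simp only: abs_divide abs_mult abs_of_nonneg[OF gap0] abs_of_pos)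
        ultimately show ?thesis unfolding diff by (metis abs_triangle_ineq4)
      qed
      ultimately show ?case unfolding den by (simp only: real_norm_def)
    qed
    then show ?case using B by (rule Lim_null_comparison)
  qed
  have "weak_conv_m (\<lambda>m. distr M borel (Z m)) std_normal_distribution"
    by (rule weak_conv_m_AE_close[OF _ _ Y real_dist_normal_dist close]) (auto simp: Y_def Z_def)
  then show ?thesis by (simp add: Z_def[abs_def])
qed

end

theorem theorem2:
  fixes F :: "real \<Rightarrow> real" and \<alpha> :: real and M :: "'a measure"
    and p :: "nat \<Rightarrow> 'a \<Rightarrow> real" and \<epsilon> :: "nat \<Rightarrow> nat \<Rightarrow> 'a \<Rightarrow> bool"
  assumes "unit_interval_cdf F" and "nondegenerate_cdf F"
    and "0 < \<alpha>"
    and "disordered_array M F p \<epsilon>"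
    and "right_edge F < 1"
    and "alpha_crit' F < ennreal \<alpha>" and "ennreal \<alpha> < alpha_crit F"
  shows "(\<exists>!a. is_growth_a \<alpha> F a) \<and>
    (AE \<omega> in M. (\<lambda>m. real (H \<alpha> \<epsilon> m \<omega>) / real m) \<longlonglongrightarrow> growth_c \<alpha> F) \<and>
    weak_conv_m
      (\<lambda>m. distr M borel (\<lambda>\<omega>.
         (real (H \<alpha> \<epsilon> m \<omega>) - growth_c \<alpha> F * real m)
           / (growth_tau \<alpha> F * sqrt \<alpha> * sqrt (real m))))
      std_normal_distribution"
proof -
  interpret prob_space M using assms(4) by (simp add: disordered_array_def)
  interpret disordered M F \<alpha> p \<epsilon> by unfold_locales (fact assms)+
  show ?thesis
    using env.growth_a_exists(1)[OF \<alpha>] AE_growth_rate normal_fluctuations by blast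
qed

end
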